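(* Let $f: M \to M$ be a continuous map on a compact Riemannian manifold $M$. (a) If $\mathcal{K}$ is a nonempty weak$^*$-compact set of $f$-invariant probability measures that is empirically stochastically stable, then every $\mu\in\mathcal{K}$ is pseudo-physical. (b) A set $\mathcal{K}$ of $f$-invariant probability measures is globally empirically stochastically stable if and only if it coincides with the set of all the pseudo-physical measures of $f$.
   Context: Setting. $M$ is a compact finite-dimensional Riemannian manifold, with or without boundary; $m$ is the Lebesgue measure on $M$, i.e. the finite Borel measure obtained from the Riemannian volume; $B_\epsilon(x)$ is the open ball of radius $\epsilon$ centered at $x$. For sets $A,B\subset M$, "$A\subset B$ Lebesgue-a.e." means $m(A\setminus B)=0$. $\mathcal{M}$ is the space of Borel probability measures on $M$ with the weak$^*$ topology, and $\mathrm{dist}^*$ is a fixed metric on $\mathcal{M}$ inducing that topology; the distance from a measure to a set, or between two sets, of measures is the infimum of the pairwise distances. $\mathcal{M}_f\subset\mathcal{M}$ is the set of $f$-invariant probability measures. $\mathbb{N}^+=\{1,2,\dots\}$. Noise. For $\epsilon>0$, $x\in M$ and a Borel set $A$, let $p_\epsilon(x,A)=\dfrac{m(A\cap B_\epsilon(f(x)))}{m(B_\epsilon(f(x)))}$. The transfer operator $\mathcal{L}_\epsilon$ on the space $C^0(M,\mathbb{C})$ of continuous functions is $(\mathcal{L}_\epsilon\varphi)(x)=\int\varphi(y)\,p_\epsilon(x,dy)$; the dual operator $\mathcal{L}_\epsilon^*:\mathcal{M}\to\mathcal{M}$ is defined by $\int\varphi\,d(\mathcal{L}^*_\epsilon\mu)=\int(\mathcal{L}_\epsilon\varphi)\,d\mu$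 for all $\varphi\in C^0(M,\mathbb{C})$. The empiric stochastic probability is $\sigma_{\epsilon,n,x}=\frac1n\sum_{j=1}^n(\mathcal{L}_\epsilon^* )^j\delta_x$, where $\delta_x$ is the Dirac measure at $x$. Empiric stochastic stability of sets. For a nonempty weak$^*$-compact set $\mathcal{K}\subset\mathcal{M}$, its basin of empiric stochastic stability $\widehat A_{\mathcal{K}}$ is the set of $x\in M$ such that for every $\rho>0$ there is $N=N(\rho)$ such that for every $n\ge N$ there is $\epsilon_0=\epsilon_0(\rho,n)>0$ with $\mathrm{dist}^*(\sigma_{\epsilon,n,x},\mathcal{K})<\rho$ for all $0<\epsilon\le\epsilon_0$. A nonempty weak$^*$-compact set $\mathcal{K}\subset\mathcal{M}_f$ is empirically stochastically stable if: (1) there is a measurable set $\widehat A\subset M$ with $m(\widehat A)>0$ such that for every $\rho>0$ and every large enough $n\in\mathbb{N}^+$ (how large may depend on $\rho$) there is $\epsilon_0>0$ (which may depend on $\rho$ and $n$ but not on $x$) with $\mathrm{dist}^*(\sigma_{\epsilon,n,x},\mathcal{K})<\rho$ for all $0<\epsilon\le\epsilon_0$ and all $x\in\widehat A$; and (2) $\mathcal{K}$ is minimal in the sense that if $\mathcal{K}'\subset\mathcal{M}_f$ is nonempty and weak$^*$-compact and $\widehat A_{\mathcal{K}}\subset\widehat A_{\mathcal{K}'}$ Lebesgue-a.e., then $\mathcal{K}\subset\mathcal{K}'$. A set $\mathcal{K}\subset\mathcal{M}_f$ is globally empirically stochastically stable if it is nonempty, weak$^*$-compact, empirically stochastically stable,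 and $\widehat A_{\mathcal{K}}$ has full Lebesgue measure. Pseudo-physical measures. Let $\sigma_{n,x}=\frac1n\sum_{j=1}^n\delta_{f^j(x)}$ and let $p\omega_x\subset\mathcal{M}$ be the set of all weak$^*$ limits of convergent subsequences $\sigma_{n_i,x}$ with $n_i\to+\infty$. For $\mu\in\mathcal{M}_f$ and $\rho>0$, the $\rho$-weak basin of statistical attraction is $A_\mu^\rho=\{x\in M:\mathrm{dist}^*(p\omega_x,\{\mu\})<\rho\}$. The measure $\mu\in\mathcal{M}_f$ is pseudo-physical if $m(A_\mu^\rho)>0$ for every $\rho>0$. *)

theory Defs
  imports "HOL-Probability.Probability"
begin

section \<open>Compact Riemannian manifolds with or without boundary\<close>

primrec Ck_on :: "nat \<Rightarrow> (real^'n) set \<Rightarrow> (real^'n \<Rightarrow> 'b::real_normed_vector) \<Rightarrow> bool" where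
  "Ck_on 0 W h \<longleftrightarrow> continuous_on W h"
| "Ck_on (Suc k) W h \<longleftrightarrow>
     (\<forall>p\<in>W. h differentiable (at p)) \<and> (\<forall>v. Ck_on k W (\<lambda>p. frechet_derivative h (at p) v))"

text \<open>On a set that need not be open (a relatively open subset of a half-space), smoothness means
  local extendability to a smooth function on an open set.\<close>

definition smooth_on :: "(real^'n) set \<Rightarrow> (real^'n \<Rightarrow> 'b::real_normed_vector) \<Rightarrow> bool" where
  "smooth_on S h \<longleftrightarrow>
     (\<forall>p\<in>S. \<exists>W h'. open W \<and> p \<in> W \<and> (\<forall>k. Ck_on k W h') \<and> (\<forall>q\<in>S \<inter> W. h' q = h q))"

text \<open>A chart is a pair of its domain and its coordinate map. Its image is a relatively open subset
  of the whole space or of a closed coordinate half-space.\<close>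

type_synonym ('a, 'n) chart = "'a set \<times> ('a \<Rightarrow> real^'n)"

definition is_chart :: "('a::topological_space, 'n::finite) chart \<Rightarrow> bool" where
  "is_chart c \<longleftrightarrow> (case c of (U, \<phi>) \<Rightarrow>
     open U \<and> homeomorphism U (\<phi> ` U) \<phi> (inv_into U \<phi>) \<and>
     (\<exists>C\<in>insert UNIV (range (\<lambda>i. {v. 0 \<le> v $ i})). openin (top_of_set C) (\<phi> ` U)))"

definition transition :: "('a, 'n) chart \<Rightarrow> ('a, 'n) chart \<Rightarrow> real^'n \<Rightarrow> real^'n" where
  "transition c c' = snd c' \<circ> inv_into (fst c) (snd c)"

definition smooth_atlas :: "('a::topological_space, 'n::finite) chart set \<Rightarrow> bool" where
  "smooth_atlas \<A> \<longleftrightarrow>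
     (\<forall>c\<in>\<A>. is_chart c) \<and> (\<Union>c\<in>\<A>. fst c) = UNIV \<and>
     (\<forall>c\<in>\<A>. \<forall>c'\<in>\<A>. smooth_on (snd c ` (fst c \<inter> fst c')) (transition c c'))"

text \<open>A Riemannian metric is given by its local expressions: \<open>g c p\<close> is the inner product on the
  tangent space, in the coordinates of the chart \<open>c\<close>, at the point with coordinates \<open>p\<close>.
  The last clause is the transformation law of covariant 2-tensors. At boundary points the one-sided
  derivative is taken.\<close>

type_synonym ('a, 'n) local_metric = "('a, 'n) chart \<Rightarrow> real^'n \<Rightarrow> real^'n \<Rightarrow> real^'n \<Rightarrow> real"

definition riemannian_metric ::
    "('a::topological_space, 'n::finite) chart set \<Rightarrow> ('a, 'n) local_metric \<Rightarrow> bool" where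
  "riemannian_metric \<A> g \<longleftrightarrow>
     (\<forall>c\<in>\<A>. \<forall>p\<in>snd c ` fst c.
        bilinear (g c p) \<and> (\<forall>u v. g c p u v = g c p v u) \<and> (\<forall>v. v \<noteq> 0 \<longrightarrow> 0 < g c p v v)) \<and>
     (\<forall>c\<in>\<A>. \<forall>u v. smooth_on (snd c ` fst c) (\<lambda>p. g c p u v)) \<and>
     (\<forall>c\<in>\<A>. \<forall>c'\<in>\<A>. \<forall>p\<in>snd c ` (fst c \<inter> fst c'). \<forall>D.
        (transition c c' has_derivative D) (at p within snd c ` (fst c \<inter> fst c')) \<longrightarrow>
        (\<forall>u v. g c p u v = g c' (transition c c' p) (D u) (D v)))"

text \<open>The class constraints in \<open>compact_riemannian_manifold\<close> and the charts make the type \<open>'a\<close> a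
  second countable Hausdorff manifold of dimension \<open>CARD('n)\<close>. It need not be connected.\<close>

definition compact_riemannian_manifold ::
    "('a::{t2_space,second_countable_topology}, 'n::finite) chart set \<Rightarrow> ('a, 'n) local_metric \<Rightarrow> bool" where
  "compact_riemannian_manifold \<A> g \<longleftrightarrow>
     compact (UNIV :: 'a set) \<and> smooth_atlas \<A> \<and> riemannian_metric \<A> g"

text \<open>\<open>curve_length \<A> g x y l\<close>: some piecewise \<open>C\<^sup>1\<close> curve from \<open>x\<close> to \<open>y\<close> has length \<open>l\<close>.
  Such a curve is a finite concatenation of \<open>C\<^sup>1\<close> arcs \<open>\<gamma>\<close>, each inside one chart domain and
  parametrised by \<open>{0..1}\<close>; \<open>w\<close> is the velocity of \<open>\<gamma>\<close> in that chart.\<close>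

inductive curve_length ::
    "('a, 'n::finite) chart set \<Rightarrow> ('a, 'n) local_metric \<Rightarrow> 'a \<Rightarrow> 'a \<Rightarrow> real \<Rightarrow> bool"
  for \<A> g where
  stationary: "curve_length \<A> g x x 0"
| append: "curve_length \<A> g x (\<gamma> 1)
      (l + integral {0..1} (\<lambda>t. sqrt (g c (snd c (\<gamma> t)) (w t) (w t))))"
  if "curve_length \<A> g x (\<gamma> 0) l" and "c \<in> \<A>" and "\<gamma> ` {0..1} \<subseteq> fst c"
    and "\<And>t. t \<in> {0..1} \<Longrightarrow> ((\<lambda>s. snd c (\<gamma> s)) has_vector_derivative w t) (at t within {0..1})"
    and "continuous_on {0..1} w"
  for \<gamma> :: "real \<Rightarrow> 'a" and w :: "real \<Rightarrow> real^'n"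

text \<open>The distance is infinite between different connected components.\<close>

definition riemannian_dist ::
    "('a, 'n::finite) chart set \<Rightarrow> ('a, 'n) local_metric \<Rightarrow> 'a \<Rightarrow> 'a \<Rightarrow> ennreal" where
  "riemannian_dist \<A> g x y = (INF l\<in>{l. curve_length \<A> g x y l}. ennreal l)"

definition riemannian_ball ::
    "('a, 'n::finite) chart set \<Rightarrow> ('a, 'n) local_metric \<Rightarrow> 'a \<Rightarrow> real \<Rightarrow> 'a set" where
  "riemannian_ball \<A> g x \<epsilon> = {y. riemannian_dist \<A> g x y < ennreal \<epsilon>}"

text \<open>The Riemannian volume is the unique Borel measure with density \<open>sqrt (det (g\<^sub>i\<^sub>j))\<close> in every
  chart.\<close>

definition gram_matrix :: "('a, 'n::finite) local_metric \<Rightarrow> ('a, 'n) chart \<Rightarrow> real^'n \<Rightarrow> real^'n^'n" where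
  "gram_matrix g c p = (\<chi> i j. g c p (axis i 1) (axis j 1))"

definition riemannian_volume ::
    "('a::topological_space, 'n::finite) chart set \<Rightarrow> ('a, 'n) local_metric \<Rightarrow> 'a measure \<Rightarrow> bool" where
  "riemannian_volume \<A> g m \<longleftrightarrow>
     sets m = sets borel \<and>
     (\<forall>c\<in>\<A>. \<forall>B\<in>sets borel. B \<subseteq> fst c \<longrightarrow>
        emeasure m B = (\<integral>\<^sup>+p. ennreal (sqrt (det (gram_matrix g c p))) * indicator (snd c ` B) p \<partial>lborel))"

section \<open>Spaces of measures\<close>

definition prob_measures :: "('a::topological_space) measure set" where
  "prob_measures = {\<mu>. sets \<mu> = sets borel \<and> prob_space \<mu>}"

definition invariant_measures :: "('a::topological_space \<Rightarrow> 'a) \<Rightarrow> 'a measure set" where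
  "invariant_measures f = {\<mu>\<in>prob_measures. distr \<mu> borel f = \<mu>}"

text \<open>The coarsest topology on the probability measures that makes integration of every continuous
  function continuous.\<close>

definition weak_star_topology :: "('a::topological_space) measure topology" where
  "weak_star_topology = topology_generated_by
     {{\<mu>\<in>prob_measures. (\<integral>x. \<phi> x \<partial>\<mu>) \<in> V} |\<phi> V.
        continuous_on UNIV (\<phi> :: 'a \<Rightarrow> complex) \<and> open V}"

definition induces_weak_star :: "(('a::topological_space) measure \<Rightarrow> 'a measure \<Rightarrow> real) \<Rightarrow> bool" where
  "induces_weak_star d \<longleftrightarrow>
     Metric_space prob_measures d \<and> Metric_space.mtopology prob_measures d = weak_star_topology"

definition set_distance :: "('b \<Rightarrow> 'b \<Rightarrow> real) \<Rightarrow> 'b set \<Rightarrow> 'b set \<Rightarrow> real" where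
  "set_distance d A B = Inf {d a b |a b. a \<in> A \<and> b \<in> B}"

definition average_measure :: "nat \<Rightarrow> (nat \<Rightarrow> 'a measure) \<Rightarrow> ('a::topological_space) measure" where
  "average_measure n \<nu> =
     measure_of UNIV (sets borel) (\<lambda>A. (\<Sum>j=1..n. emeasure (\<nu> j) A) / of_nat n)"

definition full_measure :: "'a measure \<Rightarrow> 'a set \<Rightarrow> bool" where
  "full_measure m A \<longleftrightarrow> space m - A \<in> null_sets m"

definition subset_ae :: "'a measure \<Rightarrow> 'a set \<Rightarrow> 'a set \<Rightarrow> bool" where
  "subset_ae m A B \<longleftrightarrow> A - B \<in> null_sets m"

section \<open>Pseudo-physical measures\<close>

definition empiric :: "('a::topological_space \<Rightarrow> 'a) \<Rightarrow> nat \<Rightarrow> 'a \<Rightarrow> 'a measure" where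
  "empiric f n x = average_measure n (\<lambda>j. return borel ((f ^^ j) x))"

definition p_omega :: "('a::topological_space \<Rightarrow> 'a) \<Rightarrow> 'a \<Rightarrow> 'a measure set" where
  "p_omega f x =
     {\<mu>. \<exists>r. strict_mono r \<and> limitin weak_star_topology (\<lambda>i. empiric f (r i) x) \<mu> sequentially}"

definition weak_basin ::
    "('a::topological_space measure \<Rightarrow> 'a measure \<Rightarrow> real) \<Rightarrow> ('a \<Rightarrow> 'a) \<Rightarrow> 'a measure \<Rightarrow> real \<Rightarrow> 'a set" where
  "weak_basin d f \<mu> \<rho> = {x. set_distance d (p_omega f x) {\<mu>} < \<rho>}"

definition pseudo_physical ::
    "('a::topological_space measure \<Rightarrow> 'a measure \<Rightarrow> real) \<Rightarrow> 'a measure \<Rightarrow> ('a \<Rightarrow> 'a) \<Rightarrow> 'a measure \<Rightarrow> bool" where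
  "pseudo_physical d m f \<mu> \<longleftrightarrow>
     \<mu> \<in> invariant_measures f \<and> (\<forall>\<rho>>0. 0 < emeasure m (weak_basin d f \<mu> \<rho>))"

section \<open>Noise and empiric stochastic stability\<close>

text \<open>The parameter \<open>b\<close> stands for the balls of the manifold: \<open>b x \<epsilon>\<close> is the open ball of centre \<open>x\<close>
  and radius \<open>\<epsilon>\<close>.\<close>

definition noise_kernel ::
    "('a \<Rightarrow> real \<Rightarrow> 'a set) \<Rightarrow> 'a measure \<Rightarrow> ('a \<Rightarrow> 'a) \<Rightarrow> real \<Rightarrow> 'a \<Rightarrow> 'a measure" where
  "noise_kernel b m f \<epsilon> x = uniform_measure m (b (f x) \<epsilon>)"

definition transfer ::
    "('a \<Rightarrow> real \<Rightarrow> 'a set) \<Rightarrow> 'a measure \<Rightarrow> ('a \<Rightarrow> 'a) \<Rightarrow> real \<Rightarrow> ('a \<Rightarrow> complex) \<Rightarrow> 'a \<Rightarrow> complex" where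
  "transfer b m f \<epsilon> \<phi> x = (\<integral>y. \<phi> y \<partial>noise_kernel b m f \<epsilon> x)"

definition dual_transfer ::
    "('a::topological_space \<Rightarrow> real \<Rightarrow> 'a set) \<Rightarrow> 'a measure \<Rightarrow> ('a \<Rightarrow> 'a) \<Rightarrow> real \<Rightarrow> 'a measure \<Rightarrow> 'a measure" where
  "dual_transfer b m f \<epsilon> \<mu> =
     (THE \<nu>. \<nu> \<in> prob_measures \<and>
        (\<forall>\<phi>. continuous_on UNIV \<phi> \<longrightarrow> (\<integral>x. \<phi> x \<partial>\<nu>) = (\<integral>x. transfer b m f \<epsilon> \<phi> x \<partial>\<mu>)))"

definition empiric_stochastic ::
    "('a::topological_space \<Rightarrow> real \<Rightarrow> 'a set) \<Rightarrow> 'a measure \<Rightarrow> ('a \<Rightarrow> 'a) \<Rightarrow> real \<Rightarrow> nat \<Rightarrow> 'a \<Rightarrow> 'a measure" where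
  "empiric_stochastic b m f \<epsilon> n x =
     average_measure n (\<lambda>j. (dual_transfer b m f \<epsilon> ^^ j) (return borel x))"

definition stochastic_basin ::
    "('a::topological_space measure \<Rightarrow> 'a measure \<Rightarrow> real) \<Rightarrow> ('a \<Rightarrow> real \<Rightarrow> 'a set) \<Rightarrow> 'a measure \<Rightarrow>
     ('a \<Rightarrow> 'a) \<Rightarrow> 'a measure set \<Rightarrow> 'a set" where
  "stochastic_basin d b m f K =
     {x. \<forall>\<rho>>0. \<exists>N. \<forall>n\<ge>N. \<exists>\<epsilon>\<^sub>0>0. \<forall>\<epsilon>. 0 < \<epsilon> \<and> \<epsilon> \<le> \<epsilon>\<^sub>0 \<longrightarrow>
           set_distance d {empiric_stochastic b m f \<epsilon> n x} K < \<rho>}"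

definition stochastically_stable ::
    "('a::topological_space measure \<Rightarrow> 'a measure \<Rightarrow> real) \<Rightarrow> ('a \<Rightarrow> real \<Rightarrow> 'a set) \<Rightarrow> 'a measure \<Rightarrow>
     ('a \<Rightarrow> 'a) \<Rightarrow> 'a measure set \<Rightarrow> bool" where
  "stochastically_stable d b m f K \<longleftrightarrow>
     K \<noteq> {} \<and> K \<subseteq> invariant_measures f \<and> compactin weak_star_topology K \<and>
     (\<exists>A\<in>sets m. 0 < emeasure m A \<and>
        (\<forall>\<rho>>0. \<exists>N. \<forall>n\<ge>N. \<exists>\<epsilon>\<^sub>0>0. \<forall>\<epsilon>. 0 < \<epsilon> \<and> \<epsilon> \<le> \<epsilon>\<^sub>0 \<longrightarrow>
           (\<forall>x\<in>A. set_distance d {empiric_stochastic b m f \<epsilon> n x} K < \<rho>))) \<and>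
     (\<forall>K'. K' \<noteq> {} \<and> K' \<subseteq> invariant_measures f \<and> compactin weak_star_topology K' \<and>
        subset_ae m (stochastic_basin d b m f K) (stochastic_basin d b m f K') \<longrightarrow> K \<subseteq> K')"

definition globally_stochastically_stable ::
    "('a::topological_space measure \<Rightarrow> 'a measure \<Rightarrow> real) \<Rightarrow> ('a \<Rightarrow> real \<Rightarrow> 'a set) \<Rightarrow> 'a measure \<Rightarrow>
     ('a \<Rightarrow> 'a) \<Rightarrow> 'a measure set \<Rightarrow> bool" where
  "globally_stochastically_stable d b m f K \<longleftrightarrow>
     stochastically_stable d b m f K \<and> full_measure m (stochastic_basin d b m f K)"

end

theory Submission
  imports Defs
begin

text \<open>Noise of radius \<open>e\<close> moves the transfer operator only slightly away from composition with \<open>f\<close>: the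
averages of a continuous function over the balls of radius \<open>e\<close> converge to the function uniformly.
Transfer operators do not increase the supremum norm, so the same holds for every fixed number of
steps, and for a fixed \<open>n\<close> the noisy empiric measures of length \<open>n\<close> converge to the noiseless ones
as \<open>e\<close> tends to \<open>0\<close>, uniformly in the starting point (\<open>noisy_emp_uniform\<close>). Since \<open>n\<close> is chosen before
the noise level, the noise disappears from the definitions: the basin of stochastic stability of a
compact set \<open>K\<close> is the set of points all of whose limit measures lie in \<open>K\<close>
(\<open>stochastic_basin_eq\<close>).

The theorem is thereby one on deterministic limit measures. The set of pseudo-physical measures is
compact, attracts Lebesgue almost every orbit (\<open>physical_attracts_almost_all\<close>), and is contained in
every compact set that attracts almost every orbit (\<open>physical_minimal\<close>). If a stable set \<open>K\<close>
contained a measure \<open>\<mu>\<close> that is not pseudo-physical, almost no orbit would accumulate within some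
distance \<open>\<rho>\<close> of \<open>\<mu>\<close>; removing the ball of radius \<open>\<rho>\<close> around \<open>\<mu>\<close> from \<open>K\<close> would leave a smaller compact
set with the same basin up to a null set, against the minimality of \<open>K\<close>. This is the first part
of the theorem, and one inclusion between a globally stable set and the set of pseudo-physical
measures; the other inclusion is \<open>physical_minimal\<close>. Conversely, the set of pseudo-physical measures
is globally stable: it attracts almost every orbit and is minimal, and an Egorov argument makes the
attraction uniform on a set of positive volume (\<open>uniformly_attracted_set\<close>).

Two foundations are laid first. From the geometry one needs that the relation \<open>dist x y < e\<close> is open,
that the balls around the points near \<open>x\<close> are uniformly small in the manifold topology, and that the
volume is finite and positive on nonempty open sets. From measure theory one needs that the
probability measures on a compact space are sequentially compact
(\<open>prob_measures_sequentially_compact\<close>); this is deduced from Helly's theorem on the real line by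
coding the points of the space as real numbers. That measures are determined by the integrals of
continuous functions is read off from the metrizability of the weak* topology.\<close>

section \<open>Smooth functions and positive definite matrices\<close>

lemma smooth_on_imp_continuous_on:
  assumes "smooth_on S h"
  shows "continuous_on S h"
  unfolding continuous_on_def
proof
  fix p assume "p \<in> S"
  then obtain W h' where W: "open W" "p \<in> W" and C: "\<And>k. Ck_on k W h'" and eq: "\<And>q. q \<in> S \<inter> W \<Longrightarrow> h' q = h q"
    using assms unfolding smooth_on_def by metis
  have "continuous_on W h'" using C[of 0] by simp
  then have "(h' \<longlongrightarrow> h' p) (at p within S)"
    using W by (metis continuous_on_eq_continuous_at isCont_def tendsto_within_subset subset_UNIV)
  moreover have "\<forall>\<^sub>F q in at p within S. h' q = h q"
    unfolding eventually_at_topological using W eq by blast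
  ultimately show "(h \<longlongrightarrow> h p) (at p within S)"
    using eq[of p] \<open>p \<in> S\<close> W(2) tendsto_cong by fastforce
qed

lemma smooth_on_has_derivative:
  assumes "smooth_on S h" "p \<in> S"
  obtains D where "(h has_derivative D) (at p within S)"
proof -
  obtain W h' where W: "open W" "p \<in> W" and C: "\<And>k. Ck_on k W h'" and eq: "\<And>q. q \<in> S \<inter> W \<Longrightarrow> h' q = h q"
    using assms unfolding smooth_on_def by metis
  have "h' differentiable (at p)" using C[of "Suc 0"] W by simp
  then have "(h' has_derivative frechet_derivative h' (at p)) (at p within S)"
    by (meson frechet_derivative_works has_derivative_at_withinI)
  moreover have "\<forall>\<^sub>F q in at p within S. h' q = h q"
    unfolding eventually_at_topological using W eq by blast
  ultimately have "(h has_derivative frechet_derivative h' (at p)) (at p within S)"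
    by (rule has_derivative_transform_eventually) (use eq assms W in auto)
  then show ?thesis by (rule that)
qed

text \<open>All matrices on the segment from the identity to \<open>A\<close> are positive definite, hence invertible. The
determinant thus has no zero on the segment, and it starts at \<open>1\<close>.\<close>

lemma det_pos_of_positive_definite:
  fixes A :: "real^'n^'n"
  assumes "\<And>v. v \<noteq> 0 \<Longrightarrow> 0 < v \<bullet> (A *v v)"
  shows "0 < det A"
proof (rule ccontr)
  assume "\<not> 0 < det A"
  define H :: "real \<Rightarrow> real^'n^'n" where "H t = (1 - t) *\<^sub>R mat 1 + t *\<^sub>R A" for t
  have nz: "det (H t) \<noteq> 0" if "0 \<le> t" "t \<le> 1" for t
  proof -
    have "v = 0" if "H t *v v = 0" for v
    proof (rule ccontr)
      assume "v \<noteq> 0"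
      have "H t *v v = (1 - t) *\<^sub>R v + t *\<^sub>R (A *v v)"
        by (simp add: H_def matrix_vector_mult_add_rdistrib scaleR_matrix_vector_assoc[symmetric])
      then have "v \<bullet> (H t *v v) = (1 - t) * (v \<bullet> v) + t * (v \<bullet> (A *v v))"
        by (simp add: inner_add_right)
      moreover have "0 < (1 - t) * (v \<bullet> v) + t * (v \<bullet> (A *v v))"
        using \<open>0 \<le> t\<close> \<open>t \<le> 1\<close> \<open>v \<noteq> 0\<close> assms[OF \<open>v \<noteq> 0\<close>]
        by (cases "t = 0") (auto intro!: add_nonneg_pos mult_nonneg_nonneg mult_pos_pos)
      ultimately show False using that by simp
    qed
    then have "invertible (H t)"
      unfolding invertible_left_inverse matrix_left_invertible_ker by blast
    then show ?thesis by (simp add: invertible_det_nz)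
  qed
  have "continuous_on {0..1} (\<lambda>t. det (H t))"
    unfolding det_def H_def by (intro continuous_intros)
  then have "\<exists>t\<ge>0. t \<le> 1 \<and> det (H t) = 0"
    using \<open>\<not> 0 < det A\<close> by (intro IVT2') (auto simp: H_def)
  with nz show False by blast
qed

text \<open>Relatively open subsets of a model half-space have interior points, even near the boundary. This
gives them positive Lebesgue measure.\<close>

lemma half_space_contains_balls:
  fixes p :: "real^'n"
  assumes "C \<in> insert UNIV (range (\<lambda>i. {v. 0 \<le> v $ i}))" "p \<in> C" "0 < r"
  obtains q where "cball q (r/4) \<subseteq> ball p r \<inter> C"
proof (cases "C = UNIV")
  case True
  then show ?thesis using assms(3) by (intro that[of p]) auto
next
  case False
  then obtain i where C: "C = {v. 0 \<le> v $ i}" using assms(1) by blast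
  \<comment> \<open>the centre is moved inwards, orthogonally to the boundary\<close>
  let ?q = "p + (r/2) *\<^sub>R axis i 1"
  have "v \<in> ball p r \<inter> C" if "v \<in> cball ?q (r/4)" for v
  proof
    have "norm (v - ?q) \<le> r/4" using that by (simp add: dist_norm norm_minus_commute)
    moreover have "norm ((r/2) *\<^sub>R axis i 1 :: real^'n) = r/2" using assms(3) by simp
    ultimately show "v \<in> ball p r"
      using norm_triangle_ineq[of "v - ?q" "(r/2) *\<^sub>R axis i 1"] assms(3) by (simp add: dist_norm norm_minus_commute)
    have "\<bar>(v - ?q) $ i\<bar> \<le> r/4" using component_le_norm_cart[of "v - ?q" i] \<open>norm (v - ?q) \<le> r/4\<close> by linarith
    moreover have "(v - ?q) $ i = v $ i - p $ i - r/2" by (simp add: axis_def)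
    moreover have "0 \<le> p $ i" using assms(2) C by simp
    ultimately have "0 \<le> v $ i" using assms(3) by linarith
    then show "v \<in> C" using C by simp
  qed
  then show ?thesis by (intro that[of ?q]) blast
qed

section \<open>Charts and the local metric\<close>

locale riemannian =
  fixes \<A> :: "('a::{t2_space,second_countable_topology}, 'n::finite) chart set"
    and g :: "('a, 'n) local_metric"
  assumes manifold: "compact_riemannian_manifold \<A> g"
begin

abbreviation coords :: "('a, 'n) chart \<Rightarrow> 'a \<Rightarrow> real^'n" where "coords \<equiv> snd"

abbreviation param :: "('a, 'n) chart \<Rightarrow> real^'n \<Rightarrow> 'a" where
  "param c \<equiv> inv_into (fst c) (snd c)"

lemma chart_cover: obtains c where "c \<in> \<A>" "x \<in> fst c"
proof -
  have "x \<in> (\<Union>c\<in>\<A>. fst c)"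
    using manifold by (simp add: compact_riemannian_manifold_def smooth_atlas_def)
  then show ?thesis using that by blast
qed

lemma
  assumes "c \<in> \<A>"
  shows open_chart: "open (fst c)"
    and homeo_chart: "homeomorphism (fst c) (coords c ` fst c) (coords c) (param c)"
    and model_chart: "\<exists>C\<in>insert UNIV (range (\<lambda>i. {v. 0 \<le> v $ i})). openin (top_of_set C) (coords c ` fst c)"
proof -
  have "is_chart c"
    using manifold assms by (simp add: compact_riemannian_manifold_def smooth_atlas_def)
  then show "open (fst c)" "homeomorphism (fst c) (coords c ` fst c) (coords c) (param c)"
    "\<exists>C\<in>insert UNIV (range (\<lambda>i. {v. 0 \<le> v $ i})). openin (top_of_set C) (coords c ` fst c)"
    by (simp_all add: is_chart_def split_beta)
qed

lemma continuous_coords: "c \<in> \<A> \<Longrightarrow> continuous_on (fst c) (coords c)"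
  using homeo_chart[of c] unfolding homeomorphism_def by simp

lemma continuous_param: "c \<in> \<A> \<Longrightarrow> continuous_on (coords c ` fst c) (param c)"
  using homeo_chart[of c] unfolding homeomorphism_def by simp

lemma param_coords: "c \<in> \<A> \<Longrightarrow> x \<in> fst c \<Longrightarrow> param c (coords c x) = x"
  using homeo_chart[of c] unfolding homeomorphism_def by simp

lemma coords_param: "c \<in> \<A> \<Longrightarrow> p \<in> coords c ` fst c \<Longrightarrow> param c p \<in> fst c \<and> coords c (param c p) = p"
  by (simp add: f_inv_into_f inv_into_into)

lemma open_chart_ball: "c \<in> \<A> \<Longrightarrow> open {x \<in> fst c. dist p (coords c x) < r}"
  using continuous_on_open_vimage[THEN iffD1, OF open_chart continuous_coords, rule_format, of c "ball p r"]
  by (simp add: vimage_def Int_def conj_commute)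

text \<open>In the coordinates of a chart, a neighbourhood of a point contains the part of a closed ball in
the model space \<open>C\<close>. Such a part is compact and convex, so the metric has bounds on it and it contains
the segments between its points.\<close>

lemma chart_box:
  assumes c: "c \<in> \<A>" and x: "x \<in> fst c" and G: "open G" "x \<in> G"
  obtains C r where "C \<in> insert UNIV (range (\<lambda>i. {v. 0 \<le> v $ i}))" "convex C" "closed C"
    "coords c ` fst c \<subseteq> C" "0 < r" "cball (coords c x) r \<inter> C \<subseteq> coords c ` (fst c \<inter> G)"
proof -
  obtain C where C: "C \<in> insert UNIV (range (\<lambda>i. {v. 0 \<le> v $ i}))" "openin (top_of_set C) (coords c ` fst c)"
    using model_chart[OF c] by blast
  have "convex C" using C(1) by (auto intro!: convexI simp: convex_bound_le)
  have "closed C" using C(1) by (auto intro!: closed_Collect_le continuous_intros)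
  have "openin (top_of_set (fst c)) (fst c \<inter> G)" using G(1) by blast
  then have "openin (top_of_set (coords c ` fst c)) (coords c ` (fst c \<inter> G))"
    using homeomorphism_imp_open_map[OF homeo_chart[OF c]] by blast
  then have "openin (top_of_set C) (coords c ` (fst c \<inter> G))"
    using C(2) by (rule openin_trans)
  moreover have "coords c x \<in> coords c ` (fst c \<inter> G)" using x G by blast
  ultimately obtain r where "0 < r" "cball (coords c x) r \<inter> C \<subseteq> coords c ` (fst c \<inter> G)"
    unfolding openin_contains_cball by blast
  moreover have "coords c ` fst c \<subseteq> C" using C(2) openin_imp_subset by blast
  ultimately show ?thesis using C(1) \<open>convex C\<close> \<open>closed C\<close> by (intro that[of C r])
qed

lemma
  assumes "c \<in> \<A>" "p \<in> coords c ` fst c"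
  shows bilinear_metric: "bilinear (g c p)"
    and metric_pos: "v \<noteq> 0 \<Longrightarrow> 0 < g c p v v"
proof -
  have "bilinear (g c p) \<and> (\<forall>u v. g c p u v = g c p v u) \<and> (\<forall>v. v \<noteq> 0 \<longrightarrow> 0 < g c p v v)"
    using manifold assms unfolding compact_riemannian_manifold_def riemannian_metric_def by blast
  then show "bilinear (g c p)" "v \<noteq> 0 \<Longrightarrow> 0 < g c p v v" by simp_all
qed

lemma metric_nonneg: "c \<in> \<A> \<Longrightarrow> p \<in> coords c ` fst c \<Longrightarrow> 0 \<le> g c p v v"
  using metric_pos[of c p v] bilinear_lzero[OF bilinear_metric, of c p v] by (cases "v = 0") auto

lemma metric_expansion:
  assumes "c \<in> \<A>" "p \<in> coords c ` fst c"
  shows "g c p u v = (\<Sum>i\<in>UNIV. \<Sum>j\<in>UNIV. u $ i * v $ j * g c p (axis i 1) (axis j 1))"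
proof -
  have u: "u = (\<Sum>i\<in>UNIV. (u $ i) *\<^sub>R axis i 1)" for u :: "real^'n"
    using basis_expansion[of u] by (simp add: scalar_mult_eq_scaleR)
  have "g c p u v = g c p (\<Sum>i\<in>UNIV. (u $ i) *\<^sub>R axis i 1) (\<Sum>j\<in>UNIV. (v $ j) *\<^sub>R axis j 1)"
    using u[of u] u[of v] by simp
  also have "\<dots> = (\<Sum>(i,j)\<in>UNIV \<times> UNIV. g c p ((u $ i) *\<^sub>R axis i 1) ((v $ j) *\<^sub>R axis j 1))"
    by (rule bilinear_sum[OF bilinear_metric[OF assms]])
  also have "\<dots> = (\<Sum>i\<in>UNIV. \<Sum>j\<in>UNIV. u $ i * v $ j * g c p (axis i 1) (axis j 1))"
    by (simp add: sum.cartesian_product bilinear_lmul[OF bilinear_metric[OF assms]]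
        bilinear_rmul[OF bilinear_metric[OF assms]] mult.assoc mult.left_commute)
  finally show ?thesis .
qed

lemma continuous_metric_coefficient: "c \<in> \<A> \<Longrightarrow> continuous_on (coords c ` fst c) (\<lambda>p. g c p u v)"
proof -
  assume "c \<in> \<A>"
  then have "smooth_on (coords c ` fst c) (\<lambda>p. g c p u v)"
    using manifold unfolding compact_riemannian_manifold_def riemannian_metric_def by blast
  then show ?thesis by (rule smooth_on_imp_continuous_on)
qed

lemma continuous_metric:
  assumes "c \<in> \<A>"
  shows "continuous_on (coords c ` fst c \<times> UNIV) (\<lambda>z. g c (fst z) (snd z) (snd z))"
proof -
  have "continuous_on (coords c ` fst c \<times> UNIV) (\<lambda>z. g c (fst z) (axis i 1) (axis j 1))" for i j
    by (rule continuous_on_compose2[OF continuous_metric_coefficient[OF assms]]) (auto intro: continuous_intros)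
  then have "continuous_on (coords c ` fst c \<times> UNIV)
      (\<lambda>z. \<Sum>i\<in>UNIV. \<Sum>j\<in>UNIV. snd z $ i * snd z $ j * g c (fst z) (axis i 1) (axis j 1))"
    by (intro continuous_intros)
  then show ?thesis
    by (rule continuous_on_eq) (use metric_expansion[OF assms] in auto)
qed

text \<open>Unit vectors at the points of a compact set form a compact set, on which the continuous positive
function \<open>g c p v v\<close> attains a positive minimum and a maximum; homogeneity extends the bounds to all
vectors.\<close>

lemma metric_comparison:
  assumes "c \<in> \<A>" "compact K" "K \<subseteq> coords c ` fst c"
  obtains a b where "0 < a" "0 < b"
    "\<And>p v. p \<in> K \<Longrightarrow> a * norm v \<le> sqrt (g c p v v) \<and> sqrt (g c p v v) \<le> b * norm v"
proof (cases "K = {}")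
  case True
  then show ?thesis using that[of 1 1] by simp
next
  case False
  let ?S = "sphere 0 1 :: (real^'n) set"
  have "axis undefined 1 \<in> ?S" by simp
  then have ne: "K \<times> ?S \<noteq> {}" using False by blast
  have cpt: "compact (K \<times> ?S)" using assms(2) by (intro compact_Times) simp_all
  have cont: "continuous_on (K \<times> ?S) (\<lambda>z. g c (fst z) (snd z) (snd z))"
    by (rule continuous_on_subset[OF continuous_metric[OF assms(1)]]) (use assms(3) in auto)
  obtain z where z: "z \<in> K \<times> ?S" "\<And>y. y \<in> K \<times> ?S \<Longrightarrow> g c (fst z) (snd z) (snd z) \<le> g c (fst y) (snd y) (snd y)"
    using continuous_attains_inf[OF cpt ne cont] by metis
  obtain z' where z': "z' \<in> K \<times> ?S" "\<And>y. y \<in> K \<times> ?S \<Longrightarrow> g c (fst y) (snd y) (snd y) \<le> g c (fst z') (snd z') (snd z')"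
    using continuous_attains_sup[OF cpt ne cont] by metis
  let ?a = "g c (fst z) (snd z) (snd z)" and ?b = "g c (fst z') (snd z') (snd z')"
  have "snd z \<noteq> 0" using z(1) by auto
  then have a: "0 < ?a" using z(1) assms by (intro metric_pos) auto
  then have b: "0 < ?b" using z'(2)[OF z(1)] by simp
  have "sqrt ?a * norm v \<le> sqrt (g c p v v) \<and> sqrt (g c p v v) \<le> sqrt ?b * norm v" if p: "p \<in> K" for p v
  proof (cases "v = 0")
    case True
    have "bilinear (g c p)" using bilinear_metric assms p by blast
    with True show ?thesis by (simp add: bilinear_lzero)
  next
    case False
    have bil: "bilinear (g c p)" using bilinear_metric assms p by blast
    have "g c p v v = g c p (norm v *\<^sub>R sgn v) (norm v *\<^sub>R sgn v)"
      by (simp add: sgn_div_norm False)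
    also have "\<dots> = (norm v)\<^sup>2 * g c p (sgn v) (sgn v)"
      unfolding bilinear_lmul[OF bil] bilinear_rmul[OF bil] by (simp add: power2_eq_square)
    finally have s: "sqrt (g c p v v) = norm v * sqrt (g c p (sgn v) (sgn v))"
      by (simp add: real_sqrt_mult)
    have "(p, sgn v) \<in> K \<times> ?S" using p False by (simp add: norm_sgn)
    from z(2)[OF this] z'(2)[OF this] show ?thesis
      unfolding s by (simp add: mult.commute mult_left_mono)
  qed
  then show ?thesis using a b by (intro that[of "sqrt ?a" "sqrt ?b"]) auto
qed

section \<open>The topology of the Riemannian distance\<close>

lemma continuous_speed:
  assumes "c \<in> \<A>" "continuous_on T p" "continuous_on T w" "p ` T \<subseteq> coords c ` fst c"
  shows "continuous_on T (\<lambda>t. sqrt (g c (p t) (w t) (w t)))"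
proof -
  have "continuous_on T (\<lambda>t. (\<lambda>z. g c (fst z) (snd z) (snd z)) (p t, w t))"
    by (rule continuous_on_compose2[OF continuous_metric[OF assms(1)]]) (use assms in \<open>auto intro!: continuous_intros\<close>)
  then show ?thesis by (intro continuous_intros) simp
qed

lemma integral_speed_nonneg:
  fixes p w :: "real \<Rightarrow> real^'n"
  assumes "c \<in> \<A>" "p ` T \<subseteq> coords c ` fst c"
  shows "0 \<le> integral T (\<lambda>t. sqrt (g c (p t) (w t) (w t)))"
proof (cases "(\<lambda>t. sqrt (g c (p t) (w t) (w t))) integrable_on T")
  case True
  then show ?thesis by (rule integral_nonneg) (use assms metric_nonneg[OF assms(1)] in auto)
next
  case False
  then show ?thesis by (simp add: not_integrable_integral)
qed

lemma curve_length_nonneg: "curve_length \<A> g x y l \<Longrightarrow> 0 \<le> l"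
proof (induction rule: curve_length.induct)
  case (append \<gamma> w x l c)
  have "0 \<le> integral {0..1} (\<lambda>t. sqrt (g c (coords c (\<gamma> t)) (w t) (w t)))"
    by (rule integral_speed_nonneg) (use append in auto)
  with append show ?case by simp
qed simp

lemma curve_length_trans:
  "curve_length \<A> g y z l' \<Longrightarrow> curve_length \<A> g x y l \<Longrightarrow> curve_length \<A> g x z (l + l')"
proof (induction rule: curve_length.induct)
  case (append \<gamma> w y l' c)
  from curve_length.append[OF append.IH[OF append.prems] append.hyps(2-5)]
  show ?case by (simp add: add.assoc)
qed simp

text \<open>The infimum in the Riemannian distance is below the radius if and only if the length of one curve
is, so balls can be handled without ever mentioning the distance.\<close>

lemma mem_riemannian_ball: "y \<in> riemannian_ball \<A> g x e \<longleftrightarrow> (\<exists>l<e. curve_length \<A> g x y l)"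
proof -
  have "y \<in> riemannian_ball \<A> g x e \<longleftrightarrow> (\<exists>l. curve_length \<A> g x y l \<and> ennreal l < ennreal e)"
    by (simp add: riemannian_ball_def riemannian_dist_def INF_less_iff)
  then show ?thesis
    using ennreal_less_iff[OF curve_length_nonneg, of x y _ e] by (metis (no_types, lifting))
qed

text \<open>A coordinate segment is itself an admissible curve, which bounds the Riemannian distance from
above by the Euclidean one.\<close>

lemma curve_length_segment:
  assumes c: "c \<in> \<A>" and K: "convex K" "K \<subseteq> coords c ` fst c"
    and b: "\<And>p v. p \<in> K \<Longrightarrow> sqrt (g c p v v) \<le> b * norm v"
    and p: "p \<in> K" and q: "q \<in> K"
  obtains l where "curve_length \<A> g (param c p) (param c q) l" "l \<le> b * norm (q - p)"
proof -
  let ?s = "\<lambda>t. p + t *\<^sub>R (q - p)"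
  let ?\<gamma> = "\<lambda>t. param c (?s t)"
  have s: "?s t \<in> K" if "t \<in> {0..1}" for t
    using convexD_alt[OF K(1) p q, of t] that by (simp add: algebra_simps)
  have cs: "coords c (?\<gamma> t) = ?s t" and d: "?\<gamma> t \<in> fst c" if "t \<in> {0..1}" for t
    using coords_param[OF c subsetD[OF K(2) s[OF that]]] by simp_all
  have der: "((\<lambda>t. coords c (?\<gamma> t)) has_vector_derivative (q - p)) (at t within {0..1})" if "t \<in> {0..1}" for t
  proof (rule has_vector_derivative_transform[OF that])
    show "(?s has_vector_derivative (q - p)) (at t within {0..1})"
      by (auto intro!: derivative_eq_intros)
  qed (simp add: cs)
  let ?I = "integral {0..1} (\<lambda>t. sqrt (g c (coords c (?\<gamma> t)) (q - p) (q - p)))"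
  have "curve_length \<A> g (?\<gamma> 0) (?\<gamma> 1) (0 + ?I)"
    by (rule curve_length.append[OF curve_length.stationary c _ der]) (use d in auto)
  moreover have "?I \<le> b * norm (q - p)"
  proof -
    have "norm ?I \<le> b * norm (q - p) * (1 - 0)"
    proof (rule integral_bound)
      show "continuous_on {0..1} (\<lambda>t. sqrt (g c (coords c (?\<gamma> t)) (q - p) (q - p)))"
      proof (rule continuous_speed[OF c])
        have "continuous_on {0..1} ?s" by (intro continuous_intros)
        then show "continuous_on {0..1} (\<lambda>t. coords c (?\<gamma> t))"
          by (rule continuous_on_eq) (simp add: cs)
      qed (use d in auto)
      show "norm (sqrt (g c (coords c (?\<gamma> t)) (q - p) (q - p))) \<le> b * norm (q - p)" if "t \<in> {0..1}" for t
        using b[OF s[OF that], of "q - p"] metric_nonneg[OF c subsetD[OF K(2) s[OF that]], of "q - p"]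
        by (simp add: cs[OF that])
    qed simp
    then show ?thesis by simp
  qed
  ultimately show ?thesis by (intro that[of ?I]) simp_all
qed

lemma short_curves_nearby:
  assumes "0 < e"
  obtains V where "open V" "x \<in> V"
    "\<And>y. y \<in> V \<Longrightarrow> (\<exists>l<e. curve_length \<A> g x y l) \<and> (\<exists>l<e. curve_length \<A> g y x l)"
proof -
  obtain c where c: "c \<in> \<A>" "x \<in> fst c" by (rule chart_cover)
  obtain C r where C: "convex C" "closed C" "coords c ` fst c \<subseteq> C" "0 < r"
    "cball (coords c x) r \<inter> C \<subseteq> coords c ` (fst c \<inter> UNIV)"
    by (rule chart_box[OF c open_UNIV UNIV_I]) iprover
  let ?K = "cball (coords c x) r \<inter> C"
  have K: "?K \<subseteq> coords c ` fst c" using C(5) by simp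
  have "compact ?K" using C(2) by (intro compact_Int_closed) simp_all
  then obtain a b where b: "0 < b" "\<And>p v. p \<in> ?K \<Longrightarrow> a * norm v \<le> sqrt (g c p v v) \<and> sqrt (g c p v v) \<le> b * norm v"
    by (rule metric_comparison[OF c(1) _ K]) iprover
  have conv: "convex ?K" using C(1) by (intro convex_Int) simp_all
  let ?d = "min r (e / b)"
  let ?V = "{y \<in> fst c. dist (coords c x) (coords c y) < ?d}"
  have d: "0 < ?d" using C(4) b(1) assms by simp
  have "(\<exists>l<e. curve_length \<A> g x y l) \<and> (\<exists>l<e. curve_length \<A> g y x l)" if "y \<in> ?V" for y
  proof -
    have y: "y \<in> fst c" "dist (coords c x) (coords c y) < ?d" using that by simp_all
    have pK: "coords c x \<in> ?K" "coords c y \<in> ?K" using C(3,4) c(2) y by auto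
    have bd: "b * norm (coords c y - coords c x) < e"
      using y(2) b(1) by (simp add: dist_norm norm_minus_commute field_simps)
    have b': "\<And>p v. p \<in> ?K \<Longrightarrow> sqrt (g c p v v) \<le> b * norm v" using b(2) by simp
    obtain l where l: "curve_length \<A> g (param c (coords c x)) (param c (coords c y)) l"
        "l \<le> b * norm (coords c y - coords c x)"
      by (rule curve_length_segment[OF c(1) conv K b' pK])
    obtain l' where l': "curve_length \<A> g (param c (coords c y)) (param c (coords c x)) l'"
        "l' \<le> b * norm (coords c x - coords c y)"
      by (rule curve_length_segment[OF c(1) conv K b' pK(2,1)])
    have "l < e" "l' < e" using l(2) l'(2) bd by (simp_all add: norm_minus_commute)
    then show ?thesis
      using l(1) l'(1) param_coords[OF c(1) c(2)] param_coords[OF c(1) y(1)] by auto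
  qed
  then show ?thesis
    using open_chart_ball[OF c(1), of "coords c x" ?d] c(2) d by (intro that[of ?V]) simp_all
qed

text \<open>A curve shorter than \<open>e\<close> can be prolonged at both ends by curves that use up less than half of the
slack each.\<close>

lemma open_riemannian_ball_relation: "open {(x, y). y \<in> riemannian_ball \<A> g x e}"
proof (subst open_subopen, intro ballI)
  fix z assume "z \<in> {(x, y). y \<in> riemannian_ball \<A> g x e}"
  then obtain x0 y0 l where z: "z = (x0, y0)" and l: "l < e" "curve_length \<A> g x0 y0 l"
    by (auto simp: mem_riemannian_ball)
  let ?h = "(e - l) / 2"
  have h: "0 < ?h" using l by simp
  obtain V where V: "open V" "x0 \<in> V"
    "\<And>x. x \<in> V \<Longrightarrow> (\<exists>l<?h. curve_length \<A> g x0 x l) \<and> (\<exists>l<?h. curve_length \<A> g x x0 l)"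
    by (rule short_curves_nearby[OF h]) iprover
  obtain W where W: "open W" "y0 \<in> W"
    "\<And>y. y \<in> W \<Longrightarrow> (\<exists>l<?h. curve_length \<A> g y0 y l) \<and> (\<exists>l<?h. curve_length \<A> g y y0 l)"
    by (rule short_curves_nearby[OF h]) iprover
  have "y \<in> riemannian_ball \<A> g x e" if xV: "x \<in> V" and yW: "y \<in> W" for x y
  proof -
    obtain l1 l2 where l1: "l1 < ?h" "curve_length \<A> g x x0 l1" and l2: "l2 < ?h" "curve_length \<A> g y0 y l2"
      using V(3)[OF xV] W(3)[OF yW] by blast
    have "curve_length \<A> g x y ((l1 + l) + l2)"
      by (rule curve_length_trans[OF l2(2) curve_length_trans[OF l(2) l1(2)]])
    moreover have "(l1 + l) + l2 < e" using l1(1) l2(1) by (simp add: field_simps)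
    ultimately show ?thesis unfolding mem_riemannian_ball by blast
  qed
  then show "\<exists>T. open T \<and> z \<in> T \<and> T \<subseteq> {(x, y). y \<in> riemannian_ball \<A> g x e}"
    using V(1,2) W(1,2) z by (intro exI[of _ "V \<times> W"]) (auto intro: open_Times)
qed

text \<open>The speed of an arc may be computed in any chart that contains it: the velocity is transported by
the derivative of the transition map, and the transformation law of the metric makes the two
lengths of the velocity equal.\<close>

lemma transition_speed:
  assumes c: "c \<in> \<A>" and c': "c' \<in> \<A>"
    and t: "t \<in> T" and T: "\<gamma> ` T \<subseteq> fst c' \<inter> fst c"
    and der: "((\<lambda>s. coords c' (\<gamma> s)) has_vector_derivative w) (at t within T)"
  obtains u where "((\<lambda>s. coords c (\<gamma> s)) has_vector_derivative u) (at t within T)"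
    "g c (coords c (\<gamma> t)) u u = g c' (coords c' (\<gamma> t)) w w"
proof -
  let ?S = "coords c' ` (fst c' \<inter> fst c)" and ?p = "coords c' (\<gamma> t)"
  have p: "?p \<in> ?S" using t T by blast
  have "smooth_on ?S (transition c' c)"
    using manifold c c' unfolding compact_riemannian_manifold_def smooth_atlas_def by blast
  then obtain D where D: "(transition c' c has_derivative D) (at ?p within ?S)"
    using p by (rule smooth_on_has_derivative)
  have trans: "transition c' c (coords c' (\<gamma> s)) = coords c (\<gamma> s)" if "s \<in> T" for s
  proof -
    have "\<gamma> s \<in> fst c'" using that T by blast
    then show ?thesis by (simp add: transition_def param_coords[OF c'])
  qed
  have "(transition c' c has_derivative D) (at ?p within (\<lambda>s. coords c' (\<gamma> s)) ` T)"
    by (rule has_derivative_subset[OF D]) (use T in blast)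
  from has_derivative_in_compose[OF der[unfolded has_vector_derivative_def] this]
  have comp: "((\<lambda>s. transition c' c (coords c' (\<gamma> s))) has_derivative (\<lambda>h. D (h *\<^sub>R w))) (at t within T)" .
  have lin: "linear D" using D by (rule has_derivative_linear)
  have "((\<lambda>s. coords c (\<gamma> s)) has_derivative (\<lambda>h. D (h *\<^sub>R w))) (at t within T)"
    by (rule has_derivative_transform[OF t _ comp]) (simp add: trans)
  then have "((\<lambda>s. coords c (\<gamma> s)) has_vector_derivative D w) (at t within T)"
    unfolding has_vector_derivative_def linear_scale[OF lin] .
  moreover have "g c' ?p w w = g c (transition c' c ?p) (D w) (D w)"
    using manifold c c' p D unfolding compact_riemannian_manifold_def riemannian_metric_def by blast
  then have "g c (coords c (\<gamma> t)) (D w) (D w) = g c' ?p w w" by (simp add: trans[OF t])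
  ultimately show ?thesis by (rule that)
qed

text \<open>As long as an arc stays where the metric is at least \<open>a\<^sup>2\<close> times the Euclidean one in the chart \<open>c\<close>,
the mean value inequality bounds the Euclidean distance covered in \<open>c\<close>. The length on the right-hand
side is the one in the chart \<open>c'\<close> of the arc, as it appears in the length of a curve.\<close>

lemma curve_length_coords_bound:
  assumes c: "c \<in> \<A>" and c': "c' \<in> \<A>" and T: "0 \<le> T" "T \<le> 1"
    and \<gamma>': "\<gamma> ` {0..1} \<subseteq> fst c'"
    and der: "\<And>t. t \<in> {0..1} \<Longrightarrow> ((\<lambda>s. coords c' (\<gamma> s)) has_vector_derivative w t) (at t within {0..1})"
    and w: "continuous_on {0..1} w"
    and \<gamma>: "\<gamma> ` {0..T} \<subseteq> fst c"
    and a: "0 < a" "\<And>t v. t \<in> {0..T} \<Longrightarrow> a * norm v \<le> sqrt (g c (coords c (\<gamma> t)) v v)"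
  shows "a * dist (coords c (\<gamma> 0)) (coords c (\<gamma> T)) \<le> integral {0..1} (\<lambda>t. sqrt (g c' (coords c' (\<gamma> t)) (w t) (w t)))"
proof -
  let ?f = "\<lambda>t. sqrt (g c' (coords c' (\<gamma> t)) (w t) (w t))"
  have "continuous_on {0..1} (\<lambda>t. coords c' (\<gamma> t))"
    using der by (rule continuous_on_vector_derivative)
  then have f: "continuous_on {0..1} ?f"
    by (rule continuous_speed[OF c' _ w]) (use \<gamma>' in auto)
  have f0: "0 \<le> ?f t" if "t \<in> {0..1}" for t
  proof -
    have "coords c' (\<gamma> t) \<in> coords c' ` fst c'" using \<gamma>' that by blast
    from metric_nonneg[OF c' this] show ?thesis by simp
  qed
  have deriv: "\<exists>u. ((\<lambda>s. coords c (\<gamma> s)) has_vector_derivative u) (at t within {0..T}) \<and> a * norm u \<le> ?f t"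
    if t: "t \<in> {0..T}" for t
  proof -
    have der': "((\<lambda>s. coords c' (\<gamma> s)) has_vector_derivative w t) (at t within {0..T})"
      by (rule has_vector_derivative_within_subset[OF der]) (use t T in auto)
    have "\<gamma> ` {0..T} \<subseteq> \<gamma> ` {0..1}" using T by (intro image_mono) auto
    then have sub: "\<gamma> ` {0..T} \<subseteq> fst c' \<inter> fst c" using \<gamma> \<gamma>' by blast
    obtain u where "((\<lambda>s. coords c (\<gamma> s)) has_vector_derivative u) (at t within {0..T})"
      "g c (coords c (\<gamma> t)) u u = g c' (coords c' (\<gamma> t)) (w t) (w t)"
      by (rule transition_speed[OF c c' t sub der'])
    then show ?thesis using a(2)[OF t, of u] by auto
  qed
  define u where "u t = (SOME u. ((\<lambda>s. coords c (\<gamma> s)) has_vector_derivative u) (at t within {0..T}) \<and> a * norm u \<le> ?f t)" for t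
  have u: "((\<lambda>s. coords c (\<gamma> s)) has_vector_derivative u t) (at t within {0..T})"
    and u_le: "a * norm (u t) \<le> ?f t" if "t \<in> {0..T}" for t
    using someI_ex[OF deriv[OF that]] unfolding u_def by iprover+
  show ?thesis
  proof (cases "T = 0")
    case True
    then show ?thesis using integral_speed_nonneg[OF c', of "\<lambda>t. coords c' (\<gamma> t)" "{0..1}" w] \<gamma>' by auto
  next
    case False
    then have "0 < T" using T by simp
    have L: "((\<lambda>t. integral {0..t} ?f / a) has_vector_derivative ?f t / a) (at t within {0..T})" if "t \<in> {0..T}" for t
    proof -
      have "((\<lambda>t. integral {0..t} ?f) has_vector_derivative ?f t) (at t within {0..1})"
        by (rule integral_has_vector_derivative[OF f]) (use that T in auto)
      then have "((\<lambda>t. integral {0..t} ?f) has_vector_derivative ?f t) (at t within {0..T})"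
        by (rule has_vector_derivative_within_subset) (use T in auto)
      then show ?thesis by (rule has_vector_derivative_divide)
    qed
    have "norm (coords c (\<gamma> T) - coords c (\<gamma> 0)) \<le> integral {0..T} ?f / a - integral {0..0} ?f / a"
    proof (rule differentiable_bound_general[OF \<open>0 < T\<close>])
      show "continuous_on {0..T} (\<lambda>t. coords c (\<gamma> t))"
        using u by (rule continuous_on_vector_derivative)
      show "continuous_on {0..T} (\<lambda>t. integral {0..t} ?f / a)"
        using L by (rule continuous_on_vector_derivative)
      fix t assume t: "0 < t" "t < T"
      have at: "at t within {0..T} = at t" using t by (rule at_within_Icc_at)
      show "((\<lambda>t. coords c (\<gamma> t)) has_vector_derivative u t) (at t)"
        using u[of t] t unfolding at by simp
      show "((\<lambda>t. integral {0..t} ?f / a) has_vector_derivative ?f t / a) (at t)"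
        using L[of t] t unfolding at by simp
      show "norm (u t) \<le> ?f t / a"
        using u_le[of t] t a(1) by (simp add: pos_le_divide_eq mult.commute)
    qed
    then have "a * dist (coords c (\<gamma> 0)) (coords c (\<gamma> T)) \<le> integral {0..T} ?f"
      using a(1) by (simp add: dist_norm norm_minus_commute pos_le_divide_eq mult.commute)
    also have "\<dots> \<le> integral {0..1} ?f"
    proof (rule integral_subset_le)
      show "?f integrable_on {0..T}"
        by (rule integrable_continuous_real[OF continuous_on_subset[OF f]]) (use T in auto)
      show "?f integrable_on {0..1}" by (rule integrable_continuous_real[OF f])
    qed (use T f0 in auto)
    finally show ?thesis .
  qed
qed

text \<open>This is the lower bound for the Riemannian distance. The induction runs over the arcs of the curve.
To leave the coordinate ball of radius \<open>2 * r\<close> around \<open>p0\<close>, a curve that starts in the ball of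
radius \<open>r\<close> has to cover the Euclidean distance \<open>r\<close>, for which its length does not suffice.\<close>

lemma short_curve_trapped:
  assumes c: "c \<in> \<A>" and C: "closed C" "coords c ` fst c \<subseteq> C"
    and box: "cball p0 (2 * r) \<inter> C \<subseteq> coords c ` fst c"
    and a: "0 < a" "\<And>p v. p \<in> cball p0 (2 * r) \<inter> C \<Longrightarrow> a * norm v \<le> sqrt (g c p v v)"
    and curve: "curve_length \<A> g x y l"
    and x: "x \<in> fst c" "dist p0 (coords c x) < r" and l: "l < a * r"
  shows "y \<in> fst c \<and> a * dist (coords c x) (coords c y) \<le> l"
  using curve x l
proof (induction rule: curve_length.induct)
  case (append \<gamma> w x l c')
  let ?f = "\<lambda>t. sqrt (g c' (coords c' (\<gamma> t)) (w t) (w t))"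
  let ?I = "integral {0..1} ?f"
  note c' = append.hyps(2) and \<gamma>' = append.hyps(3) and der = append.hyps(4) and w = append.hyps(5)
  have I0: "0 \<le> ?I" by (rule integral_speed_nonneg[OF c']) (use \<gamma>' in auto)
  then have "l < a * r" using append.prems(3) by linarith
  with append.IH append.prems(1,2) have start: "\<gamma> 0 \<in> fst c" "a * dist (coords c x) (coords c (\<gamma> 0)) \<le> l"
    by iprover+
  \<comment> \<open>the Euclidean distance that the curve can have covered at the end of the new arc\<close>
  define r' where "r' = (l + ?I) / a"
  have r': "r' < r" using append.prems(3) a(1) by (simp add: r'_def divide_less_eq mult.commute)
  define G where "G = {z \<in> fst c. dist p0 (coords c z) < 2 * r}"
  have G: "open G" unfolding G_def by (rule open_chart_ball[OF c])
  have bound: "dist (coords c x) (coords c (\<gamma> t)) \<le> r'" if t: "t \<in> {0..1}" "\<gamma> ` {0..t} \<subseteq> G" for t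
  proof -
    have "a * dist (coords c (\<gamma> 0)) (coords c (\<gamma> t)) \<le> ?I"
    proof (rule curve_length_coords_bound[OF c c' _ _ \<gamma>' der w _ a(1)])
      show "\<gamma> ` {0..t} \<subseteq> fst c" using t(2) by (auto simp: G_def)
      show "a * norm v \<le> sqrt (g c (coords c (\<gamma> s)) v v)" if "s \<in> {0..t}" for s v
      proof (rule a(2))
        have "\<gamma> s \<in> G" using t(2) that by blast
        then show "coords c (\<gamma> s) \<in> cball p0 (2 * r) \<inter> C" using C(2) by (auto simp: G_def)
      qed
    qed (use t in auto)
    moreover have "a * dist (coords c x) (coords c (\<gamma> t)) \<le> a * dist (coords c x) (coords c (\<gamma> 0)) + a * dist (coords c (\<gamma> 0)) (coords c (\<gamma> t))"
      using a(1) by (simp add: distrib_left[symmetric] dist_triangle)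
    ultimately show ?thesis
      using start(2) a(1) by (simp add: r'_def pos_le_divide_eq mult.commute)
  qed
  have cont: "continuous_on {0..1} \<gamma>"
  proof -
    have "continuous_on {0..1} (\<lambda>t. coords c' (\<gamma> t))"
      using der by (rule continuous_on_vector_derivative)
    then have "continuous_on {0..1} (\<lambda>t. param c' (coords c' (\<gamma> t)))"
      by (rule continuous_on_compose2[OF continuous_param[OF c']]) (use \<gamma>' in auto)
    moreover have "param c' (coords c' (\<gamma> t)) = \<gamma> t" if "t \<in> {0..1}" for t
      by (rule param_coords[OF c']) (use \<gamma>' that in blast)
    ultimately show ?thesis by (rule continuous_on_eq)
  qed
  \<comment> \<open>a compact subset of \<open>G\<close> that contains the arc as long as the arc stays in \<open>G\<close>\<close>
  define K where "K = param c ` (cball p0 (r + r') \<inter> C)"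
  have sub: "cball p0 (r + r') \<inter> C \<subseteq> coords c ` fst c" using box r' by force
  have "compact K"
    unfolding K_def
    by (rule compact_continuous_image[OF continuous_on_subset[OF continuous_param[OF c] sub]])
       (rule compact_Int_closed[OF compact_cball C(1)])
  have "K \<subseteq> G"
    unfolding K_def G_def using coords_param[OF c subsetD[OF sub]] r' by force
  have inK: "z \<in> K" if "z \<in> fst c" "dist (coords c x) (coords c z) \<le> r'" for z
  proof -
    have "dist p0 (coords c z) \<le> r + r'"
      using that(2) append.prems(2) dist_triangle[of p0 "coords c z" "coords c x"] by linarith
    then have "coords c z \<in> cball p0 (r + r') \<inter> C" using that(1) C(2) by auto
    then show ?thesis unfolding K_def using param_coords[OF c that(1)] by (metis image_eqI)
  qed
  have start_dist: "dist (coords c x) (coords c (\<gamma> 0)) \<le> r'"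
    using start(2) I0 a(1) by (simp add: r'_def pos_le_divide_eq mult.commute)
  have stays: "\<gamma> t \<in> G" if "t \<in> {0..1}" for t
  proof (rule ccontr)
    assume "\<gamma> t \<notin> G"
    define T where "T = {0..1} \<inter> \<gamma> -` (- G)"
    have "closed T"
      unfolding T_def by (rule continuous_closed_preimage[OF cont]) (use G in auto)
    then have "compact T"
      using compact_Int_closed[OF compact_Icc[of 0 "1::real"], of T] by (simp add: T_def Int_assoc[symmetric])
    moreover have "T \<noteq> {}" using that \<open>\<gamma> t \<notin> G\<close> by (auto simp: T_def)
    ultimately obtain \<tau> where \<tau>: "\<tau> \<in> T" "\<And>t. t \<in> T \<Longrightarrow> \<tau> \<le> t"
      using compact_attains_inf by metis
    \<comment> \<open>\<open>\<tau>\<close> is the first time outside \<open>G\<close>; up to then the arc is in \<open>K\<close>, and \<open>K\<close> is closed\<close>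
    have "\<gamma> 0 \<in> G" using inK[OF start(1) start_dist] \<open>K \<subseteq> G\<close> by blast
    then have "\<tau> \<noteq> 0" using \<tau>(1) by (auto simp: T_def)
    then have "0 < \<tau>" "\<tau> \<le> 1" using \<tau>(1) by (auto simp: T_def)
    have before: "\<gamma> s \<in> G" if "0 \<le> s" "s < \<tau>" for s
      using \<tau>(2)[of s] that \<open>\<tau> \<le> 1\<close> by (auto simp: T_def)
    have "{0..<\<tau>} \<subseteq> {0..1} \<inter> \<gamma> -` K"
    proof
      fix s assume s: "s \<in> {0..<\<tau>}"
      have "dist (coords c x) (coords c (\<gamma> s)) \<le> r'"
        by (rule bound) (use s \<open>\<tau> \<le> 1\<close> before in auto)
      moreover have "\<gamma> s \<in> fst c" using before[of s] s by (auto simp: G_def)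
      ultimately show "s \<in> {0..1} \<inter> \<gamma> -` K" using inK s \<open>\<tau> \<le> 1\<close> by auto
    qed
    then have "closure {0..<\<tau>} \<subseteq> {0..1} \<inter> \<gamma> -` K"
      by (rule closure_minimal) (rule continuous_closed_preimage[OF cont closed_atLeastAtMost compact_imp_closed[OF \<open>compact K\<close>]])
    then have "\<gamma> \<tau> \<in> K" using \<open>0 < \<tau>\<close> by (auto simp: closure_atLeastLessThan subset_iff)
    then show False using \<tau>(1) \<open>K \<subseteq> G\<close> by (auto simp: T_def)
  qed
  have "dist (coords c x) (coords c (\<gamma> 1)) \<le> r'" by (rule bound) (use stays in auto)
  then have "a * dist (coords c x) (coords c (\<gamma> 1)) \<le> l + ?I"
    using a(1) by (simp add: r'_def pos_le_divide_eq mult.commute)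
  moreover have "\<gamma> 1 \<in> fst c" using stays[of 1] by (simp add: G_def)
  ultimately show ?case by simp
qed simp

text \<open>The radius \<open>e\<close> serves all centres in a neighbourhood. Compactness of the manifold turns this into
uniform smallness of the balls.\<close>

lemma riemannian_balls_small:
  assumes "open U" "x \<in> U"
  obtains V e where "open V" "x \<in> V" "0 < e" "\<And>y. y \<in> V \<Longrightarrow> riemannian_ball \<A> g y e \<subseteq> U"
proof -
  obtain c where c: "c \<in> \<A>" "x \<in> fst c" by (rule chart_cover)
  obtain C R where C: "closed C" "coords c ` fst c \<subseteq> C" "0 < R"
    "cball (coords c x) R \<inter> C \<subseteq> coords c ` (fst c \<inter> U)"
    by (rule chart_box[OF c assms]) iprover
  define r where "r = R / 2"
  have r: "0 < r" using C(3) by (simp add: r_def)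
  let ?K = "cball (coords c x) (2 * r) \<inter> C"
  have KU: "?K \<subseteq> coords c ` (fst c \<inter> U)" using C(4) by (simp add: r_def)
  then have K: "?K \<subseteq> coords c ` fst c" by blast
  have "compact ?K" using C(1) by (intro compact_Int_closed) simp_all
  then obtain a b where a: "0 < a" "\<And>p v. p \<in> ?K \<Longrightarrow> a * norm v \<le> sqrt (g c p v v) \<and> sqrt (g c p v v) \<le> b * norm v"
    by (rule metric_comparison[OF c(1) _ K]) iprover
  have a2: "\<And>p v. p \<in> ?K \<Longrightarrow> a * norm v \<le> sqrt (g c p v v)" using a(2) by simp
  let ?V = "{y \<in> fst c. dist (coords c x) (coords c y) < r}"
  have "riemannian_ball \<A> g y (a * r) \<subseteq> U" if y: "y \<in> ?V" for y
  proof
    fix z assume "z \<in> riemannian_ball \<A> g y (a * r)"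
    then obtain l where l: "l < a * r" "curve_length \<A> g y z l" unfolding mem_riemannian_ball by blast
    have z: "z \<in> fst c" "a * dist (coords c y) (coords c z) \<le> l"
      using short_curve_trapped[OF c(1) C(1,2) K a(1) a2 l(2) _ _ l(1)] y by simp_all
    have "a * dist (coords c y) (coords c z) < a * r" using z(2) l(1) by simp
    then have "dist (coords c y) (coords c z) < r" using a(1) by simp
    then have "dist (coords c x) (coords c z) \<le> 2 * r"
      using y dist_triangle[of "coords c x" "coords c z" "coords c y"] by simp
    then have "coords c z \<in> ?K" using C(2) z(1) by auto
    then have "coords c z \<in> coords c ` (fst c \<inter> U)" using KU by blast
    then obtain z' where z': "z' \<in> fst c" "z' \<in> U" "coords c z = coords c z'" by blast
    have "z = param c (coords c z)" by (rule param_coords[OF c(1) z(1), symmetric])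
    also have "\<dots> = z'" unfolding z'(3) by (rule param_coords[OF c(1) z'(1)])
    finally have e: "z = z'" .
    show "z \<in> U" unfolding e by (rule z'(2))
  qed
  moreover have "open ?V" by (rule open_chart_ball[OF c(1)])
  ultimately show ?thesis using c(2) r a(1) by (intro that[of ?V "a * r"]) simp_all
qed

lemma self_in_riemannian_ball: "0 < e \<Longrightarrow> x \<in> riemannian_ball \<A> g x e"
  unfolding mem_riemannian_ball by (intro exI[of _ 0] conjI curve_length.stationary)

lemma riemannian_ball_mono: "e \<le> e' \<Longrightarrow> riemannian_ball \<A> g x e \<subseteq> riemannian_ball \<A> g x e'"
  by (force simp: mem_riemannian_ball)

section \<open>Finiteness and positivity of the Riemannian volume\<close>

lemma det_gram_pos:
  assumes "c \<in> \<A>" "p \<in> coords c ` fst c"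
  shows "0 < det (gram_matrix g c p)"
proof (rule det_pos_of_positive_definite)
  fix v :: "real^'n" assume "v \<noteq> 0"
  have "v \<bullet> (gram_matrix g c p *v v) = g c p v v"
    unfolding metric_expansion[OF assms, of v v]
    by (simp add: inner_vec_def matrix_vector_mult_def gram_matrix_def sum_distrib_left mult_ac)
  then show "0 < v \<bullet> (gram_matrix g c p *v v)" using metric_pos[OF assms \<open>v \<noteq> 0\<close>] by simp
qed

lemma continuous_density:
  assumes "c \<in> \<A>"
  shows "continuous_on (coords c ` fst c) (\<lambda>p. sqrt (det (gram_matrix g c p)))"
  unfolding det_def gram_matrix_def using continuous_metric_coefficient[OF assms]
  by (intro continuous_intros) simp

end

locale riemannian_with_volume = riemannian \<A> g
  for \<A> :: "('a::{t2_space,second_countable_topology}, 'n::finite) chart set"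
    and g :: "('a, 'n) local_metric" +
  fixes m :: "'a measure"
  assumes volume: "riemannian_volume \<A> g m"
begin

lemma sets_volume: "sets m = sets borel"
  using volume by (simp add: riemannian_volume_def)

lemma emeasure_volume:
  assumes "c \<in> \<A>" "B \<in> sets borel" "B \<subseteq> fst c"
  shows "emeasure m B = (\<integral>\<^sup>+p. ennreal (sqrt (det (gram_matrix g c p))) * indicator (coords c ` B) p \<partial>lborel)"
  using volume assms unfolding riemannian_volume_def by blast

text \<open>In a chart, an open set contains a Euclidean ball, on which the density is bounded below by a
positive constant.\<close>

lemma volume_open_pos:
  assumes "open G" "x \<in> G"
  shows "0 < emeasure m G"
proof -
  obtain c where c: "c \<in> \<A>" "x \<in> fst c" by (rule chart_cover)
  obtain C r where C: "C \<in> insert UNIV (range (\<lambda>i. {v. 0 \<le> v $ i}))" "coords c ` fst c \<subseteq> C" "0 < r"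
    "cball (coords c x) r \<inter> C \<subseteq> coords c ` (fst c \<inter> G)"
    by (rule chart_box[OF c assms]) iprover
  have "coords c x \<in> C" using C(2) c(2) by blast
  then obtain q where q: "cball q (r/4) \<subseteq> ball (coords c x) r \<inter> C"
    using half_space_contains_balls[OF C(1) _ C(3)] by metis
  let ?f = "\<lambda>p. sqrt (det (gram_matrix g c p))"
  have sub: "cball q (r/4) \<subseteq> coords c ` (fst c \<inter> G)"
    using q C(4) ball_subset_cball[of "coords c x" r] by blast
  have "continuous_on (cball q (r/4)) ?f"
    by (rule continuous_on_subset[OF continuous_density[OF c(1)]]) (use sub in blast)
  then obtain p where p: "p \<in> cball q (r/4)" "\<And>y. y \<in> cball q (r/4) \<Longrightarrow> ?f p \<le> ?f y"
    using continuous_attains_inf[of "cball q (r/4)" ?f] C(3) by (metis compact_cball cball_eq_empty divide_less_0_iff less_asym zero_less_numeral)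
  have "0 < ?f p" using det_gram_pos[OF c(1), of p] p(1) sub by (simp add: subset_iff image_iff) blast
  have "0 < emeasure lborel (cball q (r/4))"
    using content_cball_pos[of "r/4" q] C(3) by (auto simp: measure_def zero_less_iff_neq_zero)
  have "0 < ennreal (?f p) * emeasure lborel (cball q (r/4))"
    using \<open>0 < ?f p\<close> \<open>0 < emeasure lborel (cball q (r/4))\<close> by (simp add: ennreal_zero_less_mult_iff)
  also have "\<dots> = (\<integral>\<^sup>+y. ennreal (?f p) * indicator (cball q (r/4)) y \<partial>lborel)"
    by (rule nn_integral_cmult_indicator[symmetric]) simp
  also have "\<dots> \<le> (\<integral>\<^sup>+y. ennreal (?f y) * indicator (coords c ` (fst c \<inter> G)) y \<partial>lborel)"
    by (rule nn_integral_mono) (use p(2) sub in \<open>auto simp: indicator_def intro!: ennreal_leI\<close>)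
  also have "\<dots> = emeasure m (fst c \<inter> G)"
    by (rule emeasure_volume[OF c(1), symmetric]) (use open_chart[OF c(1)] assms(1) in auto)
  also have "\<dots> \<le> emeasure m G"
    by (rule emeasure_mono) (use assms(1) sets_volume in auto)
  finally show ?thesis .
qed

text \<open>A coordinate ball lies in a compact box, on which the density is bounded above.\<close>

lemma volume_locally_finite:
  obtains G where "open G" "x \<in> G" "emeasure m G < \<infinity>"
proof -
  obtain c where c: "c \<in> \<A>" "x \<in> fst c" by (rule chart_cover)
  obtain C r where C: "closed C" "coords c ` fst c \<subseteq> C" "0 < r"
    "cball (coords c x) r \<inter> C \<subseteq> coords c ` (fst c \<inter> UNIV)"
    by (rule chart_box[OF c open_UNIV UNIV_I]) iprover
  let ?K = "cball (coords c x) r \<inter> C" and ?f = "\<lambda>p. sqrt (det (gram_matrix g c p))"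
  let ?G = "{y \<in> fst c. dist (coords c x) (coords c y) < r}"
  have K: "compact ?K" using C(1) by (intro compact_Int_closed) simp_all
  have "continuous_on ?K ?f"
    by (rule continuous_on_subset[OF continuous_density[OF c(1)]]) (use C(4) in simp)
  from compact_imp_bounded[OF compact_continuous_image[OF this K]]
  obtain b where b: "\<And>p. p \<in> ?K \<Longrightarrow> norm (?f p) \<le> b" unfolding bounded_iff by blast
  have "open ?G" by (rule open_chart_ball[OF c(1)])
  have "emeasure m ?G = (\<integral>\<^sup>+p. ennreal (?f p) * indicator (coords c ` ?G) p \<partial>lborel)"
    by (rule emeasure_volume[OF c(1)]) (use \<open>open ?G\<close> in auto)
  also have "\<dots> \<le> (\<integral>\<^sup>+p. ennreal b * indicator ?K p \<partial>lborel)"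
  proof (rule nn_integral_mono)
    fix p
    show "ennreal (?f p) * indicator (coords c ` ?G) p \<le> ennreal b * indicator ?K p"
    proof (cases "p \<in> coords c ` ?G")
      case True
      then have "p \<in> ?K" using C(2) by auto
      then show ?thesis using True b[of p] by (auto intro!: ennreal_leI)
    qed simp
  qed
  also have "\<dots> = ennreal b * emeasure lborel ?K"
    by (rule nn_integral_cmult_indicator) (use borel_compact[OF K] in simp)
  also have "\<dots> < \<infinity>"
    using emeasure_bounded_finite[OF compact_imp_bounded[OF K]] by (simp add: ennreal_mult_less_top)
  finally have "emeasure m ?G < \<infinity>" .
  with \<open>open ?G\<close> show ?thesis using c(2) C(3) by (intro that[of ?G]) simp_all
qed

lemma finite_volume: "finite_measure m"
proof
  have "space m = UNIV" using sets_eq_imp_space_eq[OF sets_volume] by simp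
  define \<G> where "\<G> = {G. open G \<and> emeasure m G < \<infinity>}"
  have "compact (UNIV :: 'a set)" using manifold by (simp add: compact_riemannian_manifold_def)
  moreover have "UNIV \<subseteq> \<Union>\<G>"
  proof
    fix x :: 'a
    obtain G where "open G" "x \<in> G" "emeasure m G < \<infinity>" by (rule volume_locally_finite)
    then show "x \<in> \<Union>\<G>" unfolding \<G>_def by blast
  qed
  ultimately obtain F where F: "F \<subseteq> \<G>" "finite F" "UNIV \<subseteq> \<Union>F"
    by (rule compactE) (auto simp: \<G>_def)
  have "emeasure m (space m) = emeasure m (\<Union>G\<in>F. G)" using F(3) \<open>space m = UNIV\<close> by (simp add: top.extremum_unique)
  also have "\<dots> \<le> (\<Sum>G\<in>F. emeasure m G)"
    by (rule emeasure_subadditive_finite[OF F(2)]) (use F(1) sets_volume in \<open>auto simp: \<G>_def\<close>)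
  also have "\<dots> < \<infinity>" using F(1,2) by (auto simp: \<G>_def less_top[symmetric])
  finally show "emeasure m (space m) \<noteq> \<infinity>" by simp
qed

end

section \<open>Weak* convergence and compactness of the probability measures\<close>

lemma prob_measuresD:
  assumes "\<mu> \<in> prob_measures"
  shows "prob_space \<mu>" "sets \<mu> = sets borel" "space \<mu> = UNIV"
  using assms sets_eq_imp_space_eq[of \<mu> borel] by (auto simp: prob_measures_def)

lemma topspace_weak_star: "topspace weak_star_topology = prob_measures"
proof -
  have "prob_measures = {\<mu>\<in>prob_measures. (\<integral>x. (0::complex) \<partial>\<mu>) \<in> UNIV}"
    by simp
  then have "prob_measures \<in> {{\<mu>\<in>prob_measures. (\<integral>x. \<phi> x \<partial>\<mu>) \<in> V} |\<phi> V.
        continuous_on UNIV (\<phi> :: 'a::topological_space \<Rightarrow> complex) \<and> open V}"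
    by (intro CollectI exI[of _ "\<lambda>_. 0"] exI[of _ UNIV] conjI continuous_on_const open_UNIV)
  then show ?thesis
    unfolding weak_star_topology_def topology_generated_by_topspace by blast
qed

lemma limitin_weak_star:
  fixes \<mu> :: "'a::topological_space measure"
  shows "limitin weak_star_topology \<sigma> \<mu> F \<longleftrightarrow>
    \<mu> \<in> prob_measures \<and> (\<forall>\<^sub>F i in F. \<sigma> i \<in> prob_measures) \<and>
    (\<forall>\<phi> :: 'a \<Rightarrow> complex. continuous_on UNIV \<phi> \<longrightarrow> ((\<lambda>i. \<integral>x. \<phi> x \<partial>\<sigma> i) \<longlongrightarrow> (\<integral>x. \<phi> x \<partial>\<mu>)) F)"
    (is "?L \<longleftrightarrow> ?R")
proof
  assume L: ?L
  then have mu: "\<mu> \<in> prob_measures"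
    by (simp add: limitin_def topspace_weak_star)
  have *: "\<forall>\<^sub>F i in F. \<sigma> i \<in> {\<mu>\<in>prob_measures. (\<integral>x. \<phi> x \<partial>\<mu>) \<in> V}"
    if "continuous_on UNIV \<phi>" "open V" "(\<integral>x. \<phi> x \<partial>\<mu>) \<in> V" for \<phi> :: "'a \<Rightarrow> complex" and V
  proof -
    have "openin weak_star_topology {\<mu>\<in>prob_measures. (\<integral>x. \<phi> x \<partial>\<mu>) \<in> V}"
      unfolding weak_star_topology_def by (rule topology_generated_by_Basis) (use that in blast)
    with L mu that show ?thesis
      unfolding limitin_def by blast
  qed
  have "\<forall>\<^sub>F i in F. \<sigma> i \<in> prob_measures"
    using *[of "\<lambda>_. 0" UNIV] by simp
  moreover have "((\<lambda>i. \<integral>x. \<phi> x \<partial>\<sigma> i) \<longlongrightarrow> (\<integral>x. \<phi> x \<partial>\<mu>)) F"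
    if "continuous_on UNIV \<phi>" for \<phi> :: "'a \<Rightarrow> complex"
  proof (rule topological_tendstoI)
    fix S assume "open S" "(\<integral>x. \<phi> x \<partial>\<mu>) \<in> S"
    from *[OF that this] show "\<forall>\<^sub>F i in F. (\<integral>x. \<phi> x \<partial>\<sigma> i) \<in> S"
      by (rule eventually_mono) simp
  qed
  ultimately show ?R using mu by blast
next
  assume R: ?R
  then have Rev: "\<forall>\<^sub>F i in F. \<sigma> i \<in> prob_measures"
    and Rlim: "\<And>\<phi> :: 'a \<Rightarrow> complex. continuous_on UNIV \<phi> \<Longrightarrow> ((\<lambda>i. \<integral>x. \<phi> x \<partial>\<sigma> i) \<longlongrightarrow> (\<integral>x. \<phi> x \<partial>\<mu>)) F"
    by iprover+
  have "\<forall>\<^sub>F i in F. \<sigma> i \<in> U" if "openin weak_star_topology U" "\<mu> \<in> U" for U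
  proof -
    have "generate_topology_on {{\<mu>\<in>prob_measures. (\<integral>x. \<phi> x \<partial>\<mu>) \<in> V} |\<phi> V.
        continuous_on UNIV (\<phi> :: 'a \<Rightarrow> complex) \<and> open V} U"
      by (rule openin_topology_generated_by[OF that(1)[unfolded weak_star_topology_def]])
    then show ?thesis using \<open>\<mu> \<in> U\<close>
    proof induction
      case Empty
      then show ?case by (rule emptyE)
    next
      case (Int a b)
      then show ?case by (simp add: eventually_conj_iff)
    next
      case (UN K)
      then obtain k where k: "k \<in> K" "\<mu> \<in> k" by blast
      from UN.IH[OF this] show ?case by (rule eventually_mono) (use k in blast)
    next
      case (Basis s)
      then obtain \<phi> :: "'a \<Rightarrow> complex" and V where s: "s = {\<mu>\<in>prob_measures. (\<integral>x. \<phi> x \<partial>\<mu>) \<in> V}"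
        "continuous_on UNIV \<phi>" "open V" by blast
      have "\<forall>\<^sub>F i in F. (\<integral>x. \<phi> x \<partial>\<sigma> i) \<in> V"
        by (rule topological_tendstoD[OF Rlim[OF s(2)] s(3)]) (use Basis.prems s(1) in simp)
      with Rev show ?case unfolding s(1) by eventually_elim simp
    qed
  qed
  moreover have "\<mu> \<in> prob_measures" using R by (rule conjunct1)
  ultimately show ?L unfolding limitin_def topspace_weak_star by iprover
qed

text \<open>A difference in the \<open>n\<close>-th digit contributes \<open>(1/3)^n\<close>, and all later digits together contribute at
most half of that. Base \<open>3\<close> leaves the gap that makes digits locally constant functions of the sum.\<close>

lemma ternary_digits_determined:
  fixes a b :: "nat \<Rightarrow> real"
  assumes a: "\<And>i. a i \<in> {0, 1}" and b: "\<And>i. b i \<in> {0, 1}"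
    and "\<bar>(\<Sum>i. a i * (1/3)^i) - (\<Sum>i. b i * (1/3)^i)\<bar> < (1/3)^n / 2"
  shows "a n = b n"
  using assms(3)
proof (induction n rule: less_induct)
  case (less n)
  have sm: "summable (\<lambda>i. c i * (1/3::real)^i)" if "\<And>i. \<bar>c i\<bar> \<le> 1" for c
    by (rule summable_comparison_test'[where g="\<lambda>i. (1/3::real)^i" and N=0])
       (use that in \<open>auto simp: abs_mult summable_geometric intro!: mult_left_le_one_le\<close>)
  define c where "c i = a i - b i" for i
  have c: "\<bar>c i\<bar> \<le> 1" for i using a[of i] b[of i] by (auto simp: c_def)
  have a1: "\<bar>a i\<bar> \<le> 1" "\<bar>b i\<bar> \<le> 1" for i using a[of i] b[of i] by auto
  have diff: "(\<Sum>i. a i * (1/3)^i) - (\<Sum>i. b i * (1/3)^i) = (\<Sum>i. c i * (1/3)^i)"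
    by (subst suminf_diff) (auto simp: c_def algebra_simps intro: sm a1)
  have zero: "c j = 0" if "j < n" for j
  proof -
    have "(1/3::real)^n \<le> (1/3)^j" by (rule power_decreasing) (use that in auto)
    with less.prems have "\<bar>(\<Sum>i. a i * (1/3)^i) - (\<Sum>i. b i * (1/3)^i)\<bar> < (1/3)^j / 2"
      by linarith
    from less.IH[OF that this] show ?thesis by (simp add: c_def)
  qed
  have "(\<Sum>i. c i * (1/3)^i) = (\<Sum>i. c (i + Suc n) * (1/3)^(i + Suc n)) + (\<Sum>i<Suc n. c i * (1/3)^i)"
    by (rule suminf_split_initial_segment[OF sm[OF c]])
  also have "(\<Sum>i<Suc n. c i * (1/3)^i) = c n * (1/3)^n"
    using zero by simp
  finally have e: "(\<Sum>i. c i * (1/3)^i) = (\<Sum>i. c (i + Suc n) * (1/3)^(i + Suc n)) + c n * (1/3)^n" .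
  have g: "(\<lambda>i. (1/3::real)^(i + Suc n)) sums ((1/3)^n / 2)"
    using sums_mult2[OF geometric_sums[of "1/3::real"], of "(1/3)^Suc n"]
    by (simp add: power_add mult.commute)
  have "\<bar>\<Sum>i. c (i + Suc n) * (1/3)^(i + Suc n)\<bar> \<le> (1/3)^n / 2"
  proof -
    have "norm (\<Sum>i. c (i + Suc n) * (1/3)^(i + Suc n)) \<le> (\<Sum>i. (1/3::real)^(i + Suc n))"
      by (rule norm_suminf_le[OF _ sums_summable[OF g]])
         (use c in \<open>auto simp: abs_mult intro!: mult_left_le_one_le\<close>)
    then show ?thesis using sums_unique[OF g] by simp
  qed
  then have "\<bar>c n * (1/3)^n\<bar> < (1/3)^n"
    using less.prems unfolding diff e by linarith
  then have "\<bar>c n\<bar> * (1/3)^n < 1 * (1/3)^n"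
    by (simp add: abs_mult)
  then have "\<bar>c n\<bar> < 1" by simp
  then show ?case using a[of n] b[of n] by (auto simp: c_def)
qed

text \<open>Enumerate a countable base and code a point \<open>x\<close> by the real number \<open>s x\<close> whose ternary digits tell
which base sets contain \<open>x\<close>. The code is Borel measurable but not continuous. Its inverse is
continuous even on the closure of the codes: two distinct points are separated by a base set
\<open>B i\<close> with \<open>x \<in> B i\<close> and \<open>y \<notin> closure (B i)\<close>, so codes that agree in the \<open>i\<close>-th digit cannot belong
to points close to \<open>x\<close> and to \<open>y\<close> respectively.\<close>

lemma compact_space_real_coding:
  assumes "compact (UNIV :: 'a::{t2_space,second_countable_topology} set)"
  obtains s :: "'a::{t2_space,second_countable_topology} \<Rightarrow> real" and h C
  where "s \<in> borel_measurable borel" "compact C" "range s \<subseteq> C" "continuous_on C h" "\<And>x. h (s x) = x"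
proof -
  obtain \<B> :: "'a set set" where "countable \<B>" and basis: "topological_basis \<B>"
    using ex_countable_basis by blast
  have "\<B> \<noteq> {}"
    using basis unfolding topological_basis_def by (metis Union_empty UNIV_not_empty open_UNIV subset_empty)
  define B where "B = from_nat_into \<B>"
  have rB: "range B = \<B>"
    unfolding B_def using \<open>\<B> \<noteq> {}\<close> \<open>countable \<B>\<close> by (simp add: range_from_nat_into)
  have oB: "open (B i)" for i
    using basis rB by (metis rangeI topological_basis_open)
  have sep: "\<exists>i. x \<in> B i \<and> y \<notin> closure (B i)" if "x \<noteq> y" for x y :: 'a
  proof -
    obtain U V where UV: "open U" "open V" "x \<in> U" "y \<in> V" "U \<inter> V = {}"
      using hausdorff[OF \<open>x \<noteq> y\<close>] by blast
    obtain i where "x \<in> B i" "B i \<subseteq> U"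
      using topological_basisE[OF basis UV(1,3)] rB by (metis imageE)
    moreover have "V \<inter> closure (B i) = {}"
      using open_Int_closure_eq_empty[OF \<open>open V\<close>] UV(5) \<open>B i \<subseteq> U\<close> by blast
    ultimately show ?thesis using \<open>y \<in> V\<close> by blast
  qed
  define s where "s x = (\<Sum>i. indicator (B i) x * (1/3::real)^i)" for x
  have digits: "x \<in> B i \<longleftrightarrow> y \<in> B i" if "\<bar>s x - s y\<bar> < (1/3)^i / 2" for x y i
    using ternary_digits_determined[of "\<lambda>i. indicator (B i) x" "\<lambda>i. indicator (B i) y" i] that
    by (auto simp: s_def indicator_def split: if_splits)
  have smeas: "s \<in> borel_measurable borel"
    unfolding s_def using oB by (intro borel_measurable_suminf borel_measurable_times) auto
  have srange: "s x \<in> {0..3/2}" for x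
  proof -
    have sm: "summable (\<lambda>i. indicator (B i) x * (1/3::real)^i)"
      by (rule summable_comparison_test'[where g="\<lambda>i. (1/3::real)^i" and N=0])
         (auto simp: abs_mult summable_geometric indicator_def)
    have "s x \<le> (\<Sum>i. (1/3::real)^i)"
      unfolding s_def by (rule suminf_le[OF _ sm]) (auto simp: summable_geometric indicator_def)
    moreover have "0 \<le> s x"
      unfolding s_def by (rule suminf_nonneg[OF sm]) simp
    ultimately show ?thesis using suminf_geometric[of "1/3::real"] by simp
  qed
  \<comment> \<open>the closed graph of the decoding; it is compact and meets every vertical line at most once\<close>
  define R where "R = closure (range (\<lambda>x. (s x, x)))"
  have "R \<subseteq> {0..3/2} \<times> UNIV"
    unfolding R_def by (rule closure_minimal) (use srange in \<open>auto intro!: closed_Times\<close>)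
  then have R: "compact R"
    using compact_Int_closed[OF compact_Times[OF compact_Icc[of 0 "3/2::real"] assms], of R]
    by (simp add: R_def Int_absorb1)
  have graph: "x = y" if xR: "(t, x) \<in> R" and yR: "(t, y) \<in> R" for t x y
  proof (rule ccontr)
    assume "x \<noteq> y"
    then obtain i where i: "x \<in> B i" "y \<notin> closure (B i)" using sep by blast
    let ?e = "(1/3::real)^i / 4"
    have near: "\<exists>z. (s z, z) \<in> ball t ?e \<times> V" if "(t, v) \<in> R" "open V" "v \<in> V" for v V
    proof -
      have "(t, v) \<in> (ball t ?e \<times> V) \<inter> R" using that by simp
      then have "(ball t ?e \<times> V) \<inter> range (\<lambda>x. (s x, x)) \<noteq> {}"
        using open_Int_closure_eq_empty[OF open_Times[OF open_ball \<open>open V\<close>]] unfolding R_def by blast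
      then show ?thesis by blast
    qed
    obtain x' where x': "(s x', x') \<in> ball t ?e \<times> B i" using near[OF xR oB i(1)] by blast
    obtain y' where y': "(s y', y') \<in> ball t ?e \<times> (- closure (B i))" using near[OF yR, of "- closure (B i)"] i by auto
    have "dist t (s x') < ?e" "dist t (s y') < ?e" using x' y' by auto
    then have "\<bar>s x' - s y'\<bar> < (1/3)^i / 2" unfolding dist_real_def by linarith
    then have "y' \<in> B i" using digits x' by auto
    then show False using y' closure_subset by auto
  qed
  define C where "C = fst ` R"
  define h where "h t = (THE x. (t, x) \<in> R)" for t
  have hR: "h t = x" if "(t, x) \<in> R" for t x
    unfolding h_def by (rule the_equality[where P="\<lambda>x. (t, x) \<in> R", OF that]) (rule graph[OF _ that])
  have inR: "(s x, x) \<in> R" for x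
    unfolding R_def by (rule subsetD[OF closure_subset]) simp
  have "compact C"
    unfolding C_def by (rule compact_continuous_image[OF continuous_on_fst R]) (rule continuous_on_id)
  moreover have "continuous_on C h"
    unfolding continuous_on_closed_vimage[OF compact_imp_closed[OF \<open>compact C\<close>]]
  proof safe
    fix F :: "'a set" assume "closed F"
    have "t \<in> h -` F \<inter> C \<longleftrightarrow> t \<in> fst ` (R \<inter> UNIV \<times> F)" for t
      unfolding C_def by (auto simp: hR image_iff)
    then have "h -` F \<inter> C = fst ` (R \<inter> UNIV \<times> F)"
      by blast
    moreover have "compact (fst ` (R \<inter> UNIV \<times> F))"
      by (rule compact_continuous_image) (auto intro!: continuous_intros compact_Int_closed R closed_Times \<open>closed F\<close>)
    ultimately show "closed (h -` F \<inter> C)"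
      by (simp add: compact_imp_closed)
  qed
  moreover have "range s \<subseteq> C" unfolding C_def using image_eqI[OF _ inR, of _ fst] by auto
  ultimately show ?thesis by (intro that[OF smeas, of C h] hR[OF inR])
qed

text \<open>The images of the measures under the code \<open>s\<close> live on one bounded set of reals, so Helly's selection
theorem provides a weak limit \<open>N\<close> of a subsequence; \<open>N\<close> lives on the compact set \<open>C\<close>, and its image
under the decoding \<open>h\<close> is the limit sought. A continuous function \<open>\<phi>\<close> on the space becomes the
continuous function \<open>\<phi> \<circ> h\<close> on \<open>C\<close>, which Tietze's theorem extends to the real line.\<close>

lemma prob_measures_sequentially_compact:
  fixes \<sigma> :: "nat \<Rightarrow> 'a::{t2_space,second_countable_topology} measure"
  assumes compact: "compact (UNIV :: 'a set)" and \<sigma>: "\<And>n. \<sigma> n \<in> prob_measures"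
  obtains \<mu> r where "strict_mono (r :: nat \<Rightarrow> nat)" "limitin weak_star_topology (\<sigma> \<circ> r) \<mu> sequentially"
proof -
  obtain s :: "'a \<Rightarrow> real" and h C where s: "s \<in> borel_measurable borel" and C: "compact C"
    and sC: "range s \<subseteq> C" and h: "continuous_on C h" and hs: "\<And>x. h (s x) = x"
    by (rule compact_space_real_coding[OF compact]) iprover
  note P = prob_measuresD[OF \<sigma>]
  have s_meas: "s \<in> measurable (\<sigma> n) borel" for n
    using s P(2)[of n] by (simp cong: measurable_cong_sets)
  define \<nu> where "\<nu> n = distr (\<sigma> n) borel s" for n
  have \<nu>: "real_distribution (\<nu> n)" for n
    unfolding \<nu>_def real_distribution_def real_distribution_axioms_def
    using prob_space.prob_space_distr[OF P(1) s_meas] by simp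
  have \<nu>_int: "(\<integral>t. \<psi> t \<partial>\<nu> n) = (\<integral>x. \<psi> (s x) \<partial>\<sigma> n)" if "continuous_on UNIV \<psi>"
    for \<psi> :: "real \<Rightarrow> 'b::{banach,second_countable_topology}" and n
    unfolding \<nu>_def by (rule integral_distr[OF s_meas borel_measurable_continuous_onI[OF that]])
  obtain b where b: "C \<subseteq> {-b<..b}"
  proof -
    obtain a where "\<forall>x\<in>C. norm x \<le> a" using compact_imp_bounded[OF C] unfolding bounded_iff ..
    then show ?thesis by (intro that[of "a+1"]) (force simp: abs_le_iff)
  qed
  have one: "measure (\<nu> n) {- \<bar>b\<bar> - 1<..\<bar>b\<bar> + 1} = 1" for n
  proof -
    have "measure (\<nu> n) {- \<bar>b\<bar> - 1<..\<bar>b\<bar> + 1} = measure (\<sigma> n) UNIV"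
      unfolding \<nu>_def
    proof (subst measure_distr[OF s_meas])
      have "s x \<in> {- b<..b}" for x using sC b by blast
      then have "- b < s x" "s x \<le> b" for x by auto
      note bnd = this
      have "- \<bar>b\<bar> - 1 < s x" "s x \<le> \<bar>b\<bar> + 1" for x using bnd[of x] by linarith+
      then show "measure (\<sigma> n) (s -` {- \<bar>b\<bar> - 1<..\<bar>b\<bar> + 1} \<inter> space (\<sigma> n)) = measure (\<sigma> n) UNIV"
        using P(3) by (intro arg_cong2[where f=measure]) auto
    qed simp
    also have "\<dots> = 1" using prob_space.prob_space[OF P(1)] P(3) by simp
    finally show ?thesis .
  qed
  have "tight \<nu>"
    unfolding tight_def
  proof (intro conjI allI impI \<nu>)
    fix e :: real assume "0 < e"
    then have "- \<bar>b\<bar> - 1 < \<bar>b\<bar> + 1 \<and> (\<forall>n. 1 - e < measure (\<nu> n) {- \<bar>b\<bar> - 1<..\<bar>b\<bar> + 1})"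
      unfolding one by simp
    then show "\<exists>a b. a < b \<and> (\<forall>n. 1 - e < measure (\<nu> n) {a<..b})" by iprover
  qed
  from tight_imp_convergent_subsubsequence[OF this strict_mono_id]
  obtain r N where r: "strict_mono (r :: nat \<Rightarrow> nat)" and N: "real_distribution N"
    and conv: "weak_conv_m (\<nu> \<circ> r) N" by (auto simp: o_def)
  interpret N: real_distribution N by fact
  have lim: "(\<lambda>n. \<integral>t. \<psi> t \<partial>\<nu> (r n)) \<longlonglongrightarrow> (\<integral>t. \<psi> t \<partial>N)"
    if "continuous_on UNIV \<psi>" "\<And>t. norm (\<psi> t) \<le> B"
    for \<psi> :: "real \<Rightarrow> 'b::{banach,second_countable_topology}" and B
  proof -
    have "(\<lambda>n. integral\<^sup>L ((\<nu> \<circ> r) n) \<psi>) \<longlonglongrightarrow> integral\<^sup>L N \<psi>"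
      by (rule weak_conv_imp_integral_bdd_continuous_conv[OF _ N conv _ that(2)])
         (use \<nu> that(1) in \<open>auto simp: continuous_on_eq_continuous_at\<close>)
    then show ?thesis by simp
  qed
  have "C \<noteq> {}" using sC by auto
  have "AE t in N. t \<in> C"
  proof -
    \<comment> \<open>a bounded continuous function that vanishes exactly on \<open>C\<close>\<close>
    let ?\<psi> = "\<lambda>t. min 1 (infdist t C)"
    have c: "continuous_on UNIV ?\<psi>" by (intro continuous_intros)
    have "(\<integral>t. ?\<psi> t \<partial>\<nu> n) = 0" for n
    proof -
      have "?\<psi> (s x) = 0" for x using sC by (simp add: subset_iff)
      then show ?thesis unfolding \<nu>_int[OF c] by simp
    qed
    moreover have "(\<lambda>n. \<integral>t. ?\<psi> t \<partial>\<nu> (r n)) \<longlonglongrightarrow> (\<integral>t. ?\<psi> t \<partial>N)"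
      by (rule lim[OF c, of 1]) (simp add: infdist_nonneg)
    ultimately have "(\<integral>t. ?\<psi> t \<partial>N) = 0"
      by (simp add: LIMSEQ_const_iff)
    moreover have "integrable N ?\<psi>"
    proof (rule N.integrable_const_bound[of _ 1])
      show "?\<psi> \<in> borel_measurable N"
        using borel_measurable_continuous_onI[OF c] by (simp cong: measurable_cong_sets)
    qed (simp add: infdist_nonneg)
    ultimately have "AE t in N. ?\<psi> t = 0"
      using integral_nonneg_eq_0_iff_AE[of N ?\<psi>] by (simp add: infdist_nonneg)
    moreover have "t \<in> C" if "?\<psi> t = 0" for t
    proof -
      have "infdist t C = 0" using that by (simp add: min_def split: if_splits)
      then show ?thesis
        by (simp add: in_closed_iff_infdist_zero[OF compact_imp_closed[OF C] \<open>C \<noteq> {}\<close>])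
    qed
    ultimately show ?thesis by (rule eventually_mono)
  qed
  \<comment> \<open>outside \<open>C\<close>, a null set of \<open>N\<close>, the value is arbitrary\<close>
  define k where "k t = (if t \<in> C then h t else h (s undefined))" for t
  have k[measurable]: "k \<in> measurable borel borel"
    unfolding k_def
  proof (subst measurable_If_restrict_space_iff)
    show "{x \<in> space borel. x \<in> C} \<in> sets borel" using borel_compact[OF C] by simp
    show "h \<in> restrict_space borel {x. x \<in> C} \<rightarrow>\<^sub>M borel \<and>
        (\<lambda>t. h (s undefined)) \<in> restrict_space borel {x. x \<notin> C} \<rightarrow>\<^sub>M borel"
      using borel_measurable_continuous_on_restrict[OF h] by simp
  qed
  have kN: "k \<in> measurable N borel" using k by (simp cong: measurable_cong_sets)
  define \<mu> where "\<mu> = distr N borel k"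
  have \<mu>: "\<mu> \<in> prob_measures"
    unfolding \<mu>_def prob_measures_def using N.prob_space_distr[OF kN] by simp
  have "(\<lambda>n. \<integral>x. \<phi> x \<partial>(\<sigma> \<circ> r) n) \<longlonglongrightarrow> (\<integral>x. \<phi> x \<partial>\<mu>)"
    if \<phi>: "continuous_on UNIV \<phi>" for \<phi> :: "'a \<Rightarrow> complex"
  proof -
    have ch: "continuous_on C (\<phi> \<circ> h)"
      by (rule continuous_on_compose[OF h]) (rule continuous_on_subset[OF \<phi>], simp)
    obtain B where B: "\<And>t. t \<in> C \<Longrightarrow> norm ((\<phi> \<circ> h) t) \<le> \<bar>B\<bar>"
    proof -
      obtain B where "\<forall>y\<in>(\<phi> \<circ> h) ` C. norm y \<le> B"
        using compact_imp_bounded[OF compact_continuous_image[OF ch C]] unfolding bounded_iff ..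
      then show ?thesis by (intro that[of B]) (simp add: abs_le_iff order_trans[OF _ abs_ge_self])
    qed
    obtain \<psi> where \<psi>: "continuous_on UNIV \<psi>" "\<And>t. t \<in> C \<Longrightarrow> \<psi> t = (\<phi> \<circ> h) t" "\<And>t. norm (\<psi> t) \<le> \<bar>B\<bar>"
    proof (rule Tietze[OF ch, of UNIV "\<bar>B\<bar>"])
      show "closedin (top_of_set UNIV) C" using compact_imp_closed[OF C] by simp
    qed (use B that in \<open>simp_all\<close>)
    have "(\<integral>t. \<psi> t \<partial>\<nu> n) = (\<integral>x. \<phi> x \<partial>\<sigma> n)" for n
    proof -
      have "\<psi> (s x) = \<phi> x" for x using sC hs by (simp add: \<psi>(2) subset_iff)
      then show ?thesis unfolding \<nu>_int[OF \<psi>(1)] by simp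
    qed
    moreover have "(\<integral>x. \<phi> x \<partial>\<mu>) = (\<integral>t. \<psi> t \<partial>N)"
    proof -
      have "(\<integral>x. \<phi> x \<partial>\<mu>) = (\<integral>t. \<phi> (k t) \<partial>N)"
        unfolding \<mu>_def by (rule integral_distr[OF kN borel_measurable_continuous_onI[OF \<phi>]])
      also have "\<dots> = (\<integral>t. \<psi> t \<partial>N)"
      proof (rule integral_cong_AE)
        show "AE t in N. \<phi> (k t) = \<psi> t"
          using \<open>AE t in N. t \<in> C\<close> by (rule eventually_mono) (simp add: k_def \<psi>(2))
        show "(\<lambda>t. \<phi> (k t)) \<in> borel_measurable N"
          by (rule measurable_compose[OF kN borel_measurable_continuous_onI[OF \<phi>]])
        show "\<psi> \<in> borel_measurable N"
          using borel_measurable_continuous_onI[OF \<psi>(1)] by (simp cong: measurable_cong_sets)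
      qed
      finally show ?thesis .
    qed
    ultimately show ?thesis using lim[OF \<psi>(1,3)] by simp
  qed
  then have "limitin weak_star_topology (\<sigma> \<circ> r) \<mu> sequentially"
    unfolding limitin_weak_star using \<mu> \<sigma> by simp
  with r show ?thesis by (rule that)
qed

lemma continuous_bounded_on_compact_space:
  fixes \<phi> :: "'a::topological_space \<Rightarrow> 'b::real_normed_vector"
  assumes "compact (UNIV :: 'a set)" "continuous_on UNIV \<phi>"
  obtains B where "\<And>x. norm (\<phi> x) \<le> B"
proof -
  obtain B where "\<forall>y\<in>range \<phi>. norm y \<le> B"
    using compact_imp_bounded[OF compact_continuous_image[OF assms(2,1)]] unfolding bounded_iff ..
  then show ?thesis by (intro that[of B]) simp
qed

lemma integrable_continuous_prob:
  fixes \<phi> :: "'a::topological_space \<Rightarrow> 'b::{banach,second_countable_topology}"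
  assumes "compact (UNIV :: 'a set)" "continuous_on UNIV \<phi>" "\<mu> \<in> prob_measures"
  shows "integrable \<mu> \<phi>"
proof -
  note P = prob_measuresD[OF assms(3)]
  interpret prob_space \<mu> by (rule P)
  obtain B where "\<And>x. norm (\<phi> x) \<le> B"
    by (rule continuous_bounded_on_compact_space[OF assms(1,2)]) iprover
  then show ?thesis
    using borel_measurable_continuous_onI[OF assms(2)] P(2)
    by (intro integrable_const_bound[of \<phi> B]) (simp_all cong: measurable_cong_sets)
qed

lemma bind_prob_measures:
  fixes N :: "'b \<Rightarrow> 'a::topological_space measure"
  assumes "prob_space M" "N \<in> measurable M (subprob_algebra borel)" "\<And>x. N x \<in> prob_measures"
  shows "M \<bind> N \<in> prob_measures"
proof -
  interpret prob_space M by fact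
  have "prob_space (M \<bind> N)"
    by (rule prob_space_bind[OF _ assms(2)]) (simp add: prob_measuresD[OF assms(3)])
  moreover have "sets (M \<bind> N) = sets borel"
    by (rule sets_bind) (simp_all add: prob_measuresD[OF assms(3)] not_empty)
  ultimately show ?thesis by (simp add: prob_measures_def)
qed

lemma integral_bind_continuous:
  fixes N :: "'b \<Rightarrow> 'a::topological_space measure" and \<phi> :: "'a \<Rightarrow> complex"
  assumes "compact (UNIV :: 'a set)" "prob_space M" "N \<in> measurable M (subprob_algebra borel)"
    "\<And>x. N x \<in> prob_measures" "continuous_on UNIV \<phi>"
  shows "(\<integral>y. \<phi> y \<partial>(M \<bind> N)) = (\<integral>x. (\<integral>y. \<phi> y \<partial>N x) \<partial>M)" (is ?eq)
    and "integrable M (\<lambda>x. \<integral>y. \<phi> y \<partial>N x)" (is ?int)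
proof -
  interpret prob_space M by fact
  obtain B where B: "\<And>x. norm (\<phi> x) \<le> B"
    by (rule continuous_bounded_on_compact_space[OF assms(1,5)]) iprover
  have \<phi>: "\<phi> \<in> borel_measurable borel" by (rule borel_measurable_continuous_onI[OF assms(5)])
  note P = prob_measuresD[OF assms(4)]
  have int: "integrable (N x) \<phi>" for x
    by (rule integrable_continuous_prob[OF assms(1,5,4)])
  show i: ?int
  proof (rule integrable_const_bound[of _ B])
    have "norm (\<integral>y. \<phi> y \<partial>N x) \<le> B" for x
    proof -
      interpret N: prob_space "N x" by (rule P)
      have "norm (\<integral>y. \<phi> y \<partial>N x) \<le> (\<integral>y. norm (\<phi> y) \<partial>N x)" by (rule integral_norm_bound)
      also have "\<dots> \<le> (\<integral>y. B \<partial>N x)"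
        by (rule integral_mono) (simp_all add: int B)
      finally show ?thesis by (simp add: N.prob_space)
    qed
    then show "AE x in M. norm (\<integral>y. \<phi> y \<partial>N x) \<le> B" by simp
    show "(\<lambda>x. \<integral>y. \<phi> y \<partial>N x) \<in> borel_measurable M"
      by (rule measurable_compose[OF assms(3) integral_measurable_subprob_algebra[OF \<phi>]])
  qed
  have real: "(\<integral>y. h (\<phi> y) \<partial>(M \<bind> N)) = (\<integral>x. (\<integral>y. h (\<phi> y) \<partial>N x) \<partial>M)"
    if "h \<in> borel_measurable borel" "\<And>z. \<bar>h z\<bar> \<le> norm z" for h :: "complex \<Rightarrow> real"
  proof (rule integral_bind[OF _ _ assms(3), where B=B and B'=1])
    show "\<bar>h (\<phi> x)\<bar> \<le> B" for x using that(2)[of "\<phi> x"] B[of x] by linarith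
    show "AE x in M. emeasure (N x) (space (N x)) \<le> ennreal 1"
      by (simp add: prob_space.emeasure_space_1[OF P(1)])
    show "(\<lambda>y. h (\<phi> y)) \<in> borel_measurable borel" by (rule measurable_compose[OF \<phi> that(1)])
  qed (rule finite_measure_axioms)
  have iMN: "integrable (M \<bind> N) \<phi>"
    by (rule integrable_continuous_prob[OF assms(1,5) bind_prob_measures[OF assms(2-4)]])
  show ?eq
  proof (rule complex_eqI)
    show "Re (\<integral>y. \<phi> y \<partial>(M \<bind> N)) = Re (\<integral>x. (\<integral>y. \<phi> y \<partial>N x) \<partial>M)"
      using real[of Re] by (simp add: integral_Re[symmetric] int i iMN abs_Re_le_cmod del: integral_Re)
    show "Im (\<integral>y. \<phi> y \<partial>(M \<bind> N)) = Im (\<integral>x. (\<integral>y. \<phi> y \<partial>N x) \<partial>M)"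
      using real[of Im] by (simp add: integral_Im[symmetric] int i iMN abs_Im_le_cmod del: integral_Im)
  qed
qed

text \<open>The average is a mixture over an index drawn uniformly from \<open>{1..n}\<close>, so its properties are those of
the Giry bind.\<close>

lemma
  fixes \<nu> :: "nat \<Rightarrow> 'a::topological_space measure"
  assumes n: "1 \<le> n" and \<nu>: "\<And>j. \<nu> j \<in> prob_measures"
  shows average_measure_prob: "average_measure n \<nu> \<in> prob_measures"
    and integral_average_measure:
      "\<And>\<phi>. compact (UNIV :: 'a set) \<Longrightarrow> continuous_on UNIV (\<phi> :: 'a \<Rightarrow> complex) \<Longrightarrow>
        (\<integral>x. \<phi> x \<partial>average_measure n \<nu>) = (\<Sum>j=1..n. \<integral>x. \<phi> x \<partial>\<nu> j) / of_nat n"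
proof -
  let ?M = "measure_pmf (pmf_of_set {1..n})"
  have ne: "{1..n} \<noteq> {}" using n by simp
  have meas: "\<nu> \<in> measurable ?M (subprob_algebra borel)"
    by (simp add: measurable_count_space_eq1 space_subprob_algebra Pi_iff prob_measuresD[OF \<nu>]
        prob_space_imp_subprob_space cong: measurable_cong_sets)
  have em: "emeasure (?M \<bind> \<nu>) A = (\<Sum>j=1..n. emeasure (\<nu> j) A) / of_nat n" if "A \<in> sets borel" for A
  proof -
    have "emeasure (?M \<bind> \<nu>) A = (\<integral>\<^sup>+j. emeasure (\<nu> j) A \<partial>?M)"
      by (rule emeasure_bind[OF _ meas that]) simp
    also have "\<dots> = (\<Sum>j\<in>{1..n}. emeasure (\<nu> j) A) / of_nat (card {1..n})"
      unfolding nn_integral_pmf_of_set[OF ne finite_atLeastAtMost] by (simp add: ennreal_of_nat_eq_real_of_nat)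
    finally show ?thesis by simp
  qed
  have P: "?M \<bind> \<nu> \<in> prob_measures"
    by (rule bind_prob_measures[OF prob_space_measure_pmf meas \<nu>])
  have eq: "average_measure n \<nu> = ?M \<bind> \<nu>"
  proof -
    have "average_measure n \<nu> = measure_of UNIV (sets borel) (emeasure (?M \<bind> \<nu>))"
      unfolding average_measure_def
    proof (rule measure_of_eq)
      show "(\<Sum>j = 1..n. emeasure (\<nu> j) A) / of_nat n = emeasure (?M \<bind> \<nu>) A"
        if "A \<in> sigma_sets UNIV (sets borel)" for A
        using em that sets.sigma_sets_eq[of "borel :: 'a measure"] by simp
    qed simp
    also have "\<dots> = ?M \<bind> \<nu>"
      using measure_of_of_measure[of "?M \<bind> \<nu>"] prob_measuresD(2,3)[OF P] by simp
    finally show ?thesis .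
  qed
  show "average_measure n \<nu> \<in> prob_measures" unfolding eq by (rule P)
  show "(\<integral>x. \<phi> x \<partial>average_measure n \<nu>) = (\<Sum>j=1..n. \<integral>x. \<phi> x \<partial>\<nu> j) / of_nat n"
    if "compact (UNIV :: 'a set)" "continuous_on UNIV \<phi>" for \<phi> :: "'a \<Rightarrow> complex"
  proof -
    have "(\<integral>j. (\<integral>x. \<phi> x \<partial>\<nu> j) \<partial>?M) = (\<Sum>j\<in>{1..n}. pmf (pmf_of_set {1..n}) j *\<^sub>R (\<integral>x. \<phi> x \<partial>\<nu> j))"
      by (rule integral_measure_pmf) (use set_pmf_of_set[OF ne finite_atLeastAtMost] in auto)
    also have "\<dots> = (\<Sum>j\<in>{1..n}. (\<integral>x. \<phi> x \<partial>\<nu> j) / of_nat n)"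
      by (rule sum.cong) (simp_all only: pmf_of_set[OF ne finite_atLeastAtMost], simp_all add: scaleR_conv_of_real)
    finally show ?thesis
      unfolding eq integral_bind_continuous(1)[OF that(1) prob_space_measure_pmf meas \<nu> that(2)]
      by (simp add: sum_divide_distrib)
  qed
qed

lemma return_prob_measures: "return borel x \<in> prob_measures"
  by (simp add: prob_measures_def prob_space_return)

section \<open>Metrics that induce the weak* topology\<close>

locale weak_star_metric =
  fixes d :: "'a::{t2_space,second_countable_topology} measure \<Rightarrow> 'a measure \<Rightarrow> real"
  assumes compact_UNIV: "compact (UNIV :: 'a set)"
    and induces: "induces_weak_star d"
begin

sublocale Metric_space prob_measures d
  using induces by (simp add: induces_weak_star_def)

lemma mtopology_eq: "mtopology = weak_star_topology"
  using induces by (simp add: induces_weak_star_def)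

lemma weak_star_limit_iff:
  "limitin weak_star_topology \<sigma> \<mu> F \<longleftrightarrow>
    \<mu> \<in> prob_measures \<and> (\<forall>\<^sub>F i in F. \<sigma> i \<in> prob_measures) \<and> ((\<lambda>i. d (\<sigma> i) \<mu>) \<longlongrightarrow> 0) F"
  using limitin_metric_dist_null mtopology_eq by simp

text \<open>If the integrals agree, the constant sequence \<open>\<mu>\<close> converges to \<open>\<nu>\<close> in the weak* topology, and limits
in a metric space are unique.\<close>

lemma measure_eqI_continuous:
  assumes "\<mu> \<in> prob_measures" "\<nu> \<in> prob_measures"
    and "\<And>\<phi> :: 'a \<Rightarrow> complex. continuous_on UNIV \<phi> \<Longrightarrow> (\<integral>x. \<phi> x \<partial>\<mu>) = (\<integral>x. \<phi> x \<partial>\<nu>)"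
  shows "\<mu> = \<nu>"
proof -
  have "limitin weak_star_topology (\<lambda>n::nat. \<mu>) \<nu> sequentially"
    unfolding limitin_weak_star using assms by simp
  then have "(\<lambda>n::nat. d \<mu> \<nu>) \<longlonglongrightarrow> 0"
    unfolding weak_star_limit_iff by iprover
  then have "d \<mu> \<nu> = 0" by (simp add: LIMSEQ_const_iff)
  then show ?thesis using assms(1,2) by simp
qed

lemma convergent_subsequence:
  assumes "\<And>n::nat. \<sigma> n \<in> prob_measures"
  obtains \<mu> r where "strict_mono (r :: nat \<Rightarrow> nat)" "\<mu> \<in> prob_measures" "(\<lambda>n. d (\<sigma> (r n)) \<mu>) \<longlonglongrightarrow> 0"
    "limitin weak_star_topology (\<lambda>n. \<sigma> (r n)) \<mu> sequentially"
proof -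
  obtain \<mu> r where r: "strict_mono (r :: nat \<Rightarrow> nat)" and l: "limitin weak_star_topology (\<sigma> \<circ> r) \<mu> sequentially"
    by (rule prob_measures_sequentially_compact[OF compact_UNIV assms])
  from l have "\<mu> \<in> prob_measures" "(\<lambda>n. d (\<sigma> (r n)) \<mu>) \<longlonglongrightarrow> 0" "limitin weak_star_topology (\<lambda>n. \<sigma> (r n)) \<mu> sequentially"
    using weak_star_limit_iff[of "\<sigma> \<circ> r"] by (simp_all add: o_def)
  with r show ?thesis by (rule that)
qed

text \<open>By compactness, two sequences of measures that stay apart have, along a common subsequence, the
limit of the first one; their integrals being asymptotically equal, it is also the limit of the
second one.\<close>

lemma dist_tendsto_0I:
  assumes \<mu>: "\<And>n. \<mu> n \<in> prob_measures" and \<nu>: "\<And>n. \<nu> n \<in> prob_measures"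
    and int: "\<And>\<phi> :: 'a \<Rightarrow> complex. continuous_on UNIV \<phi> \<Longrightarrow> (\<lambda>n. (\<integral>x. \<phi> x \<partial>\<mu> n) - (\<integral>x. \<phi> x \<partial>\<nu> n)) \<longlonglongrightarrow> 0"
  shows "(\<lambda>n::nat. d (\<mu> n) (\<nu> n)) \<longlonglongrightarrow> 0"
proof (rule ccontr)
  assume "\<not> ?thesis"
  then obtain e where e: "e > 0" "\<not> (\<forall>\<^sub>F n in sequentially. d (\<mu> n) (\<nu> n) < e)"
    unfolding tendsto_iff dist_real_def by (auto simp: nonneg)
  then have "\<exists>\<^sub>F n in sequentially. e \<le> d (\<mu> n) (\<nu> n)"
    by (simp add: frequently_def not_le)
  then have "infinite {n. e \<le> d (\<mu> n) (\<nu> n)}"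
    by (simp add: frequently_cofinite cofinite_eq_sequentially[symmetric])
  then obtain q :: "nat \<Rightarrow> nat" where q: "strict_mono q" "\<And>n. e \<le> d (\<mu> (q n)) (\<nu> (q n))"
    by (metis (no_types, lifting) infinite_enumerate mem_Collect_eq)
  obtain \<mu>' r where r: "strict_mono (r :: nat \<Rightarrow> nat)" and \<mu>': "\<mu>' \<in> prob_measures"
    and l1: "(\<lambda>n. d (\<mu> (q (r n))) \<mu>') \<longlonglongrightarrow> 0"
    and l2: "limitin weak_star_topology (\<lambda>n. \<mu> (q (r n))) \<mu>' sequentially"
    by (rule convergent_subsequence[of "\<lambda>n. \<mu> (q n)", OF \<mu>])
  have "limitin weak_star_topology (\<lambda>n. \<nu> (q (r n))) \<mu>' sequentially"
    unfolding limitin_weak_star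
  proof (intro conjI allI impI \<mu>')
    fix \<phi> :: "'a \<Rightarrow> complex" assume \<phi>: "continuous_on UNIV \<phi>"
    have "(\<lambda>n. \<integral>x. \<phi> x \<partial>\<mu> (q (r n))) \<longlonglongrightarrow> (\<integral>x. \<phi> x \<partial>\<mu>')"
      using l2 \<phi> unfolding limitin_weak_star by iprover
    moreover have "(\<lambda>n. (\<integral>x. \<phi> x \<partial>\<mu> (q (r n))) - (\<integral>x. \<phi> x \<partial>\<nu> (q (r n)))) \<longlonglongrightarrow> 0"
      using LIMSEQ_subseq_LIMSEQ[OF int[OF \<phi>] strict_mono_o[OF q(1) r]] by (simp add: o_def)
    ultimately have "(\<lambda>n. (\<integral>x. \<phi> x \<partial>\<mu> (q (r n))) - ((\<integral>x. \<phi> x \<partial>\<mu> (q (r n))) - (\<integral>x. \<phi> x \<partial>\<nu> (q (r n))))) \<longlonglongrightarrow> (\<integral>x. \<phi> x \<partial>\<mu>') - 0"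
      by (rule tendsto_diff)
    then show "(\<lambda>n. \<integral>x. \<phi> x \<partial>\<nu> (q (r n))) \<longlonglongrightarrow> (\<integral>x. \<phi> x \<partial>\<mu>')" by simp
  qed (simp add: \<nu>)
  then have "(\<lambda>n. d (\<nu> (q (r n))) \<mu>') \<longlonglongrightarrow> 0" unfolding weak_star_limit_iff by iprover
  with l1 have "(\<lambda>n. d (\<mu> (q (r n))) \<mu>' + d (\<nu> (q (r n))) \<mu>') \<longlonglongrightarrow> 0 + 0" by (rule tendsto_add)
  moreover have "e \<le> d (\<mu> (q (r n))) \<mu>' + d (\<nu> (q (r n))) \<mu>'" for n
    using q(2)[of "r n"] triangle[OF \<mu> \<mu>' \<nu>, of "q (r n)" "q (r n)"] commute[of \<mu>' "\<nu> (q (r n))"] by linarith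
  ultimately have "e \<le> 0 + 0"
    by (intro LIMSEQ_le_const) auto
  with e show False by simp
qed

end

section \<open>An Egorov theorem\<close>

text \<open>In the application \<open>B k n\<close> is the set of points at which a pointwise convergent sequence still deviates
by \<open>1 / Suc k\<close> at or after time \<open>n\<close>; on \<open>A\<close> the convergence is uniform.\<close>

lemma egorov:
  assumes "finite_measure M" and pos: "0 < emeasure M (space M)"
    and B: "\<And>k n. B k n \<in> sets M" and dec: "\<And>k. decseq (B k)"
    and null: "\<And>k. (\<Inter>n. B k n) \<in> null_sets M"
  obtains A where "A \<in> sets M" "0 < emeasure M A" "\<And>k::nat. \<exists>n::nat. A \<inter> B k n = {}"
proof -
  interpret finite_measure M by fact
  define c where "c = measure M (space M)"
  have c: "0 < c" using pos by (simp add: c_def emeasure_eq_measure)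
  have "\<exists>n. measure M (B k n) < c * (1/2)^(k+2)" for k
  proof -
    have "(\<lambda>n. measure M (B k n)) \<longlonglongrightarrow> measure M (\<Inter>n. B k n)"
      by (rule finite_Lim_measure_decseq[OF _ dec]) (use B in auto)
    then have lim: "(\<lambda>n. measure M (B k n)) \<longlonglongrightarrow> 0"
      unfolding measure_eq_0_null_sets[OF null] .
    have "0 < c * (1/2)^(k+2)" using c by simp
    from order_tendstoD(2)[OF lim this]
    have "\<forall>\<^sub>F n in sequentially. measure M (B k n) < c * (1/2)^(k+2)" .
    then show ?thesis by (rule eventually_happens'[OF sequentially_bot])
  qed
  then have "\<exists>N. \<forall>k. measure M (B k (N k)) < c * (1/2)^(k+2)" by (intro choice allI)
  then obtain N where N: "\<And>k. measure M (B k (N k)) < c * (1/2)^(k+2)" by iprover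
  \<comment> \<open>the exceptional sets of the levels add up to at most half of the total measure\<close>
  let ?U = "\<Union>k. B k (N k)"
  have U: "?U \<in> sets M" using B by (intro sets.countable_UN) auto
  have sums: "(\<lambda>k. c * (1/2)^(k+2)) sums (c / 2)"
    using sums_mult[OF geometric_sums[of "1/2::real"], of "c/4"] by (simp add: power_add)
  have sm: "summable (\<lambda>k. measure M (B k (N k)))"
    by (rule summable_comparison_test'[OF sums_summable[OF sums], of 0]) (use N less_imp_le in auto)
  have "measure M ?U \<le> (\<Sum>k. measure M (B k (N k)))"
    by (rule finite_measure_subadditive_countably[OF _ sm]) (use B in auto)
  also have "\<dots> \<le> (\<Sum>k. c * (1/2)^(k+2))"
    by (rule suminf_le[OF less_imp_le[OF N] sm sums_summable[OF sums]])
  also have "\<dots> = c / 2" by (rule sums_unique[OF sums, symmetric])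
  finally have "0 < measure M (space M - ?U)" using c finite_measure_compl[OF U] by (simp add: c_def)
  then have "0 < emeasure M (space M - ?U)" by (simp add: emeasure_eq_measure)
  moreover have "(space M - ?U) \<inter> B k (N k) = {}" for k by blast
  ultimately show ?thesis using U by (intro that[of "space M - ?U"]) auto
qed

section \<open>Noisy dynamics on a compact space\<close>

text \<open>These assumptions are all that the dynamical part uses of the Riemannian distance and volume.\<close>

locale noisy_dynamics = weak_star_metric d
  for d :: "'a::{t2_space,second_countable_topology} measure \<Rightarrow> 'a measure \<Rightarrow> real" +
  fixes f :: "'a \<Rightarrow> 'a" and m :: "'a measure" and b :: "'a \<Rightarrow> real \<Rightarrow> 'a set"
  assumes continuous_map: "continuous_on UNIV f"
    and finite_m: "finite_measure m" and sets_m: "sets m = sets borel"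
    and open_ball_relation: "\<And>e. open {(x, y). y \<in> b x e}"
    and ball_pos: "\<And>x e. 0 < e \<Longrightarrow> 0 < emeasure m (b x e)"
    and ball_small: "\<And>x U. open U \<Longrightarrow> x \<in> U \<Longrightarrow> \<exists>V e. open V \<and> x \<in> V \<and> 0 < e \<and> (\<forall>y\<in>V. b y e \<subseteq> U)"
    and ball_mono: "\<And>x e e'. e \<le> e' \<Longrightarrow> b x e \<subseteq> b x e'"
begin

lemma space_m: "space m = UNIV"
  using sets_eq_imp_space_eq[OF sets_m] by simp

lemma iterate_continuous: "continuous_on UNIV (f ^^ j)"
proof (induction j)
  case (Suc j)
  have "continuous_on UNIV (f \<circ> (f ^^ j))"
    by (rule continuous_on_compose[OF Suc continuous_on_subset[OF continuous_map]]) simp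
  then show ?case by simp
qed (simp add: continuous_on_id)

abbreviation noise :: "real \<Rightarrow> 'a \<Rightarrow> 'a measure" where "noise \<equiv> noise_kernel b m f"
abbreviation T :: "real \<Rightarrow> ('a \<Rightarrow> complex) \<Rightarrow> 'a \<Rightarrow> complex" where "T \<equiv> transfer b m f"
abbreviation dual :: "real \<Rightarrow> 'a measure \<Rightarrow> 'a measure" where "dual \<equiv> dual_transfer b m f"

lemma open_noise_relation: "open {(x, y). y \<in> b (f x) e}"
proof -
  have "open ((\<lambda>z. (f (fst z), snd z)) -` {(x, y). y \<in> b x e})"
    by (rule open_vimage[OF open_ball_relation])
       (intro continuous_intros continuous_on_compose2[OF continuous_map continuous_on_fst], auto intro: continuous_on_id)
  moreover have "(\<lambda>z. (f (fst z), snd z)) -` {(x, y). y \<in> b x e} = {(x, y). y \<in> b (f x) e}" by auto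
  ultimately show ?thesis by simp
qed

lemma ball_sets: "b x e \<in> sets m"
proof -
  have "open (Pair x -` {(x, y). y \<in> b x e})"
    by (rule open_vimage[OF open_ball_relation]) (intro continuous_intros)
  moreover have "Pair x -` {(x, y). y \<in> b x e} = b x e" by auto
  ultimately show ?thesis by (simp add: sets_m)
qed

lemma noise_prob: "0 < e \<Longrightarrow> noise e x \<in> prob_measures"
proof -
  assume "0 < e"
  then have "prob_space (noise e x)"
    unfolding noise_kernel_def
    using ball_pos[of e "f x"] finite_measure.emeasure_finite[OF finite_m, of "b (f x) e"]
    by (intro prob_space_uniform_measure) auto
  then show ?thesis by (simp add: prob_measures_def noise_kernel_def sets_m)
qed

lemma noise_measurable: "0 < e \<Longrightarrow> noise e \<in> measurable borel (subprob_algebra borel)"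
proof (rule measurable_subprob_algebra)
  assume e: "0 < e"
  show "subprob_space (noise e x)" for x
    by (rule prob_space_imp_subprob_space[OF prob_measuresD(1)[OF noise_prob[OF e]]])
  show "sets (noise e x) = sets borel" for x
    by (rule prob_measuresD(2)[OF noise_prob[OF e]])
  interpret finite_measure m by (rule finite_m)
  have meas: "(\<lambda>x. emeasure m (b (f x) e \<inter> A)) \<in> borel_measurable borel" if A: "A \<in> sets borel" for A
  proof -
    have "{(x, y). y \<in> b (f x) e} \<in> sets (borel \<Otimes>\<^sub>M borel)"
      unfolding borel_prod using open_noise_relation by (rule borel_open)
    moreover have "UNIV \<times> A \<in> sets (borel \<Otimes>\<^sub>M borel)"
      by (rule pair_measureI) (use A in auto)
    ultimately have "{(x, y). y \<in> b (f x) e} \<inter> UNIV \<times> A \<in> sets (borel \<Otimes>\<^sub>M m)"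
      unfolding sets_pair_measure_cong[OF refl sets_m] by (rule sets.Int)
    then have "(\<lambda>x. emeasure m (Pair x -` ({(x, y). y \<in> b (f x) e} \<inter> UNIV \<times> A))) \<in> borel_measurable borel"
      by (rule measurable_emeasure_Pair)
    moreover have "Pair x -` ({(x, y). y \<in> b (f x) e} \<inter> UNIV \<times> A) = b (f x) e \<inter> A" for x by auto
    ultimately show ?thesis by simp
  qed
  fix A :: "'a set" assume A: "A \<in> sets borel"
  have "(\<lambda>x. emeasure m (b (f x) e \<inter> A) / emeasure m (b (f x) e)) \<in> borel_measurable borel"
    using meas[OF A] meas[of UNIV] by simp
  then show "(\<lambda>x. emeasure (noise e x) A) \<in> borel_measurable borel"
    unfolding noise_kernel_def using A by (simp add: emeasure_uniform_measure[OF ball_sets] sets_m)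
qed

text \<open>The dual operator is the Giry bind with the noise kernel; measurability of the kernel comes from
Fubini's theorem for the open relation \<open>y \<in> b (f x) e\<close>.\<close>

lemma
  assumes e: "0 < e" and \<mu>: "\<mu> \<in> prob_measures"
  shows dual_prob: "dual e \<mu> \<in> prob_measures"
    and integral_dual: "\<And>\<phi>. continuous_on UNIV \<phi> \<Longrightarrow> (\<integral>x. \<phi> x \<partial>dual e \<mu>) = (\<integral>x. T e \<phi> x \<partial>\<mu>)"
    and integrable_transfer: "\<And>\<phi>. continuous_on UNIV \<phi> \<Longrightarrow> integrable \<mu> (T e \<phi>)"
proof -
  note P = prob_measuresD[OF \<mu>]
  have meas: "noise e \<in> measurable \<mu> (subprob_algebra borel)"
    using noise_measurable[OF e] P(2) by (simp cong: measurable_cong_sets)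
  note B = bind_prob_measures[OF P(1) meas noise_prob[OF e]]
  note I = integral_bind_continuous[OF compact_UNIV P(1) meas noise_prob[OF e]]
  have ex: "\<mu> \<bind> noise e \<in> prob_measures \<and>
      (\<forall>\<phi>. continuous_on UNIV \<phi> \<longrightarrow> (\<integral>x. \<phi> x \<partial>(\<mu> \<bind> noise e)) = (\<integral>x. T e \<phi> x \<partial>\<mu>))"
    using B I(1) unfolding transfer_def by iprover
  have eq: "dual e \<mu> = \<mu> \<bind> noise e"
    unfolding dual_transfer_def
  proof (rule the_equality)
    show "\<mu> \<bind> noise e \<in> prob_measures \<and>
      (\<forall>\<phi>. continuous_on UNIV \<phi> \<longrightarrow> (\<integral>x. \<phi> x \<partial>(\<mu> \<bind> noise e)) = (\<integral>x. T e \<phi> x \<partial>\<mu>))" by (rule ex)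
    fix \<nu> assume \<nu>: "\<nu> \<in> prob_measures \<and> (\<forall>\<phi>. continuous_on UNIV \<phi> \<longrightarrow> (\<integral>x. \<phi> x \<partial>\<nu>) = (\<integral>x. T e \<phi> x \<partial>\<mu>))"
    show "\<nu> = \<mu> \<bind> noise e"
    proof (rule measure_eqI_continuous[OF _ B])
      show "\<nu> \<in> prob_measures" using \<nu> by (rule conjunct1)
      fix \<phi> :: "'a \<Rightarrow> complex" assume \<phi>: "continuous_on UNIV \<phi>"
      have "(\<integral>x. \<phi> x \<partial>\<nu>) = (\<integral>x. T e \<phi> x \<partial>\<mu>)" using \<nu> \<phi> by iprover
      also have "\<dots> = (\<integral>x. \<phi> x \<partial>(\<mu> \<bind> noise e))" using ex \<phi> by simp
      finally show "(\<integral>x. \<phi> x \<partial>\<nu>) = (\<integral>x. \<phi> x \<partial>(\<mu> \<bind> noise e))" .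
    qed
  qed
  show "dual e \<mu> \<in> prob_measures" unfolding eq by (rule B)
  show "(\<integral>x. \<phi> x \<partial>dual e \<mu>) = (\<integral>x. T e \<phi> x \<partial>\<mu>)" if "continuous_on UNIV \<phi>" for \<phi>
    unfolding eq using ex that by simp
  show "integrable \<mu> (T e \<phi>)" if "continuous_on UNIV \<phi>" for \<phi>
    using I(2)[OF that] by (simp add: transfer_def[abs_def])
qed

lemma dual_iterate_prob: "0 < e \<Longrightarrow> (dual e ^^ j) (return borel x) \<in> prob_measures"
  by (induction j) (simp_all add: return_prob_measures dual_prob)

text \<open>Around every point, one radius works for all centres in a neighbourhood; finitely many of these
neighbourhoods cover the space.\<close>

lemma uniform_oscillation:
  fixes \<phi> :: "'a \<Rightarrow> complex"
  assumes \<phi>: "continuous_on UNIV \<phi>" and \<eta>: "0 < \<eta>"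
  shows "\<forall>\<^sub>F e in at_right 0. \<forall>x. \<forall>y\<in>b x e. norm (\<phi> y - \<phi> x) \<le> \<eta>"
proof -
  define \<V> where "\<V> = {V. open V \<and> (\<forall>\<^sub>F e in at_right 0. \<forall>x\<in>V. \<forall>y\<in>b x e. norm (\<phi> y - \<phi> x) \<le> \<eta>)}"
  have "\<exists>V\<in>\<V>. x \<in> V" for x
  proof -
    let ?U = "{y. dist (\<phi> y) (\<phi> x) < \<eta> / 2}"
    have U: "open ?U" by (intro open_Collect_less continuous_intros continuous_on_dist \<phi>)
    moreover have "x \<in> ?U" using \<eta> by simp
    ultimately have "\<exists>V e. open V \<and> x \<in> V \<and> 0 < e \<and> (\<forall>y\<in>V. b y e \<subseteq> ?U)"
      by (rule ball_small)
    then obtain V e where V: "open V" "x \<in> V" "0 < e" "\<forall>y\<in>V. b y e \<subseteq> ?U"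
      by (elim exE conjE)
    have "\<forall>\<^sub>F e' in at_right 0. e' \<in> {0<..<e}" using V(3) by (rule eventually_at_right_real)
    then have "\<forall>\<^sub>F e' in at_right 0. \<forall>y\<in>V \<inter> ?U. \<forall>z\<in>b y e'. norm (\<phi> z - \<phi> y) \<le> \<eta>"
    proof (rule eventually_mono, intro ballI)
      fix e' y z assume e': "e' \<in> {0<..<e}" and y: "y \<in> V \<inter> ?U" and z: "z \<in> b y e'"
      have "z \<in> ?U" using bspec[OF V(4), of y] ball_mono[of e' e y] e' y z by auto
      then have "dist (\<phi> z) (\<phi> x) < \<eta> / 2" by simp
      moreover have "dist (\<phi> y) (\<phi> x) < \<eta> / 2" using y by simp
      ultimately have "dist (\<phi> z) (\<phi> y) < \<eta>" by (rule dist_triangle_half_l)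
      then show "norm (\<phi> z - \<phi> y) \<le> \<eta>" by (simp add: dist_norm)
    qed
    then have "V \<inter> ?U \<in> \<V>" using V(1) U by (simp add: \<V>_def open_Int)
    moreover have "x \<in> V \<inter> ?U" using V(2) \<eta> by simp
    ultimately show ?thesis by (rule bexI[rotated])
  qed
  then have "UNIV \<subseteq> \<Union>\<V>" by blast
  then obtain F where F: "F \<subseteq> \<V>" "finite F" "UNIV \<subseteq> \<Union>F"
    by (rule compactE[OF compact_UNIV]) (simp add: \<V>_def)
  have "\<forall>\<^sub>F e in at_right 0. \<forall>V\<in>F. \<forall>x\<in>V. \<forall>y\<in>b x e. norm (\<phi> y - \<phi> x) \<le> \<eta>"
    by (rule eventually_ball_finite[OF F(2)]) (use F(1) in \<open>auto simp: \<V>_def\<close>)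
  then show ?thesis
    by (rule eventually_mono) (use F(3) in blast)
qed

lemma transfer_uniform:
  fixes \<phi> :: "'a \<Rightarrow> complex"
  assumes \<phi>: "continuous_on UNIV \<phi>" and \<eta>: "0 < \<eta>"
  shows "\<forall>\<^sub>F e in at_right 0. \<forall>x. norm (T e \<phi> x - \<phi> (f x)) \<le> \<eta>"
  using uniform_oscillation[OF \<phi> \<eta>] eventually_at_right_less[of 0]
proof eventually_elim
  case (elim e)
  show ?case
  proof
    fix x
    interpret N: prob_space "noise e x" by (rule prob_measuresD(1)[OF noise_prob[OF elim(2)]])
    have int: "integrable (noise e x) \<phi>"
      by (rule integrable_continuous_prob[OF compact_UNIV \<phi> noise_prob[OF elim(2)]])
    have "T e \<phi> x - \<phi> (f x) = (\<integral>y. \<phi> y - \<phi> (f x) \<partial>noise e x)"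
      by (simp add: transfer_def int N.prob_space)
    also have "norm \<dots> \<le> (\<integral>y. norm (\<phi> y - \<phi> (f x)) \<partial>noise e x)"
      by (rule integral_norm_bound)
    also have "\<dots> \<le> (\<integral>y. \<eta> \<partial>noise e x)"
    proof (rule integral_mono_AE)
      show "AE y in noise e x. norm (\<phi> y - \<phi> (f x)) \<le> \<eta>"
        unfolding noise_kernel_def by (rule AE_uniform_measureI[OF ball_sets]) (use elim(1) in simp)
    qed (simp_all add: int)
    finally show "norm (T e \<phi> x - \<phi> (f x)) \<le> \<eta>" by (simp add: N.prob_space)
  qed
qed

text \<open>In the step from \<open>j\<close> to \<open>Suc j\<close>, replacing \<open>T e \<phi>\<close> by \<open>\<phi> \<circ> f\<close> under the integral costs \<open>\<eta> / 2\<close>, whatever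
the measure is, and the induction hypothesis for \<open>\<phi> \<circ> f\<close> costs another \<open>\<eta> / 2\<close>.\<close>

lemma dual_iterate_uniform:
  fixes \<phi> :: "'a \<Rightarrow> complex"
  assumes \<phi>: "continuous_on UNIV \<phi>" and \<eta>: "0 < \<eta>"
  shows "\<forall>\<^sub>F e in at_right 0. \<forall>x. norm ((\<integral>y. \<phi> y \<partial>(dual e ^^ j) (return borel x)) - \<phi> ((f ^^ j) x)) \<le> \<eta>"
  using \<phi> \<eta>
proof (induction j arbitrary: \<phi> \<eta>)
  case 0
  have "(\<integral>y. \<phi> y \<partial>return borel x) = \<phi> x" for x
    by (rule integral_return) (use borel_measurable_continuous_onI[OF 0(1)] in simp_all)
  then show ?case using 0(2) by simp
next
  case (Suc j)
  have \<phi>f: "continuous_on UNIV (\<lambda>x. \<phi> (f x))"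
    by (rule continuous_on_compose2[OF Suc.prems(1) continuous_map]) simp
  have h: "0 < \<eta> / 2" using Suc.prems(2) by simp
  show ?case
    using transfer_uniform[OF Suc.prems(1) h] Suc.IH[OF \<phi>f h] eventually_at_right_less[of 0]
  proof eventually_elim
    case (elim e)
    show ?case
    proof
      fix x
      let ?\<nu> = "(dual e ^^ j) (return borel x)"
      have \<nu>: "?\<nu> \<in> prob_measures" by (rule dual_iterate_prob[OF elim(3)])
      interpret N: prob_space ?\<nu> by (rule prob_measuresD(1)[OF \<nu>])
      have int: "integrable ?\<nu> (T e \<phi>)" "integrable ?\<nu> (\<lambda>x. \<phi> (f x))"
        by (rule integrable_transfer[OF elim(3) \<nu> Suc.prems(1)])
           (rule integrable_continuous_prob[OF compact_UNIV \<phi>f \<nu>])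
      have "norm ((\<integral>y. T e \<phi> y \<partial>?\<nu>) - (\<integral>y. \<phi> (f y) \<partial>?\<nu>)) = norm (\<integral>y. T e \<phi> y - \<phi> (f y) \<partial>?\<nu>)"
        by (simp add: int)
      also have "\<dots> \<le> (\<integral>y. norm (T e \<phi> y - \<phi> (f y)) \<partial>?\<nu>)" by (rule integral_norm_bound)
      also have "\<dots> \<le> (\<integral>y. \<eta> / 2 \<partial>?\<nu>)"
        by (rule integral_mono) (use elim(1) int in simp_all)
      finally have 1: "norm ((\<integral>y. T e \<phi> y \<partial>?\<nu>) - (\<integral>y. \<phi> (f y) \<partial>?\<nu>)) \<le> \<eta> / 2"
        by (simp add: N.prob_space)
      have 2: "norm ((\<integral>y. \<phi> (f y) \<partial>?\<nu>) - \<phi> (f ((f ^^ j) x))) \<le> \<eta> / 2"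
        using elim(2) by iprover
      have "norm ((\<integral>y. T e \<phi> y \<partial>?\<nu>) - \<phi> (f ((f ^^ j) x))) \<le> \<eta> / 2 + \<eta> / 2"
        using norm_add_rule_thm[OF 1 2] by simp
      then show "norm ((\<integral>y. \<phi> y \<partial>(dual e ^^ Suc j) (return borel x)) - \<phi> ((f ^^ Suc j) x)) \<le> \<eta>"
        by (simp add: integral_dual[OF elim(3) \<nu> Suc.prems(1)])
    qed
  qed
qed

abbreviation emp :: "nat \<Rightarrow> 'a \<Rightarrow> 'a measure" where "emp \<equiv> empiric f"
abbreviation noisy_emp :: "real \<Rightarrow> nat \<Rightarrow> 'a \<Rightarrow> 'a measure" where "noisy_emp \<equiv> empiric_stochastic b m f"

lemma emp_prob: "1 \<le> n \<Longrightarrow> emp n x \<in> prob_measures"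
  unfolding empiric_def by (rule average_measure_prob[OF _ return_prob_measures])

lemma integral_emp:
  fixes \<phi> :: "'a \<Rightarrow> complex"
  assumes "1 \<le> n" "continuous_on UNIV \<phi>"
  shows "(\<integral>y. \<phi> y \<partial>emp n x) = (\<Sum>j=1..n. \<phi> ((f ^^ j) x)) / of_nat n"
proof -
  have "(\<integral>y. \<phi> y \<partial>return borel z) = \<phi> z" for z
    by (rule integral_return) (use borel_measurable_continuous_onI[OF assms(2)] in simp_all)
  then show ?thesis
    unfolding empiric_def integral_average_measure[OF assms(1) return_prob_measures compact_UNIV assms(2)] by simp
qed

lemma noisy_emp_prob: "1 \<le> n \<Longrightarrow> 0 < e \<Longrightarrow> noisy_emp e n x \<in> prob_measures"
  unfolding empiric_stochastic_def by (rule average_measure_prob[OF _ dual_iterate_prob])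

lemma noisy_emp_integral_uniform:
  fixes \<phi> :: "'a \<Rightarrow> complex"
  assumes n: "1 \<le> n" and \<phi>: "continuous_on UNIV \<phi>" and \<eta>: "0 < \<eta>"
  shows "\<forall>\<^sub>F e in at_right 0. \<forall>x. norm ((\<integral>y. \<phi> y \<partial>noisy_emp e n x) - (\<integral>y. \<phi> y \<partial>emp n x)) \<le> \<eta>"
proof -
  have "\<forall>\<^sub>F e in at_right 0. \<forall>j\<in>{1..n}. \<forall>x.
      norm ((\<integral>y. \<phi> y \<partial>(dual e ^^ j) (return borel x)) - \<phi> ((f ^^ j) x)) \<le> \<eta>"
    by (rule eventually_ball_finite) (use dual_iterate_uniform[OF \<phi> \<eta>] in auto)
  then show ?thesis using eventually_at_right_less[of 0]
  proof eventually_elim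
    case (elim e)
    show ?case
    proof
      fix x
      let ?a = "\<lambda>j. \<integral>y. \<phi> y \<partial>(dual e ^^ j) (return borel x)" and ?c = "\<lambda>j. \<phi> ((f ^^ j) x)"
      have "(\<integral>y. \<phi> y \<partial>noisy_emp e n x) - (\<integral>y. \<phi> y \<partial>emp n x) = (\<Sum>j=1..n. ?a j - ?c j) / of_nat n"
        unfolding integral_emp[OF n \<phi>] empiric_stochastic_def
          integral_average_measure[OF n dual_iterate_prob[OF elim(2)] compact_UNIV \<phi>]
        by (simp add: sum_subtractf diff_divide_distrib)
      moreover have "norm (\<Sum>j=1..n. ?a j - ?c j) \<le> (\<Sum>j=1..n. \<eta>)"
        by (rule sum_norm_le) (use elim(1) in blast)
      ultimately show "norm ((\<integral>y. \<phi> y \<partial>noisy_emp e n x) - (\<integral>y. \<phi> y \<partial>emp n x)) \<le> \<eta>"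
        using n by (simp add: norm_divide divide_le_eq mult.commute)
    qed
  qed
qed

text \<open>For each test function the integrals converge uniformly in \<open>x\<close>. Along a sequence of noise levels
and starting points that violates the claim, \<open>dist_tendsto_0I\<close> converts this into convergence of the
distances.\<close>

lemma noisy_emp_uniform:
  assumes n: "1 \<le> n" and \<rho>: "0 < \<rho>"
  obtains e0 where "0 < e0" "\<And>e x. 0 < e \<Longrightarrow> e \<le> e0 \<Longrightarrow> d (noisy_emp e n x) (emp n x) < \<rho>"
proof -
  have "\<exists>e0>0. \<forall>e x. 0 < e \<longrightarrow> e \<le> e0 \<longrightarrow> d (noisy_emp e n x) (emp n x) < \<rho>"
  proof (rule ccontr)
    assume no: "\<not> ?thesis"
    have "\<exists>z. 0 < fst z \<and> fst z \<le> inverse (real (Suc k)) \<and> \<rho> \<le> d (noisy_emp (fst z) n (snd z)) (emp n (snd z))" for k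
    proof -
      have "0 < inverse (real (Suc k))" by simp
      with no obtain e x where "0 < e" "e \<le> inverse (real (Suc k))" "\<not> d (noisy_emp e n x) (emp n x) < \<rho>"
        by blast
      then show ?thesis by (intro exI[of _ "(e, x)"]) simp
    qed
    then obtain z where z: "\<And>k. 0 < fst (z k)" "\<And>k. fst (z k) \<le> inverse (real (Suc k))"
      "\<And>k. \<rho> \<le> d (noisy_emp (fst (z k)) n (snd (z k))) (emp n (snd (z k)))"
      by metis
    have "(\<lambda>k. fst (z k)) \<longlonglongrightarrow> 0"
      by (rule tendsto_sandwich[OF _ _ tendsto_const LIMSEQ_inverse_real_of_nat])
         (use z(2) less_imp_le[OF z(1)] in simp_all)
    then have lim: "filterlim (\<lambda>k. fst (z k)) (at_right 0) sequentially"
      unfolding filterlim_at using z(1) by (simp add: less_imp_neq[symmetric])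
    have "(\<lambda>k. d (noisy_emp (fst (z k)) n (snd (z k))) (emp n (snd (z k)))) \<longlonglongrightarrow> 0"
    proof (rule dist_tendsto_0I[OF noisy_emp_prob[OF n z(1)] emp_prob[OF n]])
      fix \<phi> :: "'a \<Rightarrow> complex" assume \<phi>: "continuous_on UNIV \<phi>"
      show "(\<lambda>k. (\<integral>x. \<phi> x \<partial>noisy_emp (fst (z k)) n (snd (z k))) - (\<integral>x. \<phi> x \<partial>emp n (snd (z k)))) \<longlonglongrightarrow> 0"
        unfolding tendsto_iff
      proof (intro allI impI)
        fix r :: real assume "0 < r"
        then have h: "0 < r / 2" by simp
        from filterlim_iff[THEN iffD1, OF lim, rule_format, OF noisy_emp_integral_uniform[OF n \<phi> h]]
        show "\<forall>\<^sub>F k in sequentially. dist ((\<integral>x. \<phi> x \<partial>noisy_emp (fst (z k)) n (snd (z k))) - (\<integral>x. \<phi> x \<partial>emp n (snd (z k)))) 0 < r"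
        proof (rule eventually_mono)
          fix k assume "\<forall>x. norm ((\<integral>y. \<phi> y \<partial>noisy_emp (fst (z k)) n x) - (\<integral>y. \<phi> y \<partial>emp n x)) \<le> r / 2"
          then have "norm ((\<integral>y. \<phi> y \<partial>noisy_emp (fst (z k)) n (snd (z k))) - (\<integral>y. \<phi> y \<partial>emp n (snd (z k)))) \<le> r / 2"
            by (rule spec)
          then show "dist ((\<integral>x. \<phi> x \<partial>noisy_emp (fst (z k)) n (snd (z k))) - (\<integral>x. \<phi> x \<partial>emp n (snd (z k)))) 0 < r"
            using \<open>0 < r\<close> by (simp add: dist_norm)
        qed
      qed
    qed
    then have "\<rho> \<le> 0" by (rule LIMSEQ_le_const) (use z(3) in blast)
    with \<rho> show False by simp
  qed
  then show ?thesis using that by blast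
qed

section \<open>Limit measures of orbits\<close>

lemma continuous_emp:
  assumes n: "1 \<le> n"
  shows "continuous_map euclidean mtopology (emp n)"
  unfolding mtopology_eq weak_star_topology_def
proof (rule continuous_on_generated_topo)
  fix U assume "U \<in> {{\<mu>\<in>prob_measures. (\<integral>x. \<phi> x \<partial>\<mu>) \<in> V} |\<phi> V.
        continuous_on UNIV (\<phi> :: 'a \<Rightarrow> complex) \<and> open V}"
  then obtain \<phi> :: "'a \<Rightarrow> complex" and V where U: "U = {\<mu>\<in>prob_measures. (\<integral>x. \<phi> x \<partial>\<mu>) \<in> V}"
    and \<phi>: "continuous_on UNIV \<phi>" and V: "open V" by blast
  have "emp n -` U = (\<lambda>x. (\<Sum>j=1..n. \<phi> ((f ^^ j) x)) / of_nat n) -` V"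
    unfolding U by (auto simp: integral_emp[OF n \<phi>] emp_prob[OF n])
  moreover have "open ((\<lambda>x. (\<Sum>j=1..n. \<phi> ((f ^^ j) x)) / of_nat n) -` V)"
  proof (rule open_vimage[OF V])
    have "continuous_on UNIV (\<lambda>x. \<phi> ((f ^^ j) x))" for j
      by (rule continuous_on_compose2[OF \<phi> iterate_continuous]) simp
    then show "continuous_on UNIV (\<lambda>x. (\<Sum>j=1..n. \<phi> ((f ^^ j) x)) / of_nat n)"
      using n by (intro continuous_intros) simp_all
  qed
  ultimately show "openin euclidean (emp n -` U \<inter> topspace euclidean)" by simp
next
  show "emp n ` topspace euclidean \<subseteq> \<Union>{{\<mu>\<in>prob_measures. (\<integral>x. \<phi> x \<partial>\<mu>) \<in> V} |\<phi> V.
        continuous_on UNIV (\<phi> :: 'a \<Rightarrow> complex) \<and> open V}"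
    unfolding topspace_weak_star[unfolded weak_star_topology_def topology_generated_by_topspace]
    using emp_prob[OF n] by blast
qed

lemma open_emp_near:
  assumes "1 \<le> n" "\<nu> \<in> prob_measures"
  shows "open {x. d (emp n x) \<nu> < \<rho>}"
proof -
  have "openin euclidean {x \<in> topspace euclidean. emp n x \<in> mball \<nu> \<rho>}"
    by (rule openin_continuous_map_preimage[OF continuous_emp[OF assms(1)] openin_mball])
  moreover have "{x \<in> topspace euclidean. emp n x \<in> mball \<nu> \<rho>} = {x. d (emp n x) \<nu> < \<rho>}"
    using assms(2) emp_prob[OF assms(1)] by (auto simp: commute)
  ultimately show ?thesis by simp
qed

lemma set_distance_less:
  assumes "A \<noteq> {}" "B \<noteq> {}"
  shows "set_distance d A B < \<rho> \<longleftrightarrow> (\<exists>a\<in>A. \<exists>c\<in>B. d a c < \<rho>)"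
proof -
  have "{d a c |a c. a \<in> A \<and> c \<in> B} \<noteq> {}" using assms by blast
  moreover have "bdd_below {d a c |a c. a \<in> A \<and> c \<in> B}"
    by (rule bdd_belowI[of _ 0]) (auto simp: nonneg)
  ultimately show ?thesis
    unfolding set_distance_def by (subst cInf_less_iff) auto
qed

lemma p_omega_iff:
  "\<mu> \<in> p_omega f x \<longleftrightarrow> \<mu> \<in> prob_measures \<and> (\<exists>r. strict_mono r \<and> (\<lambda>i. d (emp (r i) x) \<mu>) \<longlonglongrightarrow> 0)"
proof -
  have "\<forall>\<^sub>F i in sequentially. emp (r i) x \<in> prob_measures" if "strict_mono r" for r :: "nat \<Rightarrow> nat"
    using eventually_ge_at_top[of 1]
  proof eventually_elim
    case (elim i)
    then have "1 \<le> r i" using strict_mono_imp_increasing[OF that, of i] by linarith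
    then show ?case by (rule emp_prob)
  qed
  then show ?thesis unfolding p_omega_def weak_star_limit_iff by blast
qed

lemma p_omega_prob: "\<mu> \<in> p_omega f x \<Longrightarrow> \<mu> \<in> prob_measures"
  by (simp add: p_omega_iff)

lemma frequently_imp_limit_point:
  assumes "\<exists>\<^sub>F n in sequentially. P n"
  obtains r \<mu> where "strict_mono (r :: nat \<Rightarrow> nat)" "\<And>i. P (r i)" "\<mu> \<in> p_omega f x" "(\<lambda>i. d (emp (r i) x) \<mu>) \<longlonglongrightarrow> 0"
proof -
  have "\<exists>\<^sub>F n in sequentially. P n \<and> 1 \<le> n"
    using frequently_eventually_frequently[OF assms eventually_ge_at_top[of 1]] .
  then have "infinite {n. P n \<and> 1 \<le> n}"
    by (simp add: frequently_cofinite cofinite_eq_sequentially[symmetric])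
  from infinite_enumerate[OF this] obtain q :: "nat \<Rightarrow> nat"
    where q: "strict_mono q" "\<forall>n. q n \<in> {n. P n \<and> 1 \<le> n}" by (elim exE conjE)
  have q1: "1 \<le> q i" "P (q i)" for i using q(2) by auto
  obtain \<mu> r where r: "strict_mono (r :: nat \<Rightarrow> nat)" and \<mu>: "\<mu> \<in> prob_measures"
    and lim: "(\<lambda>n. d (emp (q (r n)) x) \<mu>) \<longlonglongrightarrow> 0"
    by (rule convergent_subsequence[of "\<lambda>n. emp (q n) x", OF emp_prob[OF q1(1)]])
  have s: "strict_mono (\<lambda>i. q (r i))" using strict_mono_o[OF q(1) r] by (simp add: o_def)
  with \<mu> lim have "\<mu> \<in> p_omega f x" unfolding p_omega_iff by blast
  with s lim show ?thesis using q1(2) by (intro that[of "\<lambda>i. q (r i)" \<mu>])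
qed

lemma p_omega_nonempty: "p_omega f x \<noteq> {}"
proof -
  have "\<exists>\<^sub>F n::nat in sequentially. True" by simp
  then obtain r \<mu> where "\<mu> \<in> p_omega f x" by (rule frequently_imp_limit_point)
  then show ?thesis by blast
qed

text \<open>Invariance is expressed through integrals, in which form it passes to weak* limits.\<close>

lemma invariant_iff:
  "\<mu> \<in> invariant_measures f \<longleftrightarrow> \<mu> \<in> prob_measures \<and>
    (\<forall>\<phi> :: 'a \<Rightarrow> complex. continuous_on UNIV \<phi> \<longrightarrow> (\<integral>x. \<phi> (f x) \<partial>\<mu>) = (\<integral>x. \<phi> x \<partial>\<mu>))"
proof (cases "\<mu> \<in> prob_measures")
  case True
  note P = prob_measuresD[OF True]
  have f: "f \<in> measurable \<mu> borel"
    using borel_measurable_continuous_onI[OF continuous_map] P(2) by (simp cong: measurable_cong_sets)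
  have D: "distr \<mu> borel f \<in> prob_measures"
    using prob_space.prob_space_distr[OF P(1) f] by (simp add: prob_measures_def)
  have I: "(\<integral>x. \<phi> x \<partial>distr \<mu> borel f) = (\<integral>x. \<phi> (f x) \<partial>\<mu>)" if "continuous_on UNIV \<phi>" for \<phi> :: "'a \<Rightarrow> complex"
    by (rule integral_distr[OF f borel_measurable_continuous_onI[OF that]])
  show ?thesis
  proof
    assume "\<mu> \<in> invariant_measures f"
    then have e: "distr \<mu> borel f = \<mu>" by (simp add: invariant_measures_def)
    show "\<mu> \<in> prob_measures \<and> (\<forall>\<phi> :: 'a \<Rightarrow> complex. continuous_on UNIV \<phi> \<longrightarrow> (\<integral>x. \<phi> (f x) \<partial>\<mu>) = (\<integral>x. \<phi> x \<partial>\<mu>))"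
      using I unfolding e using True by simp
  next
    assume R: "\<mu> \<in> prob_measures \<and> (\<forall>\<phi> :: 'a \<Rightarrow> complex. continuous_on UNIV \<phi> \<longrightarrow> (\<integral>x. \<phi> (f x) \<partial>\<mu>) = (\<integral>x. \<phi> x \<partial>\<mu>))"
    have "distr \<mu> borel f = \<mu>"
    proof (rule measure_eqI_continuous[OF D True])
      fix \<phi> :: "'a \<Rightarrow> complex" assume "continuous_on UNIV \<phi>"
      then show "(\<integral>x. \<phi> x \<partial>distr \<mu> borel f) = (\<integral>x. \<phi> x \<partial>\<mu>)" using R I by simp
    qed
    then show "\<mu> \<in> invariant_measures f" using True by (simp add: invariant_measures_def)
  qed
qed (simp add: invariant_measures_def)

lemma invariant_limit:
  assumes "\<And>n. \<mu> n \<in> prob_measures" "\<mu>' \<in> prob_measures" "(\<lambda>n::nat. d (\<mu> n) \<mu>') \<longlonglongrightarrow> 0"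
    and "\<And>\<phi> :: 'a \<Rightarrow> complex. continuous_on UNIV \<phi> \<Longrightarrow> (\<lambda>n. (\<integral>x. \<phi> (f x) \<partial>\<mu> n) - (\<integral>x. \<phi> x \<partial>\<mu> n)) \<longlonglongrightarrow> 0"
  shows "\<mu>' \<in> invariant_measures f"
  unfolding invariant_iff
proof (intro conjI assms(2) allI impI)
  fix \<phi> :: "'a \<Rightarrow> complex" assume \<phi>: "continuous_on UNIV \<phi>"
  have "limitin weak_star_topology \<mu> \<mu>' sequentially"
    unfolding weak_star_limit_iff using assms(1-3) by simp
  then have lim: "(\<lambda>n. \<integral>x. \<psi> x \<partial>\<mu> n) \<longlonglongrightarrow> (\<integral>x. \<psi> x \<partial>\<mu>')" if "continuous_on UNIV \<psi>" for \<psi> :: "'a \<Rightarrow> complex"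
    unfolding limitin_weak_star using that by iprover
  have \<phi>f: "continuous_on UNIV (\<lambda>x. \<phi> (f x))"
    by (rule continuous_on_compose2[OF \<phi> continuous_map]) simp
  have "(\<integral>x. \<phi> (f x) \<partial>\<mu>') - (\<integral>x. \<phi> x \<partial>\<mu>') = 0"
    by (rule LIMSEQ_unique[OF tendsto_diff[OF lim[OF \<phi>f] lim[OF \<phi>]] assms(4)[OF \<phi>]])
  then show "(\<integral>x. \<phi> (f x) \<partial>\<mu>') = (\<integral>x. \<phi> x \<partial>\<mu>')" by simp
qed

text \<open>The integrals of \<open>\<phi> \<circ> f\<close> and of \<open>\<phi>\<close> against an empiric measure of length \<open>n\<close> differ by the telescoping sum
\<open>(\<phi> (f^(n+1) x) - \<phi> (f x)) / n\<close>, which tends to \<open>0\<close>.\<close>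

lemma p_omega_invariant: "p_omega f x \<subseteq> invariant_measures f"
proof
  fix \<mu> assume "\<mu> \<in> p_omega f x"
  then obtain r where \<mu>: "\<mu> \<in> prob_measures" and r: "strict_mono r" and lim: "(\<lambda>i. d (emp (r i) x) \<mu>) \<longlonglongrightarrow> 0"
    unfolding p_omega_iff by blast
  \<comment> \<open>a shift, because \<open>r 0\<close> may be \<open>0\<close> and the empiric measure of length \<open>0\<close> is not a probability measure\<close>
  define s where "s i = r (Suc i)" for i
  have s1: "Suc i \<le> s i" for i unfolding s_def by (rule strict_mono_imp_increasing[OF r])
  then have s: "1 \<le> s i" for i by (rule order_trans[rotated]) simp
  show "\<mu> \<in> invariant_measures f"
  proof (rule invariant_limit[of "\<lambda>i. emp (s i) x", OF emp_prob[OF s] \<mu>])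
    show "(\<lambda>i. d (emp (s i) x) \<mu>) \<longlonglongrightarrow> 0" unfolding s_def by (rule LIMSEQ_Suc[OF lim])
    fix \<phi> :: "'a \<Rightarrow> complex" assume \<phi>: "continuous_on UNIV \<phi>"
    have \<phi>f: "continuous_on UNIV (\<lambda>x. \<phi> (f x))"
      by (rule continuous_on_compose2[OF \<phi> continuous_map]) simp
    obtain B where B: "\<And>x. norm (\<phi> x) \<le> B"
      by (rule continuous_bounded_on_compact_space[OF compact_UNIV \<phi>]) iprover
    have tele: "(\<Sum>j=1..n. \<phi> (f ((f ^^ j) x))) - (\<Sum>j=1..n. \<phi> ((f ^^ j) x)) = \<phi> ((f ^^ Suc n) x) - \<phi> ((f ^^ 1) x)" for n
      by (induction n) (simp_all add: add_diff_add)
    have "norm ((\<integral>y. \<phi> (f y) \<partial>emp (s i) x) - (\<integral>y. \<phi> y \<partial>emp (s i) x)) \<le> 2 * B * inverse (real (Suc i))" for i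
    proof -
      have "(\<integral>y. \<phi> (f y) \<partial>emp (s i) x) - (\<integral>y. \<phi> y \<partial>emp (s i) x) = (\<phi> ((f ^^ Suc (s i)) x) - \<phi> ((f ^^ 1) x)) / of_nat (s i)"
        unfolding integral_emp[OF s \<phi>] integral_emp[OF s \<phi>f] diff_divide_distrib[symmetric] tele ..
      also have "norm \<dots> \<le> 2 * B / real (s i)"
        unfolding norm_divide norm_of_nat
        using norm_triangle_ineq4[of "\<phi> ((f ^^ Suc (s i)) x)" "\<phi> ((f ^^ 1) x)"] B[of "(f ^^ Suc (s i)) x"] B[of "(f ^^ 1) x"]
        by (intro divide_right_mono) linarith+
      also have "\<dots> \<le> 2 * B / real (Suc i)"
      proof (rule divide_left_mono)
        show "real (Suc i) \<le> real (s i)" using s1[of i] by (rule of_nat_mono)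
        show "0 \<le> 2 * B" using B[of x] norm_ge_zero[of "\<phi> x"] by linarith
        show "0 < real (s i) * real (Suc i)" using s[of i] by simp
      qed
      finally show ?thesis by (simp only: divide_inverse)
    qed
    then show "(\<lambda>i. (\<integral>y. \<phi> (f y) \<partial>emp (s i) x) - (\<integral>y. \<phi> y \<partial>emp (s i) x)) \<longlonglongrightarrow> 0"
      by (intro Lim_null_comparison[OF always_eventually tendsto_mult_right_zero[OF LIMSEQ_inverse_real_of_nat]]) blast
  qed
qed

section \<open>The basin of stochastic stability is deterministic\<close>

text \<open>The noiseless counterpart of the basin of stochastic stability. The length \<open>n = 0\<close> is left out
because the empiric measure of length \<open>0\<close> is the zero measure.\<close>

definition eventually_near :: "'a measure set \<Rightarrow> 'a set" where
  "eventually_near K = {x. \<forall>\<rho>>0. \<exists>N. \<forall>n\<ge>N. 1 \<le> n \<longrightarrow> (\<exists>\<nu>\<in>K. d (emp n x) \<nu> < \<rho>)}"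

lemma compact_mem_of_near:
  assumes K: "compactin weak_star_topology K" and \<mu>: "\<mu> \<in> prob_measures"
    and near: "\<And>\<rho>. 0 < \<rho> \<Longrightarrow> \<exists>\<nu>\<in>K. d \<mu> \<nu> < \<rho>"
  shows "\<mu> \<in> K"
proof (rule ccontr)
  assume "\<mu> \<notin> K"
  have "closedin mtopology K"
    by (rule compactin_imp_closedin[OF Hausdorff_space_mtopology]) (simp add: mtopology_eq K)
  then obtain r where r: "0 < r" "disjnt K (mball \<mu> r)" and Kp: "K \<subseteq> prob_measures"
    using \<mu> \<open>\<mu> \<notin> K\<close> unfolding closedin_metric by blast
  obtain \<nu> where "\<nu> \<in> K" "d \<mu> \<nu> < r" using near[OF r(1)] by blast
  then show False using r(2) Kp \<mu> by (auto simp: disjnt_iff)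
qed

lemma compact_imp_prob: "compactin weak_star_topology K \<Longrightarrow> K \<subseteq> prob_measures"
  using compactin_subset_topspace topspace_weak_star by blast

text \<open>If the empiric measures were at distance at least \<open>\<rho>\<close> from \<open>K\<close> infinitely often, sequential compactness
would give a limit measure outside \<open>K\<close>.\<close>

lemma eventually_near_eq:
  assumes K: "compactin weak_star_topology K"
  shows "eventually_near K = {x. p_omega f x \<subseteq> K}"
proof (intro equalityI subsetI CollectI)
  fix x \<mu> assume x: "x \<in> eventually_near K" and \<mu>: "\<mu> \<in> p_omega f x"
  then obtain r where \<mu>p: "\<mu> \<in> prob_measures" and r: "strict_mono r" and lim: "(\<lambda>i. d (emp (r i) x) \<mu>) \<longlonglongrightarrow> 0"
    unfolding p_omega_iff by blast
  show "\<mu> \<in> K"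
  proof (rule compact_mem_of_near[OF K \<mu>p])
    fix \<rho> :: real assume "0 < \<rho>"
    then have h: "0 < \<rho> / 2" by simp
    obtain N where N: "\<And>n. N \<le> n \<Longrightarrow> 1 \<le> n \<Longrightarrow> \<exists>\<nu>\<in>K. d (emp n x) \<nu> < \<rho> / 2"
      using x h unfolding eventually_near_def by blast
    have "\<forall>\<^sub>F i in sequentially. d (emp (r i) x) \<mu> < \<rho> / 2 \<and> max N 1 \<le> i"
      using order_tendstoD(2)[OF lim h] eventually_ge_at_top by (rule eventually_conj)
    then obtain i where i: "d (emp (r i) x) \<mu> < \<rho> / 2" "max N 1 \<le> i"
      using eventually_happens'[OF sequentially_bot] by blast
    have ri: "N \<le> r i" "1 \<le> r i" using i(2) strict_mono_imp_increasing[OF r, of i] by auto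
    obtain \<nu> where \<nu>: "\<nu> \<in> K" "d (emp (r i) x) \<nu> < \<rho> / 2" using N[OF ri] by blast
    have "d \<mu> \<nu> \<le> d \<mu> (emp (r i) x) + d (emp (r i) x) \<nu>"
      by (rule triangle[OF \<mu>p emp_prob[OF ri(2)] subsetD[OF compact_imp_prob[OF K] \<nu>(1)]])
    then have "d \<mu> \<nu> < \<rho>" using i(1) \<nu>(2) commute[of \<mu> "emp (r i) x"] by linarith
    then show "\<exists>\<nu>\<in>K. d \<mu> \<nu> < \<rho>" using \<nu>(1) by blast
  qed
next
  fix x assume "x \<in> {x. p_omega f x \<subseteq> K}"
  then have sub: "p_omega f x \<subseteq> K" by simp
  show "x \<in> eventually_near K"
  proof (rule ccontr)
    assume "x \<notin> eventually_near K"
    then obtain \<rho> where \<rho>: "0 < \<rho>" and no: "\<And>N. \<exists>n\<ge>N. 1 \<le> n \<and> \<not> (\<exists>\<nu>\<in>K. d (emp n x) \<nu> < \<rho>)"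
      unfolding eventually_near_def by blast
    have "\<exists>\<^sub>F n in sequentially. \<not> (\<exists>\<nu>\<in>K. d (emp n x) \<nu> < \<rho>)"
      unfolding frequently_sequentially using no by blast
    then obtain r \<mu> where r: "\<And>i. \<not> (\<exists>\<nu>\<in>K. d (emp (r i) x) \<nu> < \<rho>)" and \<mu>: "\<mu> \<in> p_omega f x"
      and lim: "(\<lambda>i. d (emp (r i) x) \<mu>) \<longlonglongrightarrow> 0"
      by (rule frequently_imp_limit_point) iprover
    have "\<mu> \<in> K" using \<mu> sub by blast
    obtain i where "d (emp (r i) x) \<mu> < \<rho>"
      using eventually_happens'[OF sequentially_bot order_tendstoD(2)[OF lim \<rho>]] by blast
    with r[of i] \<open>\<mu> \<in> K\<close> show False by blast
  qed
qed

text \<open>Closeness to \<open>K\<close> passes from the noiseless to the noisy empiric measures and back, at the price of a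
factor \<open>2\<close>, with a noise level that depends on \<open>n\<close> and \<open>\<rho>\<close> only.\<close>

lemma near_uniform_transfer:
  assumes K: "K \<noteq> {}" "K \<subseteq> prob_measures" and n: "1 \<le> n" and \<rho>: "0 < \<rho>"
  obtains e0 where "0 < e0"
    "\<And>e x. 0 < e \<Longrightarrow> e \<le> e0 \<Longrightarrow> \<exists>\<nu>\<in>K. d (emp n x) \<nu> < \<rho> \<Longrightarrow> set_distance d {noisy_emp e n x} K < 2 * \<rho>"
    "\<And>e x. 0 < e \<Longrightarrow> e \<le> e0 \<Longrightarrow> set_distance d {noisy_emp e n x} K < \<rho> \<Longrightarrow> \<exists>\<nu>\<in>K. d (emp n x) \<nu> < 2 * \<rho>"
proof -
  obtain e0 where e0: "0 < e0" "\<And>e x. 0 < e \<Longrightarrow> e \<le> e0 \<Longrightarrow> d (noisy_emp e n x) (emp n x) < \<rho>"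
    by (rule noisy_emp_uniform[OF n \<rho>]) iprover
  have tri: "\<bar>d (noisy_emp e n x) \<nu> - d (emp n x) \<nu>\<bar> < \<rho>" if e: "0 < e" "e \<le> e0" and \<nu>: "\<nu> \<in> K" for e x \<nu>
  proof -
    have \<nu>p: "\<nu> \<in> prob_measures" using \<nu> K(2) by blast
    note t1 = triangle[OF noisy_emp_prob[OF n e(1)] emp_prob[OF n] \<nu>p, of x x]
    note t2 = triangle[OF emp_prob[OF n] noisy_emp_prob[OF n e(1)] \<nu>p, of x x]
    show ?thesis using t1 t2 e0(2)[OF e, of x] commute[of "emp n x" "noisy_emp e n x"] by linarith
  qed
  note sd = set_distance_less[of "{noisy_emp e n x}" K for e x, OF insert_not_empty K(1)]
  show ?thesis
  proof (rule that[OF e0(1)])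
    fix e x assume e: "0 < e" "e \<le> e0"
    show "set_distance d {noisy_emp e n x} K < 2 * \<rho>" if near: "\<exists>\<nu>\<in>K. d (emp n x) \<nu> < \<rho>"
    proof -
      obtain \<nu> where \<nu>: "\<nu> \<in> K" "d (emp n x) \<nu> < \<rho>" using near by blast
      then have "d (noisy_emp e n x) \<nu> < 2 * \<rho>" using tri[OF e \<nu>(1), of x] by linarith
      then show ?thesis unfolding sd using \<nu>(1) by blast
    qed
    show "\<exists>\<nu>\<in>K. d (emp n x) \<nu> < 2 * \<rho>" if near: "set_distance d {noisy_emp e n x} K < \<rho>"
    proof -
      obtain \<nu> where \<nu>: "\<nu> \<in> K" "d (noisy_emp e n x) \<nu> < \<rho>" using near unfolding sd by blast
      then have "d (emp n x) \<nu> < 2 * \<rho>" using tri[OF e \<nu>(1), of x] by linarith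
      then show ?thesis using \<nu>(1) by blast
    qed
  qed
qed

lemma stochastic_basin_eq_eventually_near:
  assumes K: "K \<noteq> {}" "K \<subseteq> prob_measures"
  shows "stochastic_basin d b m f K = eventually_near K"
proof (intro equalityI subsetI)
  fix x assume x: "x \<in> stochastic_basin d b m f K"
  show "x \<in> eventually_near K"
    unfolding eventually_near_def
  proof (intro CollectI allI impI)
    fix \<rho> :: real assume "0 < \<rho>"
    then have h: "0 < \<rho> / 2" by simp
    obtain N where N: "\<And>n. N \<le> n \<Longrightarrow> \<exists>e0>0. \<forall>e. 0 < e \<and> e \<le> e0 \<longrightarrow> set_distance d {noisy_emp e n x} K < \<rho> / 2"
      using x h unfolding stochastic_basin_def by blast
    have "\<exists>\<nu>\<in>K. d (emp n x) \<nu> < \<rho>" if n: "N \<le> n" "1 \<le> n" for n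
    proof -
      obtain e0 where e0: "0 < e0" "\<And>e. 0 < e \<Longrightarrow> e \<le> e0 \<Longrightarrow> set_distance d {noisy_emp e n x} K < \<rho> / 2"
        using N[OF n(1)] by blast
      obtain e1 where e1: "0 < e1"
        "\<And>e x. 0 < e \<Longrightarrow> e \<le> e1 \<Longrightarrow> set_distance d {noisy_emp e n x} K < \<rho> / 2 \<Longrightarrow> \<exists>\<nu>\<in>K. d (emp n x) \<nu> < 2 * (\<rho> / 2)"
        by (rule near_uniform_transfer[OF K n(2) h]) iprover
      have "\<exists>\<nu>\<in>K. d (emp n x) \<nu> < 2 * (\<rho> / 2)"
        by (rule e1(2)[of "min e0 e1"]) (use e0 e1(1) in auto)
      then show ?thesis by simp
    qed
    then show "\<exists>N. \<forall>n\<ge>N. 1 \<le> n \<longrightarrow> (\<exists>\<nu>\<in>K. d (emp n x) \<nu> < \<rho>)" by iprover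
  qed
next
  fix x assume x: "x \<in> eventually_near K"
  show "x \<in> stochastic_basin d b m f K"
    unfolding stochastic_basin_def
  proof (intro CollectI allI impI)
    fix \<rho> :: real assume "0 < \<rho>"
    then have h: "0 < \<rho> / 2" by simp
    obtain N where N: "\<And>n. N \<le> n \<Longrightarrow> 1 \<le> n \<Longrightarrow> \<exists>\<nu>\<in>K. d (emp n x) \<nu> < \<rho> / 2"
      using x h unfolding eventually_near_def by blast
    have "\<exists>e0>0. \<forall>e. 0 < e \<and> e \<le> e0 \<longrightarrow> set_distance d {noisy_emp e n x} K < \<rho>" if n: "max N 1 \<le> n" for n
    proof -
      have n': "N \<le> n" "1 \<le> n" using n by auto
      obtain e1 where e1: "0 < e1"
        "\<And>e x. 0 < e \<Longrightarrow> e \<le> e1 \<Longrightarrow> \<exists>\<nu>\<in>K. d (emp n x) \<nu> < \<rho> / 2 \<Longrightarrow> set_distance d {noisy_emp e n x} K < 2 * (\<rho> / 2)"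
        by (rule near_uniform_transfer[OF K n'(2) h]) iprover
      have "set_distance d {noisy_emp e n x} K < \<rho>" if "0 < e" "e \<le> e1" for e
        using e1(2)[OF that N[OF n']] by simp
      with e1(1) show ?thesis by blast
    qed
    then show "\<exists>N. \<forall>n\<ge>N. \<exists>e0>0. \<forall>e. 0 < e \<and> e \<le> e0 \<longrightarrow> set_distance d {noisy_emp e n x} K < \<rho>" by iprover
  qed
qed

lemma stochastic_basin_eq:
  assumes "K \<noteq> {}" "compactin weak_star_topology K"
  shows "stochastic_basin d b m f K = {x. p_omega f x \<subseteq> K}"
  using stochastic_basin_eq_eventually_near[OF assms(1) compact_imp_prob[OF assms(2)]] eventually_near_eq[OF assms(2)]
  by simp

section \<open>Measurability of the basins\<close>

lemma open_near_set:
  assumes "1 \<le> n" "K \<subseteq> prob_measures"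
  shows "open {x. \<exists>\<nu>\<in>K. d (emp n x) \<nu> < \<rho>}"
proof -
  have "{x. \<exists>\<nu>\<in>K. d (emp n x) \<nu> < \<rho>} = (\<Union>\<nu>\<in>K. {x. d (emp n x) \<nu> < \<rho>})" by blast
  also have "open \<dots>" using open_emp_near[OF assms(1)] assms(2) by blast
  finally show ?thesis .
qed

text \<open>The points that are not within \<open>1 / Suc k\<close> of \<open>K\<close> at some time from \<open>N\<close> on. With both parameters
natural numbers, the basin is obtained from these sets by countable operations.\<close>

definition far :: "'a measure set \<Rightarrow> nat \<Rightarrow> nat \<Rightarrow> 'a set" where
  "far K k N = (\<Union>n\<in>{max N 1..}. - {x. \<exists>\<nu>\<in>K. d (emp n x) \<nu> < inverse (real (Suc k))})"

lemma far_sets: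
  assumes K: "K \<subseteq> prob_measures"
  shows "far K k N \<in> sets m"
  unfolding far_def sets_m
proof (rule sets.countable_UN'[OF _ image_subsetI])
  fix n assume "n \<in> {max N 1..}"
  then have "1 \<le> n" by simp
  from borel_comp[OF borel_open[OF open_near_set[OF this K]]]
  show "- {x. \<exists>\<nu>\<in>K. d (emp n x) \<nu> < inverse (real (Suc k))} \<in> sets borel" .
qed simp

lemma decseq_far: "decseq (far K k)"
  unfolding decseq_def far_def by (intro allI impI UN_mono) auto

lemma eventually_near_eq_far: "eventually_near K = - (\<Union>k. \<Inter>N. far K k N)"
proof (intro equalityI subsetI)
  fix x assume x: "x \<in> eventually_near K"
  have "\<exists>N. x \<notin> far K k N" for k
  proof -
    have "0 < inverse (real (Suc k))" by simp
    then obtain N where "\<And>n. N \<le> n \<Longrightarrow> 1 \<le> n \<Longrightarrow> \<exists>\<nu>\<in>K. d (emp n x) \<nu> < inverse (real (Suc k))"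
      using x unfolding eventually_near_def by blast
    then have "x \<notin> far K k N" unfolding far_def by auto
    then show ?thesis by blast
  qed
  then show "x \<in> - (\<Union>k. \<Inter>N. far K k N)" by blast
next
  fix x assume x: "x \<in> - (\<Union>k. \<Inter>N. far K k N)"
  show "x \<in> eventually_near K"
    unfolding eventually_near_def
  proof (intro CollectI allI impI)
    fix \<rho> :: real assume "0 < \<rho>"
    then obtain k where k: "inverse (real (Suc k)) < \<rho>" using reals_Archimedean by blast
    obtain N where N: "x \<notin> far K k N" using x by blast
    have "\<exists>\<nu>\<in>K. d (emp n x) \<nu> < \<rho>" if n: "max N 1 \<le> n" for n
    proof -
      have "\<exists>\<nu>\<in>K. d (emp n x) \<nu> < inverse (real (Suc k))" using N n unfolding far_def by auto
      then show ?thesis using k less_trans by blast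
    qed
    then show "\<exists>N. \<forall>n\<ge>N. 1 \<le> n \<longrightarrow> (\<exists>\<nu>\<in>K. d (emp n x) \<nu> < \<rho>)" by iprover
  qed
qed

lemma attracted_set_measurable:
  assumes "compactin weak_star_topology K"
  shows "{x. p_omega f x \<subseteq> K} \<in> sets m"
proof -
  have "(\<Union>k. \<Inter>N. far K k N) \<in> sets m"
    using far_sets[OF compact_imp_prob[OF assms]] by (intro sets.countable_UN sets.countable_INT) auto
  then have "space m - (\<Union>k. \<Inter>N. far K k N) \<in> sets m" by (rule sets.compl_sets)
  then show ?thesis
    unfolding eventually_near_eq[OF assms, symmetric] eventually_near_eq_far space_m Compl_eq_Diff_UNIV .
qed

lemma weak_basin_eq:
  assumes "\<mu> \<in> prob_measures"
  shows "weak_basin d f \<mu> \<rho> = {x. \<exists>\<nu>\<in>p_omega f x. d \<nu> \<mu> < \<rho>}"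
  unfolding weak_basin_def set_distance_less[OF p_omega_nonempty insert_not_empty] by simp

text \<open>A limit measure within less than \<open>\<rho>\<close> of \<open>\<mu>\<close> exists if and only if, for some margin \<open>1 / Suc k\<close>, the empiric
measures are infinitely often within \<open>\<rho>\<close> minus that margin of \<open>\<mu>\<close>. The margin keeps the inequality
strict in the limit.\<close>

lemma weak_basin_eq_frequently:
  assumes \<mu>: "\<mu> \<in> prob_measures"
  shows "weak_basin d f \<mu> \<rho> =
    (\<Union>k. \<Inter>N. \<Union>n\<in>{max N 1..}. {x. d (emp n x) \<mu> < \<rho> - inverse (real (Suc k))})" (is "_ = ?R")
  unfolding weak_basin_eq[OF \<mu>]
proof (intro equalityI subsetI)
  fix x assume "x \<in> {x. \<exists>\<nu>\<in>p_omega f x. d \<nu> \<mu> < \<rho>}"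
  then obtain \<nu> where \<nu>: "\<nu> \<in> p_omega f x" "d \<nu> \<mu> < \<rho>" by blast
  then obtain r where \<nu>p: "\<nu> \<in> prob_measures" and r: "strict_mono r" and lim: "(\<lambda>i. d (emp (r i) x) \<nu>) \<longlonglongrightarrow> 0"
    unfolding p_omega_iff by blast
  obtain k where k: "inverse (real (Suc k)) < (\<rho> - d \<nu> \<mu>) / 2"
    using reals_Archimedean[of "(\<rho> - d \<nu> \<mu>) / 2"] \<nu>(2) by auto
  have "\<exists>n\<in>{max N 1..}. d (emp n x) \<mu> < \<rho> - inverse (real (Suc k))" for N
  proof -
    have "0 < inverse (real (Suc k))" by simp
    from eventually_conj[OF order_tendstoD(2)[OF lim this] eventually_ge_at_top[of "max N 1"]]
    obtain i where i: "d (emp (r i) x) \<nu> < inverse (real (Suc k))" "max N 1 \<le> i"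
      using eventually_happens'[OF sequentially_bot] by blast
    have ri: "max N 1 \<le> r i" using i(2) strict_mono_imp_increasing[OF r, of i] by linarith
    then have "1 \<le> r i" by simp
    have "d (emp (r i) x) \<mu> \<le> d (emp (r i) x) \<nu> + d \<nu> \<mu>"
      by (rule triangle[OF emp_prob[OF \<open>1 \<le> r i\<close>] \<nu>p \<mu>])
    also have "\<dots> < (\<rho> - d \<nu> \<mu>) / 2 + d \<nu> \<mu>" using i(1) k by simp
    also have "\<dots> = \<rho> - (\<rho> - d \<nu> \<mu>) / 2" by (simp add: field_simps)
    also have "\<dots> < \<rho> - inverse (real (Suc k))" using k by simp
    finally have "d (emp (r i) x) \<mu> < \<rho> - inverse (real (Suc k))" .
    then show ?thesis using ri by (intro bexI[of _ "r i"]) simp_all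
  qed
  then have "x \<in> (\<Union>n\<in>{max N 1..}. {x. d (emp n x) \<mu> < \<rho> - inverse (real (Suc k))})" for N
    unfolding UN_iff mem_Collect_eq .
  then have "x \<in> (\<Inter>N. \<Union>n\<in>{max N 1..}. {x. d (emp n x) \<mu> < \<rho> - inverse (real (Suc k))})"
    by (rule INT_I)
  then show "x \<in> ?R" by (rule UN_I[OF UNIV_I])
next
  fix x assume "x \<in> ?R"
  then obtain k where k: "\<exists>n\<in>{max N 1..}. d (emp n x) \<mu> < \<rho> - inverse (real (Suc k))" for N
    unfolding UN_iff INT_iff mem_Collect_eq by auto
  have "\<exists>n\<ge>N. d (emp n x) \<mu> < \<rho> - inverse (real (Suc k))" for N using k[of N] by auto
  then have "\<exists>\<^sub>F n in sequentially. d (emp n x) \<mu> < \<rho> - inverse (real (Suc k))"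
    unfolding frequently_sequentially by iprover
  then obtain r \<nu> where r: "\<And>i. d (emp (r i) x) \<mu> < \<rho> - inverse (real (Suc k))" and mono: "strict_mono r"
    and \<nu>: "\<nu> \<in> p_omega f x" and lim: "(\<lambda>i. d (emp (r i) x) \<nu>) \<longlonglongrightarrow> 0"
    by (rule frequently_imp_limit_point) iprover
  have "0 < inverse (real (Suc k))" by simp
  from eventually_conj[OF order_tendstoD(2)[OF lim this] eventually_ge_at_top[of 1]]
  obtain i where i: "d (emp (r i) x) \<nu> < inverse (real (Suc k))" "1 \<le> i"
    using eventually_happens'[OF sequentially_bot] by blast
  have "1 \<le> r i" using i(2) strict_mono_imp_increasing[OF mono, of i] by linarith
  have "d \<nu> \<mu> \<le> d \<nu> (emp (r i) x) + d (emp (r i) x) \<mu>"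
    by (rule triangle[OF p_omega_prob[OF \<nu>] emp_prob[OF \<open>1 \<le> r i\<close>] \<mu>])
  then have "d \<nu> \<mu> < \<rho>" using i(1) r[of i] commute[of \<nu> "emp (r i) x"] by linarith
  then show "x \<in> {x. \<exists>\<nu>\<in>p_omega f x. d \<nu> \<mu> < \<rho>}" using \<nu> by blast
qed

lemma weak_basin_sets:
  assumes "\<mu> \<in> prob_measures"
  shows "weak_basin d f \<mu> \<rho> \<in> sets m"
  unfolding weak_basin_eq_frequently[OF assms] sets_m
  by (intro sets.countable_UN sets.countable_INT image_subsetI sets.countable_UN' borel_open open_emp_near assms) auto

section \<open>The set of pseudo-physical measures\<close>

abbreviation physical :: "'a measure set" where "physical \<equiv> {\<mu>. pseudo_physical d m f \<mu>}"

lemma invariant_prob: "\<mu> \<in> invariant_measures f \<Longrightarrow> \<mu> \<in> prob_measures"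
  by (simp add: invariant_measures_def)

lemma weak_basin_mono:
  assumes "\<mu> \<in> prob_measures" "\<nu> \<in> prob_measures" "\<rho> + d \<nu> \<mu> \<le> \<rho>'"
  shows "weak_basin d f \<nu> \<rho> \<subseteq> weak_basin d f \<mu> \<rho>'"
  unfolding weak_basin_eq[OF assms(1)] weak_basin_eq[OF assms(2)]
proof (intro subsetI CollectI)
  fix x assume "x \<in> {x. \<exists>l\<in>p_omega f x. d l \<nu> < \<rho>}"
  then obtain l where l: "l \<in> p_omega f x" "d l \<nu> < \<rho>" by blast
  have "d l \<mu> \<le> d l \<nu> + d \<nu> \<mu>" by (rule triangle[OF p_omega_prob[OF l(1)] assms(2,1)])
  then have "d l \<mu> < \<rho>'" using l(2) assms(3) by linarith
  then show "\<exists>l\<in>p_omega f x. d l \<mu> < \<rho>'" using l(1) by blast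
qed

lemma physical_mem_of_near:
  assumes \<mu>: "\<mu> \<in> invariant_measures f"
    and near: "\<And>\<rho>. 0 < \<rho> \<Longrightarrow> \<exists>\<nu>\<in>physical. d \<nu> \<mu> < \<rho>"
  shows "\<mu> \<in> physical"
  unfolding pseudo_physical_def
proof (intro CollectI conjI \<mu> allI impI)
  fix \<rho> :: real assume "0 < \<rho>"
  then have h: "0 < \<rho> / 2" by simp
  obtain \<nu> where \<nu>: "pseudo_physical d m f \<nu>" "d \<nu> \<mu> < \<rho> / 2" using near[OF h] by blast
  have \<nu>p: "\<nu> \<in> prob_measures" using \<nu>(1) invariant_prob unfolding pseudo_physical_def by blast
  have "0 < emeasure m (weak_basin d f \<nu> (\<rho> / 2))" using \<nu>(1) h unfolding pseudo_physical_def by blast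
  also have "\<dots> \<le> emeasure m (weak_basin d f \<mu> \<rho>)"
    by (rule emeasure_mono[OF weak_basin_mono weak_basin_sets]) (use invariant_prob[OF \<mu>] \<nu>p \<nu>(2) in simp_all)
  finally show "0 < emeasure m (weak_basin d f \<mu> \<rho>)" .
qed

lemma compact_prob_measures: "compactin mtopology prob_measures"
  unfolding compactin_sequentially
proof (intro conjI allI impI subset_refl)
  fix \<sigma> :: "nat \<Rightarrow> 'a measure" assume "range \<sigma> \<subseteq> prob_measures"
  then have \<sigma>: "\<sigma> n \<in> prob_measures" for n by blast
  obtain \<mu> r where "strict_mono (r :: nat \<Rightarrow> nat)" "\<mu> \<in> prob_measures"
    "limitin weak_star_topology (\<lambda>n. \<sigma> (r n)) \<mu> sequentially"
    by (rule convergent_subsequence[of \<sigma>, OF \<sigma>])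
  then show "\<exists>l r. l \<in> prob_measures \<and> strict_mono r \<and> limitin mtopology (\<sigma> \<circ> r) l sequentially"
    unfolding mtopology_eq o_def by blast
qed

lemma compactin_of_limit_closed:
  assumes "S \<subseteq> prob_measures"
    and closed: "\<And>\<mu> \<mu>'. (\<And>n::nat. \<mu> n \<in> S) \<Longrightarrow> \<mu>' \<in> prob_measures \<Longrightarrow> (\<lambda>n. d (\<mu> n) \<mu>') \<longlonglongrightarrow> 0 \<Longrightarrow> \<mu>' \<in> S"
  shows "compactin weak_star_topology S"
  unfolding mtopology_eq[symmetric] compactin_sequentially
proof (intro conjI allI impI assms(1))
  fix \<sigma> :: "nat \<Rightarrow> 'a measure" assume "range \<sigma> \<subseteq> S"
  then have \<sigma>S: "\<sigma> n \<in> S" for n by blast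
  then have \<sigma>: "\<sigma> n \<in> prob_measures" for n using assms(1) by blast
  obtain \<mu> r where r: "strict_mono (r :: nat \<Rightarrow> nat)" and \<mu>: "\<mu> \<in> prob_measures" and lim: "(\<lambda>n. d (\<sigma> (r n)) \<mu>) \<longlonglongrightarrow> 0"
    and l: "limitin weak_star_topology (\<lambda>n. \<sigma> (r n)) \<mu> sequentially"
    by (rule convergent_subsequence[of \<sigma>, OF \<sigma>])
  have "\<mu> \<in> S" by (rule closed[OF \<sigma>S \<mu> lim])
  with r l show "\<exists>l r. l \<in> S \<and> strict_mono r \<and> limitin mtopology (\<sigma> \<circ> r) l sequentially"
    unfolding mtopology_eq o_def by blast
qed

lemma invariant_closed:
  assumes "\<And>n. \<mu> n \<in> invariant_measures f" "\<mu>' \<in> prob_measures" "(\<lambda>n::nat. d (\<mu> n) \<mu>') \<longlonglongrightarrow> 0"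
  shows "\<mu>' \<in> invariant_measures f"
proof (rule invariant_limit[OF invariant_prob[OF assms(1)] assms(2,3)])
  fix \<phi> :: "'a \<Rightarrow> complex" assume "continuous_on UNIV \<phi>"
  then have "(\<integral>x. \<phi> (f x) \<partial>\<mu> n) = (\<integral>x. \<phi> x \<partial>\<mu> n)" for n
    using assms(1)[of n] unfolding invariant_iff by blast
  then show "(\<lambda>n. (\<integral>x. \<phi> (f x) \<partial>\<mu> n) - (\<integral>x. \<phi> x \<partial>\<mu> n)) \<longlonglongrightarrow> 0" by simp
qed

lemma physical_invariant: "physical \<subseteq> invariant_measures f"
  by (auto simp: pseudo_physical_def)

lemma compact_physical: "compactin weak_star_topology physical"
proof (rule compactin_of_limit_closed)
  show "physical \<subseteq> prob_measures" using physical_invariant invariant_prob by blast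
  fix \<mu> \<mu>' assume \<mu>: "\<And>n::nat. \<mu> n \<in> physical" and \<mu>': "\<mu>' \<in> prob_measures" and lim: "(\<lambda>n. d (\<mu> n) \<mu>') \<longlonglongrightarrow> 0"
  show "\<mu>' \<in> physical"
  proof (rule physical_mem_of_near)
    show "\<mu>' \<in> invariant_measures f"
      by (rule invariant_closed[OF subsetD[OF physical_invariant \<mu>] \<mu>' lim])
    fix \<rho> :: real assume "0 < \<rho>"
    then obtain n where "d (\<mu> n) \<mu>' < \<rho>"
      using eventually_happens'[OF sequentially_bot order_tendstoD(2)[OF lim]] by blast
    then show "\<exists>\<nu>\<in>physical. d \<nu> \<mu>' < \<rho>" using \<mu>[of n] by blast
  qed
qed

text \<open>Every invariant measure that is not pseudo-physical has a ball that almost no orbit accumulates in.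
Total boundedness of the space of measures yields countably many balls, with centres in the finite
nets \<open>F k\<close>, among which the null ones already cover all these measures.\<close>

lemma physical_attracts_almost_all: "{x. \<not> p_omega f x \<subseteq> physical} \<in> null_sets m"
proof -
  have "\<exists>F. finite F \<and> F \<subseteq> prob_measures \<and> prob_measures \<subseteq> (\<Union>c\<in>F. mball c (inverse (real (Suc k))))" for k
    using compactin_imp_mtotally_bounded[OF compact_prob_measures] unfolding mtotally_bounded_def by simp
  then obtain F where F: "\<And>k. finite (F k)" "\<And>k. F k \<subseteq> prob_measures"
    "\<And>k. prob_measures \<subseteq> (\<Union>c\<in>F k. mball c (inverse (real (Suc k))))"
    by metis
  define Z where "Z = (\<Union>k. \<Union>c\<in>{c \<in> F k. emeasure m (weak_basin d f c (inverse (real (Suc k)))) = 0}. weak_basin d f c (inverse (real (Suc k))))"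
  have "Z \<in> null_sets m"
    unfolding Z_def
  proof (rule null_sets_UN, rule null_sets_UN')
    fix k
    show "countable {c \<in> F k. emeasure m (weak_basin d f c (inverse (real (Suc k)))) = 0}"
      by (rule countable_finite) (use F(1)[of k] in simp)
    fix c assume c: "c \<in> {c \<in> F k. emeasure m (weak_basin d f c (inverse (real (Suc k)))) = 0}"
    then have "c \<in> prob_measures" using F(2)[of k] by blast
    then show "weak_basin d f c (inverse (real (Suc k))) \<in> null_sets m"
      using c weak_basin_sets by auto
  qed
  moreover have "{x. \<not> p_omega f x \<subseteq> physical} \<subseteq> Z"
  proof
    fix x assume "x \<in> {x. \<not> p_omega f x \<subseteq> physical}"
    then obtain \<mu> where \<mu>: "\<mu> \<in> p_omega f x" "\<not> pseudo_physical d m f \<mu>" by blast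
    have inv: "\<mu> \<in> invariant_measures f" using \<mu>(1) p_omega_invariant by blast
    have \<mu>p: "\<mu> \<in> prob_measures" by (rule p_omega_prob[OF \<mu>(1)])
    obtain \<rho> where \<rho>: "0 < \<rho>" "emeasure m (weak_basin d f \<mu> \<rho>) = 0"
      using \<mu>(2) inv unfolding pseudo_physical_def by (auto simp: not_less)
    then have "0 < \<rho> / 2" by simp
    then obtain k where k: "inverse (real (Suc k)) < \<rho> / 2" using reals_Archimedean by blast
    obtain c where c: "c \<in> F k" "d c \<mu> < inverse (real (Suc k))" using F(3)[of k] \<mu>p by auto
    have cp: "c \<in> prob_measures" using c(1) F(2)[of k] by blast
    have "weak_basin d f c (inverse (real (Suc k))) \<subseteq> weak_basin d f \<mu> \<rho>"
      by (rule weak_basin_mono[OF \<mu>p cp]) (use c(2) k in linarith)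
    then have "emeasure m (weak_basin d f c (inverse (real (Suc k)))) \<le> emeasure m (weak_basin d f \<mu> \<rho>)"
      by (rule emeasure_mono) (rule weak_basin_sets[OF \<mu>p])
    then have "emeasure m (weak_basin d f c (inverse (real (Suc k)))) = 0" using \<rho>(2) by simp
    moreover have "x \<in> weak_basin d f c (inverse (real (Suc k)))"
      unfolding weak_basin_eq[OF cp] using \<mu>(1) c(2) commute[of c \<mu>] by auto
    ultimately show "x \<in> Z" unfolding Z_def using c(1) by blast
  qed
  moreover have "{x. \<not> p_omega f x \<subseteq> physical} \<in> sets m"
    using sets.compl_sets[OF attracted_set_measurable[OF compact_physical]]
    unfolding space_m by (simp add: set_diff_eq)
  ultimately show ?thesis by (metis null_sets_subset)
qed

lemma emeasure_m_pos: "0 < emeasure m (space m)"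
proof -
  have "0 < emeasure m (b undefined 1)" by (rule ball_pos) simp
  also have "\<dots> \<le> emeasure m (space m)" by (rule emeasure_space)
  finally show ?thesis .
qed

lemma full_measure_nonempty: "- S \<in> null_sets m \<Longrightarrow> S \<noteq> {}"
  using emeasure_m_pos space_m by auto

lemma physical_nonempty: "physical \<noteq> {}"
proof -
  have "- {x. p_omega f x \<subseteq> physical} \<in> null_sets m"
    using physical_attracts_almost_all by (simp add: Compl_eq)
  then obtain x where "p_omega f x \<subseteq> physical" using full_measure_nonempty by blast
  with p_omega_nonempty[of x] show ?thesis by blast
qed

text \<open>A weak basin of positive volume meets the basin of \<open>K\<close>, so every pseudo-physical measure is
arbitrarily close to elements of \<open>K\<close>.\<close>

lemma physical_minimal:
  assumes K: "compactin weak_star_topology K" and full: "- {x. p_omega f x \<subseteq> K} \<in> null_sets m"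
  shows "physical \<subseteq> K"
proof
  fix \<mu> assume "\<mu> \<in> physical"
  then have \<mu>: "pseudo_physical d m f \<mu>" by simp
  then have \<mu>p: "\<mu> \<in> prob_measures" using invariant_prob unfolding pseudo_physical_def by blast
  show "\<mu> \<in> K"
  proof (rule compact_mem_of_near[OF K \<mu>p])
    fix \<rho> :: real assume "0 < \<rho>"
    then have pos: "0 < emeasure m (weak_basin d f \<mu> \<rho>)" using \<mu> unfolding pseudo_physical_def by blast
    have "\<not> weak_basin d f \<mu> \<rho> \<subseteq> - {x. p_omega f x \<subseteq> K}"
    proof
      assume "weak_basin d f \<mu> \<rho> \<subseteq> - {x. p_omega f x \<subseteq> K}"
      then have "weak_basin d f \<mu> \<rho> \<in> null_sets m" by (rule null_sets_subset[OF full weak_basin_sets[OF \<mu>p]])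
      with pos show False by auto
    qed
    then obtain x where x: "x \<in> weak_basin d f \<mu> \<rho>" "p_omega f x \<subseteq> K" by blast
    then obtain \<nu> where "\<nu> \<in> p_omega f x" "d \<nu> \<mu> < \<rho>" unfolding weak_basin_eq[OF \<mu>p] by blast
    then have "\<nu> \<in> K" "d \<mu> \<nu> < \<rho>" using x(2) by (auto simp: commute[of \<mu> \<nu>])
    then show "\<exists>\<nu>\<in>K. d \<mu> \<nu> < \<rho>" by blast
  qed
qed

lemma uniformly_attracted_set:
  assumes K: "compactin weak_star_topology K" and full: "- {x. p_omega f x \<subseteq> K} \<in> null_sets m"
  obtains A where "A \<in> sets m" "0 < emeasure m A"
    "\<And>\<rho>. 0 < \<rho> \<Longrightarrow> \<exists>N. \<forall>n\<ge>N. 1 \<le> n \<longrightarrow> (\<forall>x\<in>A. \<exists>\<nu>\<in>K. d (emp n x) \<nu> < \<rho>)"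
proof -
  note Kp = compact_imp_prob[OF K]
  have null: "(\<Inter>N. far K k N) \<in> null_sets m" for k
  proof (rule null_sets_subset[OF full])
    show "(\<Inter>N. far K k N) \<in> sets m" using far_sets[OF Kp] by (intro sets.countable_INT) auto
    show "(\<Inter>N. far K k N) \<subseteq> - {x. p_omega f x \<subseteq> K}"
      unfolding eventually_near_eq[OF K, symmetric] eventually_near_eq_far by blast
  qed
  obtain A where A: "A \<in> sets m" "0 < emeasure m A" "\<And>k. \<exists>N. A \<inter> far K k N = {}"
    by (rule egorov[OF finite_m emeasure_m_pos far_sets[OF Kp] decseq_far null]) iprover
  show ?thesis
  proof (rule that[OF A(1,2)])
    fix \<rho> :: real assume "0 < \<rho>"
    then obtain k where k: "inverse (real (Suc k)) < \<rho>" using reals_Archimedean by blast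
    obtain N where N: "A \<inter> far K k N = {}" using A(3) by blast
    have "\<exists>\<nu>\<in>K. d (emp n x) \<nu> < \<rho>" if n: "N \<le> n" "1 \<le> n" and x: "x \<in> A" for n x
    proof -
      have "x \<notin> far K k N" using N x by blast
      then have "\<exists>\<nu>\<in>K. d (emp n x) \<nu> < inverse (real (Suc k))" using n unfolding far_def by auto
      then show ?thesis using k less_trans by blast
    qed
    then show "\<exists>N. \<forall>n\<ge>N. 1 \<le> n \<longrightarrow> (\<forall>x\<in>A. \<exists>\<nu>\<in>K. d (emp n x) \<nu> < \<rho>)" by blast
  qed
qed

section \<open>Stable sets and pseudo-physical measures\<close>

text \<open>If \<open>\<mu> \<in> K\<close> has a null weak basin of radius \<open>\<rho>\<close>, the set \<open>K'\<close> of the elements of \<open>K\<close> at distance at least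
\<open>\<rho>\<close> from \<open>\<mu>\<close> is a competitor of \<open>K\<close> in the minimality condition that does not contain \<open>\<mu>\<close>. It is nonempty
because the basin of \<open>K\<close> has positive volume, so that some of its orbits do not accumulate near \<open>\<mu>\<close>.\<close>

lemma stochastically_stable_imp_physical:
  assumes stable: "stochastically_stable d b m f K"
  shows "K \<subseteq> physical"
proof (rule ccontr)
  have K: "K \<noteq> {}" "K \<subseteq> invariant_measures f" "compactin weak_star_topology K"
    using stable unfolding stochastically_stable_def by iprover+
  assume "\<not> K \<subseteq> physical"
  then obtain \<mu> where \<mu>: "\<mu> \<in> K" "\<not> pseudo_physical d m f \<mu>" by blast
  note Kp = compact_imp_prob[OF K(3)]
  have \<mu>p: "\<mu> \<in> prob_measures" using Kp \<mu>(1) by blast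
  have "\<mu> \<in> invariant_measures f" using K(2) \<mu>(1) by blast
  then obtain \<rho> where \<rho>: "0 < \<rho>" "emeasure m (weak_basin d f \<mu> \<rho>) = 0"
    using \<mu>(2) unfolding pseudo_physical_def by (auto simp: not_less)
  have null: "weak_basin d f \<mu> \<rho> \<in> null_sets m"
    using weak_basin_sets[OF \<mu>p] \<rho>(2) by (rule null_setsI[rotated])
  define K' where "K' = {\<nu> \<in> K. \<rho> \<le> d \<nu> \<mu>}"
  have K'K: "K' \<subseteq> K" by (auto simp: K'_def)
  have sub: "p_omega f x \<subseteq> K'" if "p_omega f x \<subseteq> K" "x \<notin> weak_basin d f \<mu> \<rho>" for x
    using that unfolding weak_basin_eq[OF \<mu>p] K'_def by (auto simp: not_less)
  have stableA: "\<exists>A\<in>sets m. 0 < emeasure m A \<and>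
        (\<forall>\<rho>>0. \<exists>N. \<forall>n\<ge>N. \<exists>\<epsilon>\<^sub>0>0. \<forall>\<epsilon>. 0 < \<epsilon> \<and> \<epsilon> \<le> \<epsilon>\<^sub>0 \<longrightarrow>
           (\<forall>x\<in>A. set_distance d {noisy_emp \<epsilon> n x} K < \<rho>))"
    and minimal: "\<forall>K'. K' \<noteq> {} \<and> K' \<subseteq> invariant_measures f \<and> compactin weak_star_topology K' \<and>
        subset_ae m (stochastic_basin d b m f K) (stochastic_basin d b m f K') \<longrightarrow> K \<subseteq> K'"
    using stable unfolding stochastically_stable_def by iprover+
  obtain A where A: "A \<in> sets m" "0 < emeasure m A"
    and A_near: "\<forall>\<rho>>0. \<exists>N. \<forall>n\<ge>N. \<exists>\<epsilon>\<^sub>0>0. \<forall>\<epsilon>. 0 < \<epsilon> \<and> \<epsilon> \<le> \<epsilon>\<^sub>0 \<longrightarrow>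
           (\<forall>x\<in>A. set_distance d {noisy_emp \<epsilon> n x} K < \<rho>)"
    using stableA by (elim bexE conjE)
  have "A \<subseteq> stochastic_basin d b m f K"
  proof
    fix x assume "x \<in> A"
    show "x \<in> stochastic_basin d b m f K"
      unfolding stochastic_basin_def
    proof (intro CollectI allI impI)
      fix \<rho> :: real assume "0 < \<rho>"
      with A_near obtain N where "\<forall>n\<ge>N. \<exists>\<epsilon>\<^sub>0>0. \<forall>\<epsilon>. 0 < \<epsilon> \<and> \<epsilon> \<le> \<epsilon>\<^sub>0 \<longrightarrow>
           (\<forall>x\<in>A. set_distance d {noisy_emp \<epsilon> n x} K < \<rho>)" by iprover
      with \<open>x \<in> A\<close> show "\<exists>N. \<forall>n\<ge>N. \<exists>\<epsilon>\<^sub>0>0. \<forall>\<epsilon>. 0 < \<epsilon> \<and> \<epsilon> \<le> \<epsilon>\<^sub>0 \<longrightarrow>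
           set_distance d {noisy_emp \<epsilon> n x} K < \<rho>" by meson
    qed
  qed
  then have AK: "A \<subseteq> {x. p_omega f x \<subseteq> K}" unfolding stochastic_basin_eq[OF K(1,3)] .
  have "\<not> A \<subseteq> weak_basin d f \<mu> \<rho>"
  proof
    assume "A \<subseteq> weak_basin d f \<mu> \<rho>"
    then have "A \<in> null_sets m" by (rule null_sets_subset[OF null A(1)])
    with A(2) show False by auto
  qed
  then obtain x where x: "x \<in> A" "x \<notin> weak_basin d f \<mu> \<rho>" by blast
  have "p_omega f x \<subseteq> K'" using AK x by (intro sub) auto
  then have ne: "K' \<noteq> {}" using p_omega_nonempty by blast
  have cpt: "compactin weak_star_topology K'"
  proof (rule compactin_of_limit_closed)
    show "K' \<subseteq> prob_measures" using K'K Kp by blast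
    fix \<nu> \<nu>' assume \<nu>: "\<And>n::nat. \<nu> n \<in> K'" and \<nu>': "\<nu>' \<in> prob_measures" and lim: "(\<lambda>n. d (\<nu> n) \<nu>') \<longlonglongrightarrow> 0"
    have \<nu>K: "\<nu> n \<in> K" "\<rho> \<le> d (\<nu> n) \<mu>" for n using \<nu>[of n] by (simp_all add: K'_def)
    have \<nu>p: "\<nu> n \<in> prob_measures" for n using Kp \<nu>K(1) by blast
    have "\<nu>' \<in> K"
    proof (rule compact_mem_of_near[OF K(3) \<nu>'])
      fix \<rho> :: real assume "0 < \<rho>"
      then obtain n where "d (\<nu> n) \<nu>' < \<rho>"
        using eventually_happens'[OF sequentially_bot order_tendstoD(2)[OF lim]] by blast
      then have "d \<nu>' (\<nu> n) < \<rho>" by (simp add: commute[of \<nu>' "\<nu> n"])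
      then show "\<exists>l\<in>K. d \<nu>' l < \<rho>" using \<nu>K(1)[of n] by blast
    qed
    moreover have "\<rho> \<le> d \<nu>' \<mu>"
    proof -
      have "\<rho> - d \<nu>' \<mu> \<le> d (\<nu> n) \<nu>'" for n
        using triangle[OF \<nu>p[of n] \<nu>' \<mu>p] \<nu>K(2)[of n] by linarith
      then have "\<rho> - d \<nu>' \<mu> \<le> 0" by (intro LIMSEQ_le_const[OF lim]) blast
      then show ?thesis by simp
    qed
    ultimately show "\<nu>' \<in> K'" by (simp add: K'_def)
  qed
  have "subset_ae m (stochastic_basin d b m f K) (stochastic_basin d b m f K')"
    unfolding subset_ae_def stochastic_basin_eq[OF K(1,3)] stochastic_basin_eq[OF ne cpt]
  proof (rule null_sets_subset[OF null])
    show "{x. p_omega f x \<subseteq> K} - {x. p_omega f x \<subseteq> K'} \<in> sets m"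
      by (intro sets.Diff attracted_set_measurable K(3) cpt)
    show "{x. p_omega f x \<subseteq> K} - {x. p_omega f x \<subseteq> K'} \<subseteq> weak_basin d f \<mu> \<rho>"
      using sub by blast
  qed
  with minimal ne cpt K'K K(2) have "K \<subseteq> K'" by (meson order_trans)
  with \<mu>(1) have "\<rho> \<le> d \<mu> \<mu>" by (auto simp: K'_def)
  with \<rho>(1) \<mu>p show False by simp
qed

lemma full_measure_iff: "full_measure m S \<longleftrightarrow> - S \<in> null_sets m"
  by (simp add: full_measure_def space_m Compl_eq_Diff_UNIV)

lemma physical_globally_stable: "globally_stochastically_stable d b m f physical"
proof -
  note ne = physical_nonempty and cpt = compact_physical
  have full: "- {x. p_omega f x \<subseteq> physical} \<in> null_sets m"
    using physical_attracts_almost_all by (simp add: Compl_eq)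
  note Kp = compact_imp_prob[OF cpt]
  obtain A where A: "A \<in> sets m" "0 < emeasure m A"
    and near: "\<And>\<rho>. 0 < \<rho> \<Longrightarrow> \<exists>N. \<forall>n\<ge>N. 1 \<le> n \<longrightarrow> (\<forall>x\<in>A. \<exists>\<nu>\<in>physical. d (emp n x) \<nu> < \<rho>)"
    by (rule uniformly_attracted_set[OF cpt full]) iprover
  have unif: "\<exists>N. \<forall>n\<ge>N. \<exists>\<epsilon>\<^sub>0>0. \<forall>\<epsilon>. 0 < \<epsilon> \<and> \<epsilon> \<le> \<epsilon>\<^sub>0 \<longrightarrow>
           (\<forall>x\<in>A. set_distance d {noisy_emp \<epsilon> n x} physical < \<rho>)" if "0 < \<rho>" for \<rho>
  proof -
    have h: "0 < \<rho> / 2" using that by simp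
    obtain N where N: "\<forall>n\<ge>N. 1 \<le> n \<longrightarrow> (\<forall>x\<in>A. \<exists>\<nu>\<in>physical. d (emp n x) \<nu> < \<rho> / 2)"
      using near[OF h] by (elim exE)
    have "\<exists>\<epsilon>\<^sub>0>0. \<forall>\<epsilon>. 0 < \<epsilon> \<and> \<epsilon> \<le> \<epsilon>\<^sub>0 \<longrightarrow> (\<forall>x\<in>A. set_distance d {noisy_emp \<epsilon> n x} physical < \<rho>)"
      if n: "max N 1 \<le> n" for n
    proof -
      have n': "N \<le> n" "1 \<le> n" using n by auto
      obtain e1 where e1: "0 < e1"
        "\<And>e x. 0 < e \<Longrightarrow> e \<le> e1 \<Longrightarrow> \<exists>\<nu>\<in>physical. d (emp n x) \<nu> < \<rho> / 2 \<Longrightarrow>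
          set_distance d {noisy_emp e n x} physical < 2 * (\<rho> / 2)"
        by (rule near_uniform_transfer[OF ne Kp n'(2) h]) iprover
      have "set_distance d {noisy_emp e n x} physical < \<rho>" if e: "0 < e" "e \<le> e1" and x: "x \<in> A" for e x
        using e1(2)[OF e, of x] N n' x by auto
      with e1(1) show ?thesis by blast
    qed
    then show ?thesis by iprover
  qed
  have min: "physical \<subseteq> K'"
    if K': "K' \<noteq> {}" "compactin weak_star_topology K'"
      and ae: "subset_ae m (stochastic_basin d b m f physical) (stochastic_basin d b m f K')" for K'
  proof (rule physical_minimal[OF K'(2)])
    have "{x. p_omega f x \<subseteq> physical} - {x. p_omega f x \<subseteq> K'} \<in> null_sets m"
      using ae unfolding subset_ae_def stochastic_basin_eq[OF ne cpt] stochastic_basin_eq[OF K'] .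
    from null_sets.Un[OF this full]
    show "- {x. p_omega f x \<subseteq> K'} \<in> null_sets m"
      by (rule null_sets_subset) (use attracted_set_measurable[OF K'(2)] sets_m in auto)
  qed
  have "stochastically_stable d b m f physical"
    unfolding stochastically_stable_def
    by (intro conjI ne physical_invariant cpt bexI[OF _ A(1)] A(2) allI impI unif)
       (assumption, elim conjE, erule (2) min)
  moreover have "full_measure m (stochastic_basin d b m f physical)"
    unfolding full_measure_iff stochastic_basin_eq[OF ne cpt] by (rule full)
  ultimately show ?thesis unfolding globally_stochastically_stable_def by (rule conjI)
qed

lemma globally_stable_iff:
  "globally_stochastically_stable d b m f K \<longleftrightarrow> K = physical"
proof
  assume G: "globally_stochastically_stable d b m f K"
  then have stable: "stochastically_stable d b m f K"
    and full: "full_measure m (stochastic_basin d b m f K)"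
    unfolding globally_stochastically_stable_def by simp_all
  have K: "K \<noteq> {}" "K \<subseteq> invariant_measures f" "compactin weak_star_topology K"
    using stable unfolding stochastically_stable_def by iprover+
  have "physical \<subseteq> K"
    by (rule physical_minimal[OF K(3)])
       (use full in \<open>simp add: full_measure_iff stochastic_basin_eq[OF K(1,3)]\<close>)
  with stochastically_stable_imp_physical[OF stable] show "K = physical" by (rule equalityI)
qed (simp only: physical_globally_stable)

end

theorem theorem2:
  fixes f :: "'a::{t2_space,second_countable_topology} \<Rightarrow> 'a"
    and \<A> :: "('a, 'n::finite) chart set"
    and g :: "('a, 'n) local_metric"
    and m :: "'a measure"
    and d :: "'a measure \<Rightarrow> 'a measure \<Rightarrow> real"
  assumes "compact_riemannian_manifold \<A> g"
    and "riemannian_volume \<A> g m"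
    and "induces_weak_star d"
    and "continuous_on UNIV f"
  shows "(\<forall>K. K \<noteq> {} \<and> K \<subseteq> invariant_measures f \<and> compactin weak_star_topology K \<and>
            stochastically_stable d (riemannian_ball \<A> g) m f K \<longrightarrow>
            (\<forall>\<mu>\<in>K. pseudo_physical d m f \<mu>)) \<and>
         (\<forall>K. K \<subseteq> invariant_measures f \<longrightarrow>
            (globally_stochastically_stable d (riemannian_ball \<A> g) m f K \<longleftrightarrow>
             K = {\<mu>. pseudo_physical d m f \<mu>}))"
proof -
  interpret riemannian_with_volume \<A> g m
    by unfold_locales (rule assms)+
  interpret noisy_dynamics d f m "riemannian_ball \<A> g"
  proof (intro noisy_dynamics.intro weak_star_metric.intro noisy_dynamics_axioms.intro)
    show "compact (UNIV :: 'a set)" using assms(1) by (simp add: compact_riemannian_manifold_def)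
    show "open {(x, y). y \<in> riemannian_ball \<A> g x e}" for e by (rule open_riemannian_ball_relation)
    show "riemannian_ball \<A> g x e \<subseteq> riemannian_ball \<A> g x e'" if "e \<le> e'" for x e e'
      by (rule riemannian_ball_mono[OF that])
    show "0 < emeasure m (riemannian_ball \<A> g x e)" if "0 < e" for x e
    proof (rule volume_open_pos[OF _ self_in_riemannian_ball[OF that]])
      have "open (Pair x -` {(x, y). y \<in> riemannian_ball \<A> g x e})"
        by (rule open_vimage[OF open_riemannian_ball_relation]) (intro continuous_intros)
      then show "open (riemannian_ball \<A> g x e)" by (simp add: vimage_def)
    qed
    show "\<exists>V e. open V \<and> x \<in> V \<and> 0 < e \<and> (\<forall>y\<in>V. riemannian_ball \<A> g y e \<subseteq> U)"
      if U: "open U" "x \<in> U" for x U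
    proof -
      obtain V e where "open V" "x \<in> V" "0 < e" "\<And>y. y \<in> V \<Longrightarrow> riemannian_ball \<A> g y e \<subseteq> U"
        by (rule riemannian_balls_small[OF U]) iprover
      then show ?thesis by blast
    qed
    show "finite_measure m" "sets m = sets borel" by (rule finite_volume, rule sets_volume)
  qed (rule assms)+
  show ?thesis
  proof (intro conjI allI impI ballI globally_stable_iff)
    fix K \<mu>
    assume "K \<noteq> {} \<and> K \<subseteq> invariant_measures f \<and> compactin weak_star_topology K \<and>
      stochastically_stable d (riemannian_ball \<A> g) m f K" and "\<mu> \<in> K"
    then show "pseudo_physical d m f \<mu>" using stochastically_stable_imp_physical[of K] by blast
  qed
qed

end
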